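(* Let $p,q$ be odd primes with $q-p=2$, let $\varepsilon\in\{1,-1\}$, and let $E/\mathbb{Q}$ be the elliptic curve $y^2=x(x+\varepsilon p)(x+\varepsilon q)$. Let $D=D_1\cdots D_n$ ($n\ge 0$) be a product of $n$ distinct odd primes with $\gcd(pq,D)=1$, let $\mu\in\{1,-1\}$ with $\mu D\neq 1$, let $K=\mathbb{Q}(\sqrt{\mu D})$ and put $\mu_0=(1-\mu)/2$. Then $2n+\mu_0\le \delta(E,\mathbb{Q},K)\le 2n+4+\mu_0$. More precisely (all symbols $(\frac{\cdot}{\cdot})$ are Legendre symbols): (1) $\delta(E,\mathbb{Q},K)=2n+\mu_0$ if and only if $D\equiv\mu \pmod 8$ and $(\frac{\mu D}{p})=(\frac{\mu D}{q})=1$. (2) $\delta(E,\mathbb{Q},K)=2n+1+\mu_0$ if and only if one of the following holds: (2a) $D\equiv 5\mu\pmod 8$ and $(\frac{\mu D}{p})=(\frac{\mu D}{q})=1$; (2b) $D\equiv 7\mu\pmod 8$, $p\equiv 3\pmod 4$ and $(\frac{\mu D}{p})=(\frac{\mu D}{q})=1$; (2c) $D\equiv 3\mu\pmod 8$, $p\equiv 1\pmod 4$ and $(\frac{\mu D}{p})=(\frac{\mu D}{q})=1$; (2d) $D\equiv\mu\pmod 8$ and $(\frac{\mu D}{p})+(\frac{\mu D}{q})=0$. (3) $\delta(E,\mathbb{Q},K)=2n+2+\mu_0$ if and only if one of the following holds: (3a) $D\equiv 7\mu\pmod 8$, $p\equiv 1\pmod 4$ and $(\frac{\mu D}{p})=(\frac{\mu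 D}{q})=1$; (3b) $D\equiv 3\mu\pmod 8$, $p\equiv 3\pmod 4$ and $(\frac{\mu D}{p})=(\frac{\mu D}{q})=1$; (3c) $D\equiv 5\mu\pmod 8$ and $(\frac{\mu D}{p})+(\frac{\mu D}{q})=0$; (3d) $D\equiv 7\mu\pmod 8$, $p\equiv 3\pmod 4$ and $(\frac{\mu D}{p})+(\frac{\mu D}{q})=0$; (3e) $D\equiv 3\mu\pmod 8$, $p\equiv 1\pmod 4$ and $(\frac{\mu D}{p})+(\frac{\mu D}{q})=0$; (3f) $D\equiv\mu\pmod 8$ and $(\frac{\mu D}{p})=(\frac{\mu D}{q})=-1$. (4) $\delta(E,\mathbb{Q},K)=2n+3+\mu_0$ if and only if one of the following holds: (4a) $D\equiv 7\mu\pmod 8$, $p\equiv 1\pmod 4$ and $(\frac{\mu D}{p})+(\frac{\mu D}{q})=0$; (4b) $D\equiv 3\mu\pmod 8$, $p\equiv 3\pmod 4$ and $(\frac{\mu D}{p})+(\frac{\mu D}{q})=0$; (4c) $D\equiv 5\mu\pmod 8$ and $(\frac{\mu D}{p})=(\frac{\mu D}{q})=-1$; (4d) $D\equiv 7\mu\pmod 8$, $p\equiv 3\pmod 4$ and $(\frac{\mu D}{p})=(\frac{\mu D}{q})=-1$; (4e) $D\equiv 3\mu\pmod 8$, $p\equiv 1\pmod 4$ and $(\frac{\mu D}{p})=(\frac{\mu D}{q})=-1$. (5) $\delta(E,\mathbb{Q},K)=2n+4+\mu_0$ if and only if one of the following holds: (5a) $D\equiv 7\mu\pmod 8$, $p\equiv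 1\pmod 4$ and $(\frac{\mu D}{p})=(\frac{\mu D}{q})=-1$; (5b) $D\equiv 3\mu\pmod 8$, $p\equiv 3\pmod 4$ and $(\frac{\mu D}{p})=(\frac{\mu D}{q})=-1$.
   Context: For an elliptic curve $E$ over $\mathbb{Q}$ and a quadratic field $K$, for each place $v$ of $\mathbb{Q}$ (finite or infinite) fix a place $w$ of $K$ above $v$, and let $\delta_v=\log_2\big[E(\mathbb{Q}_v):N_{K_w/\mathbb{Q}_v}(E(K_w))\big]$ be the local norm index, where $N_{K_w/\mathbb{Q}_v}:E(K_w)\to E(\mathbb{Q}_v)$ is the norm (trace) map (trivially $\delta_v=0$ if $K_w=\mathbb{Q}_v$). Define $\delta(E,\mathbb{Q},K)=\sum_{v}\delta_v$, the sum over all places of $\mathbb{Q}$. *)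

theory Defs
  imports "HOL-Algebra.Ring" "HOL-Number_Theory.Number_Theory"
begin

definition padic_val_rat :: "nat \<Rightarrow> rat \<Rightarrow> int" where
  "padic_val_rat p x = (case quotient_of x of (a, b) \<Rightarrow>
      int (multiplicity (int p) a) - int (multiplicity (int p) b))"

definition padic_abs :: "nat \<Rightarrow> rat \<Rightarrow> real" where
  "padic_abs p x = (if x = 0 then 0 else real p powr (- real_of_int (padic_val_rat p x)))"

definition padic_cauchy :: "nat \<Rightarrow> (nat \<Rightarrow> rat) \<Rightarrow> bool" where
  "padic_cauchy p X \<longleftrightarrow> (\<forall>e>0. \<exists>N. \<forall>m\<ge>N. \<forall>k\<ge>N. padic_abs p (X m - X k) < e)"

definition padic_null :: "nat \<Rightarrow> (nat \<Rightarrow> rat) \<Rightarrow> bool" where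
  "padic_null p X \<longleftrightarrow> (\<forall>e>0. \<exists>N. \<forall>m\<ge>N. padic_abs p (X m) < e)"

definition padic_class :: "nat \<Rightarrow> (nat \<Rightarrow> rat) \<Rightarrow> (nat \<Rightarrow> rat) set" where
  "padic_class p X = {Y. padic_cauchy p Y \<and> padic_null p (\<lambda>n. X n - Y n)}"

definition padic_rep :: "(nat \<Rightarrow> rat) set \<Rightarrow> nat \<Rightarrow> rat" where
  "padic_rep A = (SOME X. X \<in> A)"

definition Qp :: "nat \<Rightarrow> (nat \<Rightarrow> rat) set ring" where
  "Qp p = \<lparr> carrier = padic_class p ` {X. padic_cauchy p X},
            mult = (\<lambda>A B. padic_class p (\<lambda>n. padic_rep A n * padic_rep B n)),
            one = padic_class p (\<lambda>_. 1),
            zero = padic_class p (\<lambda>_. 0),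
            add = (\<lambda>A B. padic_class p (\<lambda>n. padic_rep A n + padic_rep B n)) \<rparr>"

definition Qp_of_int :: "nat \<Rightarrow> int \<Rightarrow> (nat \<Rightarrow> rat) set" where
  "Qp_of_int p k = padic_class p (\<lambda>_. of_int k)"

definition real_field :: "real ring" where
  "real_field = \<lparr> carrier = UNIV, mult = (*), one = 1, zero = 0, add = (+) \<rparr>"

section \<open>Quadratic extension F(sqrt d) = F[t]/(t^2 - d) as pairs (a,b) = a + b sqrt d\<close>

definition quad_ext :: "('a, 'm) ring_scheme \<Rightarrow> 'a \<Rightarrow> ('a \<times> 'a) ring" where
  "quad_ext R d = \<lparr> carrier = carrier R \<times> carrier R,
     mult = (\<lambda>(a, b) (c, e). (add R (mult R a c) (mult R d (mult R b e)),
                              add R (mult R a e) (mult R b c))),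
     one = (one R, zero R),
     zero = (zero R, zero R),
     add = (\<lambda>(a, b) (c, e). (add R a c, add R b e)) \<rparr>"

definition quad_conj :: "('a, 'm) ring_scheme \<Rightarrow> 'a \<times> 'a \<Rightarrow> 'a \<times> 'a" where
  "quad_conj R z = (fst z, a_inv R (snd z))"

text \<open>Points: None is the point at infinity O, Some (x,y) an affine point.\<close>
definition ec_points :: "('a, 'm) ring_scheme \<Rightarrow> 'a \<Rightarrow> 'a \<Rightarrow> ('a \<times> 'a) option set" where
  "ec_points R a2 a4 = insert None
     {Some (x, y) | x y. x \<in> carrier R \<and> y \<in> carrier R \<and>
        mult R y y = add R (add R (mult R x (mult R x x)) (mult R a2 (mult R x x))) (mult R a4 x)}"

definition ec_add :: "('a, 'm) ring_scheme \<Rightarrow> 'a \<Rightarrow> 'a \<Rightarrow>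
    ('a \<times> 'a) option \<Rightarrow> ('a \<times> 'a) option \<Rightarrow> ('a \<times> 'a) option" where
  "ec_add R a2 a4 P Q =
    (case P of None \<Rightarrow> Q
     | Some (x1, y1) \<Rightarrow> (case Q of None \<Rightarrow> P
       | Some (x2, y2) \<Rightarrow>
         (if x1 = x2 \<and> y1 = a_inv R y2 then None
          else let
            two = add R (one R) (one R);
            three = add R two (one R);
            lam = (if x1 = x2
                   then mult R (add R (add R (mult R three (mult R x1 x1)) (mult R two (mult R a2 x1))) a4)
                               (m_inv R (mult R two y1))
                   else mult R (a_minus R y2 y1) (m_inv R (a_minus R x2 x1)));
            x3 = a_minus R (a_minus R (a_minus R (mult R lam lam) a2) x1) x2;
            y3 = a_inv R (add R (mult R lam (a_minus R x3 x1)) y1)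
          in Some (x3, y3))))"

text \<open>Norm (trace) map E(F(sqrt d)) -> E(F), P |-> P + sigma(P); the result has rational
  (i.e. F-) coordinates, which we project back to F.\<close>
definition ec_norm :: "('a, 'm) ring_scheme \<Rightarrow> 'a \<Rightarrow> 'a \<Rightarrow> 'a \<Rightarrow>
    (('a \<times> 'a) \<times> ('a \<times> 'a)) option \<Rightarrow> ('a \<times> 'a) option" where
  "ec_norm R d a2 a4 P =
    map_option (\<lambda>(x, y). (fst x, fst y))
      (ec_add (quad_ext R d) (a2, zero R) (a4, zero R) P
         (map_option (\<lambda>(x, y). (quad_conj R x, quad_conj R y)) P))"

definition norm_index :: "('a, 'm) ring_scheme \<Rightarrow> 'a \<Rightarrow> 'a \<Rightarrow> 'a \<Rightarrow> nat" where
  "norm_index R d a2 a4 =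
    (let N = ec_norm R d a2 a4 ` ec_points (quad_ext R d) (a2, zero R) (a4, zero R)
     in card ((\<lambda>P. ec_add R a2 a4 P ` N) ` ec_points R a2 a4))"

text \<open>delta_v for the local field F = Q_v (with embedding emb : Z -> F), K = Q(sqrt d):
  if d is a square in Q_v then K_w = Q_v and delta_v = 0; otherwise K_w = Q_v(sqrt d).\<close>
definition local_delta :: "('a, 'm) ring_scheme \<Rightarrow> (int \<Rightarrow> 'a) \<Rightarrow> int \<Rightarrow> int \<Rightarrow> int \<Rightarrow> real" where
  "local_delta R emb a2 a4 d =
    (if \<exists>s\<in>carrier R. mult R s s = emb d then 0
     else log 2 (real (norm_index R (emb d) (emb a2) (emb a4))))"

text \<open>Places of Q: None = the infinite place, Some p = the p-adic place (p prime).\<close>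
definition places_Q :: "nat option set" where
  "places_Q = insert None (Some ` {p. prime p})"

definition place_delta :: "int \<Rightarrow> int \<Rightarrow> int \<Rightarrow> nat option \<Rightarrow> real" where
  "place_delta a2 a4 d v = (case v of
      None \<Rightarrow> local_delta real_field of_int a2 a4 d
    | Some p \<Rightarrow> local_delta (Qp p) (Qp_of_int p) a2 a4 d)"

text \<open>delta(E, Q, Q(sqrt d)) for E : y^2 = x^3 + a2 x^2 + a4 x: the sum over all places
  (only finitely many terms are nonzero, so we sum over the support).\<close>
definition delta_EQK :: "int \<Rightarrow> int \<Rightarrow> int \<Rightarrow> real" where
  "delta_EQK a2 a4 d = (\<Sum>v\<in>{v\<in>places_Q. place_delta a2 a4 d v \<noteq> 0}. place_delta a2 a4 d v)"

end

theory Submission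
  imports Defs "HOL-Library.Z2" "HOL-Library.Product_Plus"
begin

text \<open>
  For E: y^2 = x(x + a)(x + b) over a local field F, the Kummer map sends (x, y) to the square classes
  of x and x + a, and it is a homomorphism because the abscissas of three collinear points multiply
  to a square. Kramer's criterion identifies the norms from F(sqrt d): a point of E is a norm if and
  only if its Kummer class is also the class of a point on the twist y^2 = x(x + d a)(x + d b). Hence
  the local norm index is the index of the intersection of the two Kummer images in the first one.
  Square classes are locally constant, so the images can be computed with rational x.

  At a prime l of good reduction the image consists of all unramified classes: over the residue field
  every point with trivial class has four halves, so the Kummer map takes at least four values. The
  twist has the same image if d is a unit, and one meeting it trivially if l divides d. For l = p, q
  and d a nonresidue the images meet in a subgroup of index 2. At 2 both images have eight elements,
  and a finite computation in the residue classes modulo 8 remains. At the real place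
  only the signs matter.
\<close>

section \<open>Polynomial identities in an arbitrary commutative ring\<close>

text \<open>A line y = l x + n and the Vieta relations of its three intersections with the curve
  carry the argument. Two of these points may coincide or be conjugate over the quadratic extension
  K, so the single relation \<open>line_cubic\<close> describes addition, doubling and the norm of a
  point of E(K), whose line through its conjugate is defined over R. Both directions of Kramer's
  criterion then become explicit. If P is the norm of a point with abscissa z, its class is given by
  the norms of z and z + a; the isomorphism over K to the twist multiplies them by d^2, so the norm
  taken on the twist has the same class. Conversely, let t be an abscissa on the twist with the
  class of P = (x, y). For e = 0, a, b one has t + d e = k + d (x + e) with k = t - d x, and
  equality of classes means t + d e = (x + e) r^2 with r depending on e. From y, d, k and these r a
  line through -P is written down whose other two intersections are conjugate. The local images are
  found by valuations, because a sufficiently dominant term determines the class of a sum.\<close>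

text \<open>The product of all commutative rings carried by subsets of a type, and of the integers (which
  provide 0 \<noteq> 1). Every single ring embeds into it, although not unitally, so identities between
  elements of a locale-based ring can be proved by the simplifier in a type class.\<close>
typedef 'a cring_prod =
  "{f :: 'a ring \<Rightarrow> 'a. \<forall>R. if cring R then f R \<in> carrier R else f R = undefined} \<times> (UNIV :: int set)"
proof -
  have "(\<lambda>R :: 'a ring. if cring R then zero R else undefined, 0) \<in>
    {f :: 'a ring \<Rightarrow> 'a. \<forall>R. if cring R then f R \<in> carrier R else f R = undefined} \<times> (UNIV :: int set)"
    by (auto intro: ring.ring_simprules cring.axioms)
  then show ?thesis by (rule exI)
qed

lemma cring_one:
  assumes "cring R" "x \<in> carrier R"
  shows "mult R (one R) x = x" "mult R x (one R) = x"
  using assms by (simp_all add: cring_def ring_def monoid.l_one monoid.r_one)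

setup_lifting type_definition_cring_prod

instantiation cring_prod :: (type) comm_ring_1
begin

lift_definition zero_cring_prod :: "'a cring_prod"
  is "(\<lambda>R. if cring R then zero R else undefined, 0)"
  by (auto intro: ring.ring_simprules cring.axioms)

lift_definition one_cring_prod :: "'a cring_prod"
  is "(\<lambda>R. if cring R then one R else undefined, 1)"
  by (auto intro: ring.ring_simprules cring.axioms)

lift_definition plus_cring_prod :: "'a cring_prod \<Rightarrow> 'a cring_prod \<Rightarrow> 'a cring_prod"
  is "\<lambda>(f, m) (g, n). (\<lambda>R. if cring R then add R (f R) (g R) else undefined, m + n)"
  by (force intro: ring.ring_simprules cring.axioms)

lift_definition uminus_cring_prod :: "'a cring_prod \<Rightarrow> 'a cring_prod"
  is "\<lambda>(f, m). (\<lambda>R. if cring R then a_inv R (f R) else undefined, - m)"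
  by (force intro: ring.ring_simprules cring.axioms)

lift_definition minus_cring_prod :: "'a cring_prod \<Rightarrow> 'a cring_prod \<Rightarrow> 'a cring_prod"
  is "\<lambda>(f, m) (g, n). (\<lambda>R. if cring R then a_minus R (f R) (g R) else undefined, m - n)"
  by (force intro: ring.ring_simprules cring.axioms)

lift_definition times_cring_prod :: "'a cring_prod \<Rightarrow> 'a cring_prod \<Rightarrow> 'a cring_prod"
  is "\<lambda>(f, m) (g, n). (\<lambda>R. if cring R then mult R (f R) (g R) else undefined, m * n)"
  by (force intro: ring.ring_simprules cring.axioms)

instance
proof
  fix x y z :: "'a cring_prod"
  show "x + y + z = x + (y + z)"
    by transfer (force simp: cring.cring_simprules)
  show "x + y = y + x"
    by transfer (force simp: cring.cring_simprules)
  show "0 + x = x"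
    by transfer (force simp: cring.cring_simprules)
  show "- x + x = 0"
    by transfer (force simp: cring.cring_simprules)
  show "x - y = x + - y"
    by transfer (force simp: cring.cring_simprules a_minus_def)
  show "x * y * z = x * (y * z)"
    by transfer (force simp: cring.cring_simprules)
  show "x * y = y * x"
    by transfer (force simp: cring.cring_simprules)
  show "1 * x = x"
    by transfer (force simp: cring_one)
  show "(x + y) * z = x * z + y * z"
    by transfer (force simp: cring.cring_simprules algebra_simps)
  show "(0 :: 'a cring_prod) \<noteq> 1"
    by transfer simp
qed

end

definition lift :: "'a ring \<Rightarrow> 'a \<Rightarrow> 'a cring_prod" where
  "lift R x = Abs_cring_prod (\<lambda>R'. if R' = R then x else if cring R' then zero R' else undefined, 0)"

lemma Rep_lift:
  assumes "cring R" "x \<in> carrier R"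
  shows "Rep_cring_prod (lift R x) = (\<lambda>R'. if R' = R then x else if cring R' then zero R' else undefined, 0)"
  unfolding lift_def using assms
  by (subst Abs_cring_prod_inverse) (auto intro: ring.ring_simprules cring.axioms)

lemma lift_inject:
  assumes "cring R" "x \<in> carrier R" "y \<in> carrier R" "lift R x = lift R y"
  shows "x = y"
proof -
  have "fst (Rep_cring_prod (lift R x)) R = fst (Rep_cring_prod (lift R y)) R"
    using assms(4) by simp
  then show ?thesis using assms(1-3) by (simp add: Rep_lift)
qed

lemma lift_hom:
  assumes "cring R" "x \<in> carrier R" "y \<in> carrier R"
  shows "lift R (add R x y) = lift R x + lift R y"
    and "lift R (mult R x y) = lift R x * lift R y"
    and "lift R (a_minus R x y) = lift R x - lift R y"
  using assms
  by (auto simp: Rep_cring_prod_inject [symmetric] Rep_lift plus_cring_prod.rep_eq times_cring_prod.rep_eq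
      minus_cring_prod.rep_eq fun_eq_iff cring.cring_simprules a_minus_def)

lemma lift_uminus:
  assumes "cring R" "x \<in> carrier R"
  shows "lift R (a_inv R x) = - lift R x"
  using assms
  by (auto simp: Rep_cring_prod_inject [symmetric] Rep_lift uminus_cring_prod.rep_eq fun_eq_iff
      cring.cring_simprules)

lemma lift_zero:
  assumes "cring R"
  shows "lift R (zero R) = 0"
  using assms
  by (auto simp: Rep_cring_prod_inject [symmetric] Rep_lift zero_cring_prod.rep_eq fun_eq_iff
      cring.cring_simprules)

text \<open>\<open>lift\<close> is not unital: \<open>one R\<close> goes to an idempotent that
  vanishes in all other components. It can therefore only be absorbed into a neighbouring factor,
  and constants such as 2 and 3 appear in R as repeated sums.\<close>

lemma lift_one:
  assumes "cring R" "x \<in> carrier R"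
  shows "lift R (one R) * lift R x = lift R x" "lift R x * lift R (one R) = lift R x"
  using assms
  by (simp_all flip: lift_hom add: cring.cring_simprules cring_one)

section \<open>The chord and tangent construction\<close>

text \<open>The line y = l x + n meets the cubic y^2 = x^3 + a2 x^2 + a4 x in a point with abscissa x and in
  two further points whose abscissas have sum s and product c. The latter two need not be rational.\<close>
definition line_cubic :: "'a ring \<Rightarrow> 'a \<Rightarrow> 'a \<Rightarrow> 'a \<Rightarrow> 'a \<Rightarrow> 'a \<Rightarrow> 'a \<Rightarrow> 'a \<Rightarrow> bool" where
  "line_cubic R a2 a4 l n s c x \<longleftrightarrow>
     add R s x = a_minus R (mult R l l) a2 \<and>
     add R c (mult R s x) = a_minus R a4 (add R (mult R l n) (mult R l n)) \<and>
     mult R c x = mult R n n"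

abbreviation cubic :: "'a ring \<Rightarrow> 'a \<Rightarrow> 'a \<Rightarrow> 'a \<Rightarrow> 'a" where
  "cubic R a2 a4 x \<equiv> add R (add R (mult R x (mult R x x)) (mult R a2 (mult R x x))) (mult R a4 x)"

locale odd_char_field = field R for R :: "'a ring" (structure) +
  assumes two_nz: "\<one> \<oplus> \<one> \<noteq> \<zero>"
begin

lemma lift_eqI: "x \<in> carrier R \<Longrightarrow> y \<in> carrier R \<Longrightarrow> lift R x = lift R y \<Longrightarrow> x = y"
  using lift_inject[OF is_cring] by blast

lemma lift_iff: "x \<in> carrier R \<Longrightarrow> y \<in> carrier R \<Longrightarrow> lift R x = lift R y \<longleftrightarrow> x = y"
  by (rule iffI) (erule lift_eqI, simp_all)

lemmas lift_R [simp] = lift_hom[OF is_cring] lift_uminus[OF is_cring] lift_zero[OF is_cring] lift_one[OF is_cring]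

lemma line_cubic_lift:
  assumes "a2 \<in> carrier R" "a4 \<in> carrier R" "l \<in> carrier R" "n \<in> carrier R" "s \<in> carrier R"
    "c \<in> carrier R" "x \<in> carrier R"
  shows "line_cubic R a2 a4 l n s c x \<longleftrightarrow>
     lift R s + lift R x = lift R l * lift R l - lift R a2 \<and>
     lift R c + lift R s * lift R x = lift R a4 - 2 * (lift R l * lift R n) \<and>
     lift R c * lift R x = lift R n * lift R n"
proof -
  have 1: "s \<oplus> x = l \<otimes> l \<ominus> a2 \<longleftrightarrow> lift R (s \<oplus> x) = lift R (l \<otimes> l \<ominus> a2)"
    by (rule lift_iff[symmetric]) (use assms in simp_all)
  have 2: "c \<oplus> s \<otimes> x = a4 \<ominus> (l \<otimes> n \<oplus> l \<otimes> n) \<longleftrightarrow> lift R (c \<oplus> s \<otimes> x) = lift R (a4 \<ominus> (l \<otimes> n \<oplus> l \<otimes> n))"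
    by (rule lift_iff[symmetric]) (use assms in simp_all)
  have 3: "c \<otimes> x = n \<otimes> n \<longleftrightarrow> lift R (c \<otimes> x) = lift R (n \<otimes> n)"
    by (rule lift_iff[symmetric]) (use assms in simp_all)
  show ?thesis
    unfolding line_cubic_def 1 2 3 using assms by simp
qed

lemma curve_lift:
  assumes "a2 \<in> carrier R" "a4 \<in> carrier R" "x \<in> carrier R" "y \<in> carrier R"
  shows "y \<otimes> y = cubic R a2 a4 x \<longleftrightarrow>
    lift R y * lift R y = lift R x * (lift R x * lift R x) + lift R a2 * (lift R x * lift R x) + lift R a4 * lift R x"
proof -
  have "y \<otimes> y = cubic R a2 a4 x \<longleftrightarrow> lift R (y \<otimes> y) = lift R (cubic R a2 a4 x)"
    by (rule lift_iff[symmetric]) (use assms in simp_all)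
  then show ?thesis
    using assms by simp
qed

lemma double_eq_0: "x \<in> carrier R \<Longrightarrow> x \<oplus> x = \<zero> \<Longrightarrow> x = \<zero>"
proof -
  assume x: "x \<in> carrier R" "x \<oplus> x = \<zero>"
  have "(\<one> \<oplus> \<one>) \<otimes> x = x \<oplus> x" using x by (simp add: l_distr)
  then show ?thesis using x two_nz integral[of "\<one> \<oplus> \<one>" x] by auto
qed

lemma eq_uminus_self: "x \<in> carrier R \<Longrightarrow> x = \<ominus> x \<Longrightarrow> x = \<zero>"
  by (rule double_eq_0) (metis r_neg)+

lemma square_eq_square:
  assumes "x \<in> carrier R" "y \<in> carrier R" "x \<otimes> x = y \<otimes> y"
  shows "x = y \<or> x = \<ominus> y"
proof -
  have "(x \<ominus> y) \<otimes> (x \<oplus> y) = x \<otimes> x \<ominus> y \<otimes> y"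
    by (rule lift_eqI) (use assms(1,2) in \<open>simp_all add: algebra_simps\<close>)
  also have "\<dots> = \<zero>" using assms by (simp add: a_minus_def r_neg)
  finally have "x \<ominus> y = \<zero> \<or> x \<oplus> y = \<zero>"
    using integral[of "x \<ominus> y" "x \<oplus> y"] assms by auto
  then show ?thesis
  proof
    assume "x \<ominus> y = \<zero>"
    then show ?thesis using assms by simp
  next
    assume "x \<oplus> y = \<zero>"
    then have "\<ominus> y = x" by (rule minus_equality) (use assms in simp_all)
    then show ?thesis by simp
  qed
qed

lemma mult_inv_cancel:
  assumes "x \<in> carrier R" "y \<in> carrier R" "y \<noteq> \<zero>"
  shows "(x \<otimes> inv y) \<otimes> y = x" "inv y \<in> carrier R"
  using assms by (auto simp: field_Units m_assoc)

lemma eq_divI: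
  assumes "x \<in> carrier R" "y \<in> carrier R" "z \<in> carrier R" "y \<noteq> \<zero>" "z \<otimes> y = x"
  shows "x \<otimes> inv y = z"
proof -
  have "y \<in> Units R" using assms by (simp add: field_Units)
  then have "y \<otimes> inv y = \<one>" "inv y \<in> carrier R" by auto
  then show ?thesis using assms m_assoc[of z y "inv y"] by simp
qed

end

section \<open>Vieta relations for chords and tangents\<close>

lemma ring_chord:
  fixes x1 :: "'k::comm_ring_1"
  assumes "(l * x1 + n) * (l * x1 + n) = x1 * (x1 * x1) + a2 * (x1 * x1) + a4 * x1"
    and "(l * x2 + n) * (l * x2 + n) = x2 * (x2 * x2) + a2 * (x2 * x2) + a4 * x2"
    and "x1 + x2 + x3 = l * l - a2"
  shows "(x2 - x1) * (x1 * x2 + (x1 + x2) * x3) = (x2 - x1) * (a4 - 2 * (l * n))"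
proof -
  have x3: "x3 = l * l - a2 - x1 - x2" using assms(3) by (simp add: algebra_simps)
  \<comment> \<open>The factor x2 - x1 stays, because \<open>cring_prod\<close> has zero divisors;
    it is cancelled later, in the field itself.\<close>
  have "(x2 - x1) * (x1 * x2 + (x1 + x2) * x3) - (x2 - x1) * (a4 - 2 * (l * n))
    = ((l * x2 + n) * (l * x2 + n) - (x2 * (x2 * x2) + a2 * (x2 * x2) + a4 * x2)) 
     - ((l * x1 + n) * (l * x1 + n) - (x1 * (x1 * x1) + a2 * (x1 * x1) + a4 * x1))"
    unfolding x3 by (simp add: algebra_simps)
  then show ?thesis using assms by simp
qed

text \<open>With the first two Vieta relations given, the curve equation at the single root x1
  determines the constant coefficient.\<close>

lemma ring_third:
  fixes x1 :: "'k::comm_ring_1"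
  assumes "(l * x1 + n) * (l * x1 + n) = x1 * (x1 * x1) + a2 * (x1 * x1) + a4 * x1"
    and "x1 * x2 + (x1 + x2) * x3 = a4 - 2 * (l * n)"
    and "x1 + x2 + x3 = l * l - a2"
  shows "x1 * x2 * x3 = n * n"
proof -
  have x3: "x3 = l * l - a2 - x1 - x2" using assms(3) by (simp add: algebra_simps)
  have "n * n - x1 * x2 * x3 = ((l * x1 + n) * (l * x1 + n) - (x1 * (x1 * x1) + a2 * (x1 * x1) + a4 * x1))
    - x1 * (x1 * x2 + (x1 + x2) * x3 - (a4 - 2 * (l * n)))"
    unfolding x3 by (simp add: algebra_simps)
  then show ?thesis using assms by simp
qed

text \<open>At a double intersection the vanishing of the derivative at x1 takes over the part that
  the second point plays in \<open>ring_chord\<close>.\<close>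

lemma ring_tangent:
  fixes x1 :: "'k::comm_ring_1"
  assumes "2 * (l * (l * x1 + n)) = 3 * (x1 * x1) + 2 * (a2 * x1) + a4"
    and "x1 + x1 + x3 = l * l - a2"
  shows "x1 * x1 + (x1 + x1) * x3 = a4 - 2 * (l * n)"
proof -
  have x3: "x3 = l * l - a2 - x1 - x1" using assms(2) by (simp add: algebra_simps)
  have "x1 * x1 + (x1 + x1) * x3 - (a4 - 2 * (l * n))
    = 2 * (l * (l * x1 + n)) - (3 * (x1 * x1) + 2 * (a2 * x1) + a4)"
    unfolding x3 by (simp add: algebra_simps)
  then show ?thesis using assms by simp
qed

lemma ring_tangent_rev:
  fixes x1 :: "'k::comm_ring_1"
  assumes "x1 * x1 + (x1 + x1) * x3 = a4 - 2 * (l * n)"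
    and "x1 + x1 + x3 = l * l - a2"
  shows "2 * (l * (l * x1 + n)) = 3 * (x1 * x1) + 2 * (a2 * x1) + a4"
proof -
  have x3: "x3 = l * l - a2 - x1 - x1" using assms(2) by (simp add: algebra_simps)
  have "x1 * x1 + (x1 + x1) * x3 - (a4 - 2 * (l * n))
    = 2 * (l * (l * x1 + n)) - (3 * (x1 * x1) + 2 * (a2 * x1) + a4)"
    unfolding x3 by (simp add: algebra_simps)
  then show ?thesis using assms(1) by (metis eq_iff_diff_eq_0)
qed

text \<open>The hypotheses on s, c and x0 compare the coefficients of the cubic minus (l x + n)^2
  with those of (x^2 - s x + c)(x - x0), so every zero of this product gives a point of the
  curve.\<close>

lemma ring_line_cubic:
  fixes x :: "'k::comm_ring_1"
  assumes "s + x0 = l * l - a2" "c + s * x0 = a4 - 2 * (l * n)" "c * x0 = n * n"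
    and "(x * x - s * x + c) * (x - x0) = 0"
  shows "(l * x + n) * (l * x + n) = x * (x * x) + a2 * (x * x) + a4 * x"
proof -
  have a: "a2 = l * l - s - x0" "a4 = c + s * x0 + 2 * (l * n)"
    using assms by (simp_all add: algebra_simps)
  have "x * (x * x) + a2 * (x * x) + a4 * x - (l * x + n) * (l * x + n)
    = (x * x - s * x + c) * (x - x0) + (c * x0 - n * n)"
    unfolding a by (simp add: algebra_simps)
  then show ?thesis using assms by simp
qed

section \<open>The addition law expressed by lines\<close>

context odd_char_field
begin

lemma line_cubic_on_curve:
  assumes "a2 \<in> carrier R" "a4 \<in> carrier R" "l \<in> carrier R" "n \<in> carrier R" "s \<in> carrier R"
    "c \<in> carrier R" "x \<in> carrier R"
    and "line_cubic R a2 a4 l n s c x"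
  shows "(l \<otimes> x \<oplus> n) \<otimes> (l \<otimes> x \<oplus> n) = cubic R a2 a4 x"
  using assms by (subst curve_lift) (auto simp: line_cubic_lift intro: ring_line_cubic)

definition slope :: "'a \<Rightarrow> 'a \<Rightarrow> 'a \<Rightarrow> 'a \<Rightarrow> 'a \<Rightarrow> 'a \<Rightarrow> 'a" where
  "slope a2 a4 x1 y1 x2 y2 = (if x1 = x2
     then ((\<one> \<oplus> \<one> \<oplus> \<one>) \<otimes> (x1 \<otimes> x1) \<oplus> (\<one> \<oplus> \<one>) \<otimes> (a2 \<otimes> x1) \<oplus> a4) \<otimes> inv ((\<one> \<oplus> \<one>) \<otimes> y1)
     else (y2 \<ominus> y1) \<otimes> inv (x2 \<ominus> x1))"

lemma ec_add_slope:
  assumes "\<not> (x1 = x2 \<and> y1 = \<ominus> y2)"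
  shows "ec_add R a2 a4 (Some (x1, y1)) (Some (x2, y2)) =
    (let l = slope a2 a4 x1 y1 x2 y2; x3 = l \<otimes> l \<ominus> a2 \<ominus> x1 \<ominus> x2
     in Some (x3, \<ominus> (l \<otimes> (x3 \<ominus> x1) \<oplus> y1)))"
  using assms unfolding ec_add_def slope_def by (auto simp: Let_def)

lemma slope_eqI:
  assumes c: "a2 \<in> carrier R" "a4 \<in> carrier R" "x1 \<in> carrier R" "y1 \<in> carrier R" "x2 \<in> carrier R"
    "y2 \<in> carrier R" "l \<in> carrier R"
    and "x1 = x2 \<Longrightarrow> y1 \<noteq> \<zero> \<and>
      2 * (lift R l * lift R y1) = 3 * (lift R x1 * lift R x1) + 2 * (lift R a2 * lift R x1) + lift R a4"
    and "x1 \<noteq> x2 \<Longrightarrow> lift R l * (lift R x2 - lift R x1) = lift R y2 - lift R y1"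
  shows "slope a2 a4 x1 y1 x2 y2 = l"
proof (cases "x1 = x2")
  case True
  note h = assms(8)[OF True]
  have nz: "(\<one> \<oplus> \<one>) \<otimes> y1 \<noteq> \<zero>" using h two_nz c integral[of "\<one> \<oplus> \<one>" y1] by auto
  have "l \<otimes> ((\<one> \<oplus> \<one>) \<otimes> y1) = (\<one> \<oplus> \<one> \<oplus> \<one>) \<otimes> (x1 \<otimes> x1) \<oplus> (\<one> \<oplus> \<one>) \<otimes> (a2 \<otimes> x1) \<oplus> a4"
  proof (rule lift_eqI)
    have "lift R l * lift R y1 + lift R l * lift R y1 = lift R x1 * lift R x1 + lift R x1 * lift R x1 + lift R x1 * lift R x1
      + (lift R a2 * lift R x1 + lift R a2 * lift R x1) + lift R a4"
      using h by (simp add: algebra_simps)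
    then show "lift R (l \<otimes> ((\<one> \<oplus> \<one>) \<otimes> y1)) = lift R ((\<one> \<oplus> \<one> \<oplus> \<one>) \<otimes> (x1 \<otimes> x1) \<oplus> (\<one> \<oplus> \<one>) \<otimes> (a2 \<otimes> x1) \<oplus> a4)"
      using c by (simp add: l_distr r_distr)
  qed (use c in simp_all)
  then show ?thesis unfolding slope_def using True eq_divI[OF _ _ _ nz] c by simp
next
  case False
  have nz: "x2 \<ominus> x1 \<noteq> \<zero>" using False c by auto
  have "l \<otimes> (x2 \<ominus> x1) = y2 \<ominus> y1"
    by (rule lift_eqI) (use assms(9)[OF False] c in simp_all)
  then show ?thesis unfolding slope_def using False eq_divI[OF _ _ _ nz] c by simp
qed

lemma slope_props:
  assumes c: "a2 \<in> carrier R" "a4 \<in> carrier R" "x1 \<in> carrier R" "y1 \<in> carrier R" "x2 \<in> carrier R"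
    "y2 \<in> carrier R"
    and nz: "x1 = x2 \<longrightarrow> y1 \<noteq> \<zero>"
  defines "l \<equiv> slope a2 a4 x1 y1 x2 y2"
  shows "l \<in> carrier R"
    and "x1 = x2 \<Longrightarrow> 2 * (lift R l * lift R y1) = 3 * (lift R x1 * lift R x1) + 2 * (lift R a2 * lift R x1) + lift R a4"
    and "x1 \<noteq> x2 \<Longrightarrow> lift R l * (lift R x2 - lift R x1) = lift R y2 - lift R y1"
proof -
  have nz1: "(\<one> \<oplus> \<one>) \<otimes> y1 \<noteq> \<zero>" if "x1 = x2" using nz that two_nz c integral[of "\<one> \<oplus> \<one>" y1] by auto
  have nz2: "x2 \<ominus> x1 \<noteq> \<zero>" if "x1 \<noteq> x2" using that c by auto
  show l: "l \<in> carrier R" unfolding l_def slope_def using nz1 nz2 c by (auto simp: mult_inv_cancel(2))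
  show "2 * (lift R l * lift R y1) = 3 * (lift R x1 * lift R x1) + 2 * (lift R a2 * lift R x1) + lift R a4" if e: "x1 = x2"
  proof -
    have "l \<otimes> ((\<one> \<oplus> \<one>) \<otimes> y1) = (\<one> \<oplus> \<one> \<oplus> \<one>) \<otimes> (x1 \<otimes> x1) \<oplus> (\<one> \<oplus> \<one>) \<otimes> (a2 \<otimes> x1) \<oplus> a4"
      unfolding l_def slope_def using e nz1 c by (auto intro: mult_inv_cancel(1))
    then have "lift R (l \<otimes> ((\<one> \<oplus> \<one>) \<otimes> y1)) = lift R ((\<one> \<oplus> \<one> \<oplus> \<one>) \<otimes> (x1 \<otimes> x1) \<oplus> (\<one> \<oplus> \<one>) \<otimes> (a2 \<otimes> x1) \<oplus> a4)"
      by simp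
    then show ?thesis using c l by (simp add: l_distr r_distr algebra_simps)
  qed
  show "lift R l * (lift R x2 - lift R x1) = lift R y2 - lift R y1" if e: "x1 \<noteq> x2"
  proof -
    have "l \<otimes> (x2 \<ominus> x1) = y2 \<ominus> y1"
      unfolding l_def slope_def using e nz2 c by (auto intro: mult_inv_cancel(1))
    then have "lift R (l \<otimes> (x2 \<ominus> x1)) = lift R (y2 \<ominus> y1)" by simp
    then show ?thesis using c l by simp
  qed
qed

text \<open>Hides the division in the slope: later arguments see a sum only through the Vieta
  relations of a line and the final reflection.\<close>

lemma ec_add_line:
  assumes c: "a2 \<in> carrier R" "a4 \<in> carrier R" "x1 \<in> carrier R" "y1 \<in> carrier R" "x2 \<in> carrier R"
    "y2 \<in> carrier R"
    and on: "y1 \<otimes> y1 = cubic R a2 a4 x1" "y2 \<otimes> y2 = cubic R a2 a4 x2"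
    and ne: "\<not> (x1 = x2 \<and> y1 = \<ominus> y2)"
  obtains l n x3 where "l \<in> carrier R" "n \<in> carrier R" "x3 \<in> carrier R"
    "y1 = l \<otimes> x1 \<oplus> n" "y2 = l \<otimes> x2 \<oplus> n" "line_cubic R a2 a4 l n (x1 \<oplus> x2) (x1 \<otimes> x2) x3"
    "ec_add R a2 a4 (Some (x1, y1)) (Some (x2, y2)) = Some (x3, \<ominus> (l \<otimes> x3 \<oplus> n))"
proof -
  \<comment> \<open>Points with equal abscissas are equal or opposite, and the opposite case, which
    includes y1 = 0, is excluded by \<open>ne\<close>.\<close>
  have yy: "y1 = y2 \<and> y1 \<noteq> \<zero>" if "x1 = x2"
  proof -
    have "y1 \<otimes> y1 = y2 \<otimes> y2" using on that by simp
    then have y12: "y1 = y2" using square_eq_square[of y1 y2] c ne that by simp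
    then have "y1 \<noteq> \<zero>" using ne that by auto
    then show ?thesis using y12 by simp
  qed
  define l where "l = slope a2 a4 x1 y1 x2 y2"
  define n where "n = y1 \<ominus> l \<otimes> x1"
  define x3 where "x3 = l \<otimes> l \<ominus> a2 \<ominus> x1 \<ominus> x2"
  have nz0: "x1 = x2 \<longrightarrow> y1 \<noteq> \<zero>" using yy by blast
  note sl = slope_props[OF c nz0, folded l_def]
  have l: "l \<in> carrier R" using sl(1) .
  have n: "n \<in> carrier R" unfolding n_def using l c by simp
  have x3: "x3 \<in> carrier R" unfolding x3_def using l c by simp
  have y1: "y1 = l \<otimes> x1 \<oplus> n"
    by (rule lift_eqI) (use c l in \<open>simp_all add: n_def\<close>)
  have y2: "y2 = l \<otimes> x2 \<oplus> n"
  proof (rule lift_eqI)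
    show "lift R y2 = lift R (l \<otimes> x2 \<oplus> n)"
    proof (cases "x1 = x2")
      case True
      then show ?thesis using yy y1 by simp
    next
      case False
      then show ?thesis using sl(3) c l by (simp add: n_def algebra_simps)
    qed
  qed (use c l n in simp_all)
  have sum: "lift R x1 + lift R x2 + lift R x3 = lift R l * lift R l - lift R a2"
    unfolding x3_def using c l by simp
  have o1: "(lift R l * lift R x1 + lift R n) * (lift R l * lift R x1 + lift R n) = lift R x1 * (lift R x1 * lift R x1) +
     lift R a2 * (lift R x1 * lift R x1) + lift R a4 * lift R x1"
  proof -
    have "lift R y1 = lift R l * lift R x1 + lift R n" using arg_cong[OF y1, of "lift R"] c l n by simp
    then show ?thesis using on(1) c by (simp add: curve_lift)
  qed
  have o2: "(lift R l * lift R x2 + lift R n) * (lift R l * lift R x2 + lift R n) = lift R x2 * (lift R x2 * lift R x2) +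
     lift R a2 * (lift R x2 * lift R x2) + lift R a4 * lift R x2"
  proof -
    have "lift R y2 = lift R l * lift R x2 + lift R n" using arg_cong[OF y2, of "lift R"] c l n by simp
    then show ?thesis using on(2) c by (simp add: curve_lift)
  qed
  have second: "lift R x1 * lift R x2 + (lift R x1 + lift R x2) * lift R x3 = lift R a4 - 2 * (lift R l * lift R n)"
  proof (cases "x1 = x2")
    case True
    have "lift R y1 = lift R l * lift R x1 + lift R n" using arg_cong[OF y1, of "lift R"] c l n by simp
    then have "2 * (lift R l * (lift R l * lift R x1 + lift R n)) = 3 * (lift R x1 * lift R x1) + 2 * (lift R a2 * lift R x1) + lift R a4"
      using sl(2)[OF True] by simp
    then show ?thesis using ring_tangent[of "lift R l" "lift R x1" "lift R n" "lift R a2" "lift R a4" "lift R x3"] sum True by simp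
  next
    case False
    have nz: "x2 \<ominus> x1 \<noteq> \<zero>" using False c by auto
    have "(x2 \<ominus> x1) \<otimes> (x1 \<otimes> x2 \<oplus> (x1 \<oplus> x2) \<otimes> x3) = (x2 \<ominus> x1) \<otimes> (a4 \<ominus> (l \<otimes> n \<oplus> l \<otimes> n))"
      by (rule lift_eqI) (use ring_chord[OF o1 o2 sum] c l n x3 in simp_all)
    then have "x1 \<otimes> x2 \<oplus> (x1 \<oplus> x2) \<otimes> x3 = a4 \<ominus> (l \<otimes> n \<oplus> l \<otimes> n)"
      by (rule iffD1[OF m_lcancel[OF nz], rotated -1]) (use c l n x3 in simp_all)
    then have "lift R (x1 \<otimes> x2 \<oplus> (x1 \<oplus> x2) \<otimes> x3) = lift R (a4 \<ominus> (l \<otimes> n \<oplus> l \<otimes> n))" by simp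
    then show ?thesis using c l n x3 by simp
  qed
  have "line_cubic R a2 a4 l n (x1 \<oplus> x2) (x1 \<otimes> x2) x3"
    using ring_third[OF o1 second sum] second sum c l n x3 by (simp add: line_cubic_lift)
  moreover have "ec_add R a2 a4 (Some (x1, y1)) (Some (x2, y2)) = Some (x3, \<ominus> (l \<otimes> x3 \<oplus> n))"
  proof -
    have "\<ominus> (l \<otimes> (x3 \<ominus> x1) \<oplus> y1) = \<ominus> (l \<otimes> x3 \<oplus> n)"
      by (rule lift_eqI) (use c l x3 in \<open>simp_all add: n_def algebra_simps\<close>)
    then show ?thesis using ne by (simp add: ec_add_slope Let_def flip: l_def x3_def)
  qed
  ultimately show ?thesis by (rule that[OF l n x3 y1 y2])
qed

text \<open>Converse of \<open>ec_add_line\<close>: a line known in advance determines the sum. This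
  makes it possible to add in K by means of a line over R.\<close>

lemma ec_add_eqI:
  assumes c: "a2 \<in> carrier R" "a4 \<in> carrier R" "x1 \<in> carrier R" "x2 \<in> carrier R" "x3 \<in> carrier R"
    "l \<in> carrier R" "n \<in> carrier R"
    and y: "y1 = l \<otimes> x1 \<oplus> n" "y2 = l \<otimes> x2 \<oplus> n"
    and lc: "line_cubic R a2 a4 l n (x1 \<oplus> x2) (x1 \<otimes> x2) x3"
    and ne: "\<not> (x1 = x2 \<and> y1 = \<ominus> y2)"
  shows "ec_add R a2 a4 (Some (x1, y1)) (Some (x2, y2)) = Some (x3, \<ominus> (l \<otimes> x3 \<oplus> n))"
proof -
  have yc: "y1 \<in> carrier R" "y2 \<in> carrier R" using c y by auto
  have L: "lift R (x1 \<oplus> x2) + lift R x3 = lift R l * lift R l - lift R a2"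
    "lift R (x1 \<otimes> x2) + lift R (x1 \<oplus> x2) * lift R x3 = lift R a4 - 2 * (lift R l * lift R n)"
    using lc c by (auto simp: line_cubic_lift)
  have sl: "slope a2 a4 x1 y1 x2 y2 = l"
  proof (rule slope_eqI)
    assume e: "x1 = x2"
    then have "y1 = y2" using y by simp
    then have "y1 \<noteq> \<zero>" using ne e by auto
    moreover have "2 * (lift R l * lift R y1) = 3 * (lift R x1 * lift R x1) + 2 * (lift R a2 * lift R x1) + lift R a4"
      using ring_tangent_rev[of "lift R x1" "lift R x3" "lift R a4" "lift R l" "lift R n" "lift R a2"] L e c y(1) by simp
    ultimately show "y1 \<noteq> \<zero> \<and> 2 * (lift R l * lift R y1) = 3 * (lift R x1 * lift R x1) + 2 * (lift R a2 * lift R x1) + lift R a4"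
      by blast
  qed (use c yc y in \<open>simp_all add: algebra_simps\<close>)
  have x3: "l \<otimes> l \<ominus> a2 \<ominus> x1 \<ominus> x2 = x3"
  proof (rule lift_eqI)
    have "lift R l * lift R l - lift R a2 = lift R x1 + lift R x2 + lift R x3" using L(1) c by simp
    then show "lift R (l \<otimes> l \<ominus> a2 \<ominus> x1 \<ominus> x2) = lift R x3" using c by simp
  qed (use c in simp_all)
  have "\<ominus> (l \<otimes> (x3 \<ominus> x1) \<oplus> y1) = \<ominus> (l \<otimes> x3 \<oplus> n)"
    by (rule lift_eqI) (use c y in \<open>simp_all add: algebra_simps\<close>)
  then show ?thesis using ne by (simp add: ec_add_slope Let_def sl x3)
qed

end

section \<open>Quadratic extensions\<close>

lemma quad_ext_simps [simp]:
  "carrier (quad_ext R d) = carrier R \<times> carrier R"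
  "mult (quad_ext R d) (x, y) (z, w) = (add R (mult R x z) (mult R d (mult R y w)), add R (mult R x w) (mult R y z))"
  "add (quad_ext R d) (x, y) (z, w) = (add R x z, add R y w)"
  "one (quad_ext R d) = (one R, zero R)"
  "zero (quad_ext R d) = (zero R, zero R)"
  by (simp_all add: quad_ext_def)

locale nonsquare = odd_char_field +
  fixes d
  assumes d_carrier [simp]: "d \<in> carrier R"
    and d_nonsquare: "\<And>s. s \<in> carrier R \<Longrightarrow> s \<otimes> s \<noteq> d"
begin

abbreviation K where "K \<equiv> quad_ext R d"

lemma cring_K: "cring K"
proof (rule cringI)
  show "abelian_group K"
  proof (rule abelian_groupI)
    fix p assume "p \<in> carrier K"
    then show "\<exists>q\<in>carrier K. q \<oplus>\<^bsub>K\<^esub> p = \<zero>\<^bsub>K\<^esub>"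
      by (cases p) (auto intro!: bexI[of _ "(\<ominus> fst p, \<ominus> snd p)"] simp: l_neg)
  qed (auto simp: a_ac)
  show "comm_monoid K"
  proof (rule comm_monoidI)
    fix p q r assume "p \<in> carrier K" "q \<in> carrier K" "r \<in> carrier K"
    then show "p \<otimes>\<^bsub>K\<^esub> q \<otimes>\<^bsub>K\<^esub> r = p \<otimes>\<^bsub>K\<^esub> (q \<otimes>\<^bsub>K\<^esub> r)"
      by (cases p; cases q; cases r) (auto intro!: lift_eqI simp: algebra_simps)
  next
    fix p q assume "p \<in> carrier K" "q \<in> carrier K"
    then show "p \<otimes>\<^bsub>K\<^esub> q = q \<otimes>\<^bsub>K\<^esub> p"
      by (cases p; cases q) (auto intro!: lift_eqI simp: algebra_simps)
  qed (auto simp: l_null r_null)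
  fix p q r assume "p \<in> carrier K" "q \<in> carrier K" "r \<in> carrier K"
  then show "(p \<oplus>\<^bsub>K\<^esub> q) \<otimes>\<^bsub>K\<^esub> r = p \<otimes>\<^bsub>K\<^esub> r \<oplus>\<^bsub>K\<^esub> q \<otimes>\<^bsub>K\<^esub> r"
    by (cases p; cases q; cases r) (auto intro!: lift_eqI simp: algebra_simps)
qed

text \<open>Otherwise d would be the square of u / v.\<close>

lemma norm_nz:
  assumes "u \<in> carrier R" "v \<in> carrier R" "u \<noteq> \<zero> \<or> v \<noteq> \<zero>"
  shows "u \<otimes> u \<ominus> d \<otimes> (v \<otimes> v) \<noteq> \<zero>"
proof
  assume "u \<otimes> u \<ominus> d \<otimes> (v \<otimes> v) = \<zero>"
  then have e: "u \<otimes> u = d \<otimes> (v \<otimes> v)" using assms by simp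
  show False
  proof (cases "v = \<zero>")
    case True
    then have "u \<otimes> u = \<zero>" using e by simp
    then show ?thesis using assms True integral by blast
  next
    case False
    have i: "inv v \<in> carrier R" "v \<otimes> inv v = \<one>" using False assms field_Units by auto
    have "(u \<otimes> inv v) \<otimes> (u \<otimes> inv v) = (u \<otimes> u) \<otimes> (inv v \<otimes> inv v)"
      using assms i by (simp add: m_ac)
    also have "\<dots> = d \<otimes> (v \<otimes> v) \<otimes> (inv v \<otimes> inv v)" by (simp add: e)
    also have "\<dots> = d \<otimes> ((v \<otimes> inv v) \<otimes> (v \<otimes> inv v))"
      using assms i(1) d_carrier by (simp only: m_ac m_closed)
    also have "\<dots> = d" using i by simp
    finally show ?thesis using d_nonsquare[of "u \<otimes> inv v"] assms i by simp
  qed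
qed

lemma cfield_K: "odd_char_field K"
proof -
  interpret Kc: cring K by (rule cring_K)
  have invK: "\<exists>q\<in>carrier K. q \<otimes>\<^bsub>K\<^esub> p = \<one>\<^bsub>K\<^esub>" if pK: "p \<in> carrier K" "p \<noteq> \<zero>\<^bsub>K\<^esub>" for p
  proof -
    obtain u v where p: "p = (u, v)" "u \<in> carrier R" "v \<in> carrier R" using pK by (cases p) auto
    \<comment> \<open>The inverse of u + v sqrt d is its conjugate divided by the norm N.\<close>
    define N where "N = u \<otimes> u \<ominus> d \<otimes> (v \<otimes> v)"
    have "N \<noteq> \<zero>" unfolding N_def by (rule norm_nz) (use pK p in auto)
    then have i: "inv N \<in> carrier R" "N \<otimes> inv N = \<one>" using p field_Units by (auto simp: N_def)
    have Ni: "lift R N * lift R (inv N) = lift R \<one>"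
    proof -
      have "N \<in> carrier R" using p by (simp add: N_def)
      then have "lift R (N \<otimes> inv N) = lift R N * lift R (inv N)" using i(1) by simp
      then show ?thesis by (simp only: i(2))
    qed
    have "u \<otimes> inv N \<otimes> u \<oplus> d \<otimes> (\<ominus> v \<otimes> inv N \<otimes> v) = \<one>"
    proof (rule lift_eqI)
      have "lift R (u \<otimes> inv N \<otimes> u \<oplus> d \<otimes> (\<ominus> v \<otimes> inv N \<otimes> v)) = lift R N * lift R (inv N)"
      proof -
        have Nl: "lift R N = lift R u * lift R u - lift R d * (lift R v * lift R v)" using p by (simp add: N_def)
        show ?thesis unfolding Nl using p i(1) by (simp add: algebra_simps)
      qed
      then show "lift R (u \<otimes> inv N \<otimes> u \<oplus> d \<otimes> (\<ominus> v \<otimes> inv N \<otimes> v)) = lift R \<one>" by (simp only: Ni)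
    qed (use p i(1) in simp_all)
    moreover have "u \<otimes> inv N \<otimes> v \<oplus> \<ominus> v \<otimes> inv N \<otimes> u = \<zero>"
      by (rule lift_eqI) (use p i(1) in \<open>simp_all add: algebra_simps\<close>)
    ultimately show ?thesis using p i by (intro bexI[of _ "(u \<otimes> inv N, \<ominus> v \<otimes> inv N)"]) auto
  qed
  have "Units K = carrier K - {\<zero>\<^bsub>K\<^esub>}"
  proof -
    have "\<zero>\<^bsub>K\<^esub> \<notin> Units K"
    proof
      assume "\<zero>\<^bsub>K\<^esub> \<in> Units K"
      then have "\<zero>\<^bsub>K\<^esub> \<otimes>\<^bsub>K\<^esub> inv\<^bsub>K\<^esub> \<zero>\<^bsub>K\<^esub> = \<one>\<^bsub>K\<^esub>" by (rule Kc.Units_r_inv)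
      moreover have "inv\<^bsub>K\<^esub> \<zero>\<^bsub>K\<^esub> \<in> carrier K" using \<open>\<zero>\<^bsub>K\<^esub> \<in> Units K\<close> by (rule Kc.Units_inv_closed)
      ultimately have "\<zero>\<^bsub>K\<^esub> = \<one>\<^bsub>K\<^esub>" by (simp only: Kc.l_null)
      then show False by simp
    qed
    moreover have "p \<in> Units K" if pK: "p \<in> carrier K" "p \<noteq> \<zero>\<^bsub>K\<^esub>" for p
    proof -
      obtain q where "q \<in> carrier K" "q \<otimes>\<^bsub>K\<^esub> p = \<one>\<^bsub>K\<^esub>" using invK[OF pK] by blast
      then show ?thesis using pK Kc.m_comm[of p q] unfolding Units_def by auto
    qed
    ultimately show ?thesis using Kc.Units_closed by blast
  qed
  then have "field K" by (rule Kc.cring_fieldI)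
  then show ?thesis
    using two_nz by (simp add: odd_char_field_def odd_char_field_axioms_def)
qed

lemma uminus_K [simp]:
  "u \<in> carrier R \<Longrightarrow> v \<in> carrier R \<Longrightarrow> \<ominus>\<^bsub>K\<^esub> (u, v) = (\<ominus> u, \<ominus> v)"
proof -
  interpret Kc: cring K by (rule cring_K)
  assume "u \<in> carrier R" "v \<in> carrier R"
  then show ?thesis by (intro Kc.minus_equality) (auto simp: l_neg)
qed

lemma minus_K [simp]:
  "u \<in> carrier R \<Longrightarrow> v \<in> carrier R \<Longrightarrow> u' \<in> carrier R \<Longrightarrow> v' \<in> carrier R \<Longrightarrow>
   (u', v') \<ominus>\<^bsub>K\<^esub> (u, v) = (u' \<ominus> u, v' \<ominus> v)"
  by (simp add: a_minus_def[of K] a_minus_def[of R])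

lemma line_cubic_K:
  assumes "a2 \<in> carrier R" "a4 \<in> carrier R" "l \<in> carrier R" "n \<in> carrier R" "s \<in> carrier R"
    "c \<in> carrier R" "x \<in> carrier R" "line_cubic R a2 a4 l n s c x"
  shows "line_cubic K (a2, \<zero>) (a4, \<zero>) (l, \<zero>) (n, \<zero>) (s, \<zero>) (c, \<zero>) (x, \<zero>)"
  using assms by (simp add: line_cubic_def a_minus_def[of R])

text \<open>The point and its conjugate have abscissas with sum 2 u and product u^2 - d v^2, and
  both lie on the line y = l x + n over R. For v nonzero the abscissas differ, so the two points are
  not opposite.\<close>

lemma ec_norm_affine:
  assumes c: "a2 \<in> carrier R" "a4 \<in> carrier R" "l \<in> carrier R" "n \<in> carrier R" "u \<in> carrier R" "v \<in> carrier R"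
    "x \<in> carrier R"
    and v: "v \<noteq> \<zero>"
    and lc: "line_cubic R a2 a4 l n (u \<oplus> u) (u \<otimes> u \<ominus> d \<otimes> (v \<otimes> v)) x"
  shows "ec_norm R d a2 a4 (Some ((u, v), (l \<otimes> u \<oplus> n, l \<otimes> v))) = Some (x, \<ominus> (l \<otimes> x \<oplus> n))"
proof -
  interpret Kf: odd_char_field K by (rule cfield_K)
  have "ec_add K (a2, \<zero>) (a4, \<zero>) (Some ((u, v), (l \<otimes> u \<oplus> n, l \<otimes> v)))
      (Some ((u, \<ominus> v), (l \<otimes> u \<oplus> n, \<ominus> (l \<otimes> v))))
    = Some ((x, \<zero>), \<ominus>\<^bsub>K\<^esub> ((l, \<zero>) \<otimes>\<^bsub>K\<^esub> (x, \<zero>) \<oplus>\<^bsub>K\<^esub> (n, \<zero>)))"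
  proof (rule Kf.ec_add_eqI)
    have "(u, v) \<oplus>\<^bsub>K\<^esub> (u, \<ominus> v) = (u \<oplus> u, \<zero>)" using c by (simp add: r_neg)
    moreover have "(u, v) \<otimes>\<^bsub>K\<^esub> (u, \<ominus> v) = (u \<otimes> u \<ominus> d \<otimes> (v \<otimes> v), \<zero>)"
      using c by (auto intro!: lift_eqI)
    ultimately show "line_cubic K (a2, \<zero>) (a4, \<zero>) (l, \<zero>) (n, \<zero>) ((u, v) \<oplus>\<^bsub>K\<^esub> (u, \<ominus> v)) ((u, v) \<otimes>\<^bsub>K\<^esub> (u, \<ominus> v)) (x, \<zero>)"
      using line_cubic_K[OF c(1-4) _ _ c(7) lc] c by simp
    show "\<not> ((u, v) = (u, \<ominus> v) \<and> (l \<otimes> u \<oplus> n, l \<otimes> v) = \<ominus>\<^bsub>K\<^esub> (l \<otimes> u \<oplus> n, \<ominus> (l \<otimes> v)))"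
      using v c eq_uminus_self[of v] by auto
  qed (use c in \<open>auto simp: r_minus\<close>)
  then show ?thesis
    unfolding ec_norm_def using c by (simp add: quad_conj_def)
qed

text \<open>A rational point is its own conjugate, so its norm is its double; the tangent is found
  over R and then used over K.\<close>

lemma ec_norm_base:
  assumes c: "a2 \<in> carrier R" "a4 \<in> carrier R" "x \<in> carrier R" "y \<in> carrier R"
    and on: "y \<otimes> y = cubic R a2 a4 x"
  shows "ec_norm R d a2 a4 (Some ((x, \<zero>), (y, \<zero>))) = ec_add R a2 a4 (Some (x, y)) (Some (x, y))"
proof (cases "y = \<ominus> y")
  case True
  then have "y = \<zero>" using eq_uminus_self c by blast
  then show ?thesis using c
    unfolding ec_norm_def ec_add_def by (simp add: quad_conj_def)
next
  case False
  interpret Kf: odd_char_field K by (rule cfield_K)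
  obtain l n x3 where o: "l \<in> carrier R" "n \<in> carrier R" "x3 \<in> carrier R"
    "y = l \<otimes> x \<oplus> n" "line_cubic R a2 a4 l n (x \<oplus> x) (x \<otimes> x) x3"
    "ec_add R a2 a4 (Some (x, y)) (Some (x, y)) = Some (x3, \<ominus> (l \<otimes> x3 \<oplus> n))"
    using ec_add_line[OF c(1,2) c(3,4) c(3,4) on on] False by metis
  have "ec_add K (a2, \<zero>) (a4, \<zero>) (Some ((x, \<zero>), (y, \<zero>))) (Some ((x, \<zero>), (y, \<zero>)))
    = Some ((x3, \<zero>), \<ominus>\<^bsub>K\<^esub> ((l, \<zero>) \<otimes>\<^bsub>K\<^esub> (x3, \<zero>) \<oplus>\<^bsub>K\<^esub> (n, \<zero>)))"
  proof (rule Kf.ec_add_eqI)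
    show "line_cubic K (a2, \<zero>) (a4, \<zero>) (l, \<zero>) (n, \<zero>) ((x, \<zero>) \<oplus>\<^bsub>K\<^esub> (x, \<zero>)) ((x, \<zero>) \<otimes>\<^bsub>K\<^esub> (x, \<zero>)) (x3, \<zero>)"
      using line_cubic_K[OF c(1,2) o(1,2) _ _ o(3) o(5)] c by simp
    show "\<not> ((x, \<zero>) = (x, \<zero>) \<and> (y, \<zero>) = \<ominus>\<^bsub>K\<^esub> (y, \<zero>))" using False c by simp
  qed (use c o in auto)
  then show ?thesis
    unfolding ec_norm_def using c o by (simp add: quad_conj_def)
qed

text \<open>The element u + v sqrt d is a root of x^2 - s x + c for s = 2 u and c = u^2 - d v^2,
  hence an intersection of line and curve.\<close>

lemma quad_point:
  assumes c: "a2 \<in> carrier R" "a4 \<in> carrier R" "l \<in> carrier R" "n \<in> carrier R" "u \<in> carrier R" "v \<in> carrier R"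
    "x \<in> carrier R"
    and lc: "line_cubic R a2 a4 l n (u \<oplus> u) (u \<otimes> u \<ominus> d \<otimes> (v \<otimes> v)) x"
  shows "Some ((u, v), (l \<otimes> u \<oplus> n, l \<otimes> v)) \<in> ec_points K (a2, \<zero>) (a4, \<zero>)"
proof -
  interpret Kf: odd_char_field K by (rule cfield_K)
  define s c0 where "s = u \<oplus> u" and "c0 = u \<otimes> u \<ominus> d \<otimes> (v \<otimes> v)"
  have sc: "s \<in> carrier R" "c0 \<in> carrier R" unfolding s_def c0_def using c by auto
  have L: "line_cubic K (a2, \<zero>) (a4, \<zero>) (l, \<zero>) (n, \<zero>) (s, \<zero>) (c0, \<zero>) (x, \<zero>)"
    using line_cubic_K[OF c(1-4) sc c(7)] lc by (simp add: s_def c0_def)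
  have root: "(u, v) \<otimes>\<^bsub>K\<^esub> (u, v) \<ominus>\<^bsub>K\<^esub> (s, \<zero>) \<otimes>\<^bsub>K\<^esub> (u, v) \<oplus>\<^bsub>K\<^esub> (c0, \<zero>) = \<zero>\<^bsub>K\<^esub>"
    using c by (auto simp: s_def c0_def intro!: lift_eqI)
  have rl: "lift K (u, v) * lift K (u, v) - lift K (s, \<zero>) * lift K (u, v) + lift K (c0, \<zero>) = 0"
  proof -
    have uv: "(u, v) \<in> carrier K" "(s, \<zero>) \<in> carrier K" "(c0, \<zero>) \<in> carrier K" using c sc by auto
    have "lift K ((u, v) \<otimes>\<^bsub>K\<^esub> (u, v) \<ominus>\<^bsub>K\<^esub> (s, \<zero>) \<otimes>\<^bsub>K\<^esub> (u, v) \<oplus>\<^bsub>K\<^esub> (c0, \<zero>)) = lift K \<zero>\<^bsub>K\<^esub>"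
      using root by simp
    then show ?thesis
      using uv by (simp only: Kf.lift_R Kf.m_closed Kf.minus_closed)
  qed
  have uv: "(a2, \<zero>) \<in> carrier K" "(a4, \<zero>) \<in> carrier K" "(l, \<zero>) \<in> carrier K" "(n, \<zero>) \<in> carrier K"
    "(s, \<zero>) \<in> carrier K" "(c0, \<zero>) \<in> carrier K" "(x, \<zero>) \<in> carrier K" "(u, v) \<in> carrier K"
    using c sc by auto
  have "((l, \<zero>) \<otimes>\<^bsub>K\<^esub> (u, v) \<oplus>\<^bsub>K\<^esub> (n, \<zero>)) \<otimes>\<^bsub>K\<^esub> ((l, \<zero>) \<otimes>\<^bsub>K\<^esub> (u, v) \<oplus>\<^bsub>K\<^esub> (n, \<zero>)) = cubic K (a2, \<zero>) (a4, \<zero>) (u, v)"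
  proof (subst Kf.curve_lift)
    show "lift K ((l, \<zero>) \<otimes>\<^bsub>K\<^esub> (u, v) \<oplus>\<^bsub>K\<^esub> (n, \<zero>)) * lift K ((l, \<zero>) \<otimes>\<^bsub>K\<^esub> (u, v) \<oplus>\<^bsub>K\<^esub> (n, \<zero>)) =
      lift K (u, v) * (lift K (u, v) * lift K (u, v)) + lift K (a2, \<zero>) * (lift K (u, v) * lift K (u, v)) +
      lift K (a4, \<zero>) * lift K (u, v)"
      using ring_line_cubic[of "lift K (s, \<zero>)" "lift K (x, \<zero>)" "lift K (l, \<zero>)" "lift K (a2, \<zero>)" "lift K (c0, \<zero>)"
          "lift K (a4, \<zero>)" "lift K (n, \<zero>)" "lift K (u, v)"] L rl uv
      by (simp only: Kf.lift_R Kf.line_cubic_lift Kf.m_closed) simp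
  qed (use uv in \<open>simp_all only: Kf.m_closed Kf.a_closed\<close>)
  moreover have "(l, \<zero>) \<otimes>\<^bsub>K\<^esub> (u, v) \<oplus>\<^bsub>K\<^esub> (n, \<zero>) = (l \<otimes> u \<oplus> n, l \<otimes> v)" using c by simp
  ultimately show ?thesis
    unfolding ec_points_def using c by simp
qed

end

text \<open>\<open>re\<close> and \<open>im\<close> are the two components of the curve equation at
  (u + v sqrt d, r + s sqrt d), the second one divided by v. The first Vieta relation is the
  definition of x; the conclusions are the other two.\<close>

lemma ring_norm_lc:
  fixes u :: "'k::comm_ring_1"
  assumes re: "r * r + d * (s * s) = u * u * u + 3 * (d * u * v * v) + a2 * (u * u + d * v * v) + a4 * u"
    and im: "2 * (r * l) = 3 * (u * u) + d * v * v + 2 * (a2 * u) + a4"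
    and s: "s = l * v"
    and x: "x = l * l - a2 - u - u"
    and n: "n = r - l * u"
  shows "u * u - d * (v * v) + (u + u) * x = a4 - 2 * (l * n)" "(u * u - d * (v * v)) * x = n * n"
proof -
  have a4: "a4 = 2 * (r * l) - 3 * (u * u) - d * v * v - 2 * (a2 * u)" using im by (simp add: algebra_simps)
  show "u * u - d * (v * v) + (u + u) * x = a4 - 2 * (l * n)"
    unfolding x n a4 by (simp add: algebra_simps)
  have rr: "r * r = u * u * u + 3 * (d * u * v * v) + a2 * (u * u + d * v * v) + a4 * u - d * (s * s)"
    using re by (simp add: algebra_simps)
  have "n * n = r * r - 2 * (r * l) * u + l * l * u * u" unfolding n by (simp add: algebra_simps)
  also have "\<dots> = (u * u - d * (v * v)) * x"
    unfolding rr im s x by (simp add: algebra_simps)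
  finally show "(u * u - d * (v * v)) * x = n * n" by simp
qed

context nonsquare
begin

lemma quad_point_cases:
  assumes c: "a2 \<in> carrier R" "a4 \<in> carrier R"
    and P: "Some ((u, v), (r, s)) \<in> ec_points K (a2, \<zero>) (a4, \<zero>)"
  shows "u \<in> carrier R" "v \<in> carrier R" "r \<in> carrier R" "s \<in> carrier R"
    and "lift R r * lift R r + lift R d * (lift R s * lift R s) = lift R u * lift R u * lift R u
      + 3 * (lift R d * lift R u * lift R v * lift R v) + lift R a2 * (lift R u * lift R u + lift R d * lift R v * lift R v) + lift R a4 * lift R u"
    and "2 * (lift R r * lift R s) = lift R v * (3 * (lift R u * lift R u) + lift R d * lift R v * lift R v + 2 * (lift R a2 * lift R u) + lift R a4)"
proof -
  from P show C: "u \<in> carrier R" "v \<in> carrier R" "r \<in> carrier R" "s \<in> carrier R"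
    unfolding ec_points_def by auto
  have e: "(r, s) \<otimes>\<^bsub>K\<^esub> (r, s) = cubic K (a2, \<zero>) (a4, \<zero>) (u, v)"
    using P unfolding ec_points_def by blast
  have f: "lift R (fst ((r, s) \<otimes>\<^bsub>K\<^esub> (r, s))) = lift R (fst (cubic K (a2, \<zero>) (a4, \<zero>) (u, v)))"
    by (simp only: e)
  have g: "lift R (snd ((r, s) \<otimes>\<^bsub>K\<^esub> (r, s))) = lift R (snd (cubic K (a2, \<zero>) (a4, \<zero>) (u, v)))"
    by (simp only: e)
  show "lift R r * lift R r + lift R d * (lift R s * lift R s) = lift R u * lift R u * lift R u
      + 3 * (lift R d * lift R u * lift R v * lift R v) + lift R a2 * (lift R u * lift R u + lift R d * lift R v * lift R v) + lift R a4 * lift R u"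
    using f C c by (simp add: algebra_simps)
  show "2 * (lift R r * lift R s) = lift R v * (3 * (lift R u * lift R u) + lift R d * lift R v * lift R v + 2 * (lift R a2 * lift R u) + lift R a4)"
    using g C c by (simp add: algebra_simps)
qed

text \<open>The line through the point and its conjugate has slope s / v and is therefore defined
  over R.\<close>

lemma quad_point_line_cubic:
  assumes c: "a2 \<in> carrier R" "a4 \<in> carrier R"
    and P: "Some ((u, v), (r, s)) \<in> ec_points K (a2, \<zero>) (a4, \<zero>)" and v: "v \<noteq> \<zero>"
  obtains l n x where "l \<in> carrier R" "n \<in> carrier R" "x \<in> carrier R"
    "r = l \<otimes> u \<oplus> n" "s = l \<otimes> v"
    "line_cubic R a2 a4 l n (u \<oplus> u) (u \<otimes> u \<ominus> d \<otimes> (v \<otimes> v)) x"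
proof -
  note Q = quad_point_cases[OF c P]
  define l where "l = s \<otimes> inv v"
  define n where "n = r \<ominus> l \<otimes> u"
  define x where "x = l \<otimes> l \<ominus> a2 \<ominus> u \<ominus> u"
  have l: "l \<in> carrier R" "s = l \<otimes> v"
    unfolding l_def using mult_inv_cancel[of s v] Q v by auto
  have nx: "n \<in> carrier R" "x \<in> carrier R" unfolding n_def x_def using l Q c by auto
  have r: "r = l \<otimes> u \<oplus> n"
    by (rule lift_eqI) (use Q l in \<open>simp_all add: n_def\<close>)
  have sl: "lift R s = lift R l * lift R v" using l Q by simp
  have "v \<otimes> (r \<otimes> l \<oplus> r \<otimes> l) = v \<otimes> (u \<otimes> u \<oplus> u \<otimes> u \<oplus> u \<otimes> u \<oplus> d \<otimes> v \<otimes> v \<oplus> (a2 \<otimes> u \<oplus> a2 \<otimes> u) \<oplus> a4)"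
    by (rule lift_eqI) (use Q c l in \<open>simp_all add: sl algebra_simps\<close>)
  then have "r \<otimes> l \<oplus> r \<otimes> l = u \<otimes> u \<oplus> u \<otimes> u \<oplus> u \<otimes> u \<oplus> d \<otimes> v \<otimes> v \<oplus> (a2 \<otimes> u \<oplus> a2 \<otimes> u) \<oplus> a4"
    by (rule iffD1[OF m_lcancel[OF v], rotated -1]) (use c l Q in simp_all)
  then have "lift R (r \<otimes> l \<oplus> r \<otimes> l) = lift R (u \<otimes> u \<oplus> u \<otimes> u \<oplus> u \<otimes> u \<oplus> d \<otimes> v \<otimes> v \<oplus> (a2 \<otimes> u \<oplus> a2 \<otimes> u) \<oplus> a4)"
    by simp
  then have im: "2 * (lift R r * lift R l) = 3 * (lift R u * lift R u) + lift R d * lift R v * lift R v + 2 * (lift R a2 * lift R u) + lift R a4"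
    using c l Q by (simp add: algebra_simps)
  have xl: "lift R x = lift R l * lift R l - lift R a2 - lift R u - lift R u"
    unfolding x_def using c l Q by simp
  have nl: "lift R n = lift R r - lift R l * lift R u"
    unfolding n_def using c l Q by simp
  have "line_cubic R a2 a4 l n (u \<oplus> u) (u \<otimes> u \<ominus> d \<otimes> (v \<otimes> v)) x"
    using ring_norm_lc[OF Q(5) im sl xl nl] c l Q nx by (simp add: line_cubic_lift xl)
  then show ?thesis using that l nx r by blast
qed

end

section \<open>Square classes\<close>

text \<open>An injection of the group of square classes into some abelian group.\<close>
locale square_class_field = odd_char_field +
  fixes cl :: "'a \<Rightarrow> 'g::ab_group_add"
  assumes cl_mult: "\<lbrakk>x \<in> carrier R; y \<in> carrier R; x \<noteq> \<zero>; y \<noteq> \<zero>\<rbrakk> \<Longrightarrow> cl (x \<otimes> y) = cl x + cl y"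
    and cl_eq_0_iff: "\<lbrakk>x \<in> carrier R; x \<noteq> \<zero>\<rbrakk> \<Longrightarrow> cl x = 0 \<longleftrightarrow> (\<exists>s\<in>carrier R. s \<otimes> s = x)"
begin

lemma nz_mult: "x \<in> carrier R \<Longrightarrow> y \<in> carrier R \<Longrightarrow> x \<noteq> \<zero> \<Longrightarrow> y \<noteq> \<zero> \<Longrightarrow> x \<otimes> y \<noteq> \<zero>"
  using integral by blast

lemma cl_double: "x \<in> carrier R \<Longrightarrow> x \<noteq> \<zero> \<Longrightarrow> cl x + cl x = 0"
  using cl_mult[of x x] cl_eq_0_iff[of "x \<otimes> x"] nz_mult[of x x] by auto

lemma cl_add_eq_0: "x \<in> carrier R \<Longrightarrow> x \<noteq> \<zero> \<Longrightarrow> cl x + g = 0 \<longleftrightarrow> g = cl x"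
  using cl_double[of x] by (metis add_left_cancel)

lemma cl_eq_iff:
  assumes "x \<in> carrier R" "y \<in> carrier R" "x \<noteq> \<zero>" "y \<noteq> \<zero>"
  shows "cl x = cl y \<longleftrightarrow> (\<exists>s\<in>carrier R. s \<otimes> s = x \<otimes> y)"
  using cl_eq_0_iff[of "x \<otimes> y"] cl_add_eq_0[of x "cl y"] cl_mult[of x y] nz_mult[of x y] assms by auto

text \<open>One component of the Kummer map. At a root of the cubic the factor x vanishes, and w is
  then meant to be the product of the other two factors, because all three have to multiply to a
  square.\<close>

definition root_class :: "'a \<Rightarrow> 'a \<Rightarrow> 'g" where
  "root_class w x = cl (if x = \<zero> then w else x)"

text \<open>Off the root this is the relation c x = n^2; at the root n = 0, and the second Vieta
  relation leaves c = a4.\<close>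

lemma root_class_line_cubic:
  assumes c: "a2 \<in> carrier R" "a4 \<in> carrier R" "l \<in> carrier R" "n \<in> carrier R" "s \<in> carrier R"
    "c \<in> carrier R" "x \<in> carrier R" "line_cubic R a2 a4 l n s c x"
    and nz: "c \<noteq> \<zero>" "a4 \<noteq> \<zero>"
  shows "root_class a4 x = cl c"
proof (cases "x = \<zero>")
  case True
  then have "n = \<zero>" using c integral[of n n] by (auto simp: line_cubic_def)
  then have "c = a4" using True c by (simp add: line_cubic_def a_minus_def)
  then show ?thesis using True by (simp add: root_class_def)
next
  case False
  have "n \<otimes> n = c \<otimes> x" using c by (simp add: line_cubic_def)
  then have "cl c = cl x" using cl_eq_iff[of c x] False nz c by auto
  then show ?thesis using False by (simp add: root_class_def)
qed

text \<open>If x1 x2 = 0, the line passes through the torsion point (0, 0). Then n = 0 and (x1 + x2)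
  x3 = a4, which takes the place of the relation with n^2.\<close>

lemma root_class_three_points:
  assumes c: "a2 \<in> carrier R" "a4 \<in> carrier R" "l \<in> carrier R" "n \<in> carrier R" "x1 \<in> carrier R"
    "x2 \<in> carrier R" "x3 \<in> carrier R" "line_cubic R a2 a4 l n (x1 \<oplus> x2) (x1 \<otimes> x2) x3"
    and nz: "a4 \<noteq> \<zero>"
  shows "root_class a4 x3 = root_class a4 x1 + root_class a4 x2"
proof (cases "x1 \<otimes> x2 = \<zero>")
  case False
  then have "x1 \<noteq> \<zero>" "x2 \<noteq> \<zero>" using c by auto
  then show ?thesis using root_class_line_cubic[OF c(1-4) _ _ c(7,8) False nz] cl_mult c by (simp add: root_class_def)
next
  case True
  have n: "n = \<zero>" using True c integral[of n n] by (auto simp: line_cubic_def)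
  have e: "(x1 \<oplus> x2) \<otimes> x3 = a4" using c(8) n True c(1-7) by (simp add: line_cubic_def a_minus_def)
  have "x1 = \<zero> \<or> x2 = \<zero>" using True c integral by blast
  then show ?thesis
  proof
    assume x1: "x1 = \<zero>"
    then have f: "x2 \<otimes> x3 = a4" using e c by simp
    then have g: "x2 \<noteq> \<zero>" "x3 \<noteq> \<zero>" using nz c by auto
    have "cl a4 = cl x2 + cl x3" using cl_mult[of x2 x3] f g c by simp
    then show ?thesis using x1 g c cl_double[of x2] by (simp add: root_class_def algebra_simps flip: add.assoc)
  next
    assume x2: "x2 = \<zero>"
    then have f: "x1 \<otimes> x3 = a4" using e c by simp
    then have g: "x1 \<noteq> \<zero>" "x3 \<noteq> \<zero>" using nz c by auto
    have "cl a4 = cl x1 + cl x3" using cl_mult[of x1 x3] f g c by simp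
    then show ?thesis using x2 g c cl_double[of x1] by (simp add: root_class_def algebra_simps flip: add.assoc)
  qed
qed

end

text \<open>The translation by a moves the root -a to 0, so that statements on the root 0 apply to
  -a as well. Here c + a s + a^2 is the product of the two translated abscissas.\<close>

lemma (in odd_char_field) line_cubic_shift:
  assumes c: "a \<in> carrier R" "b \<in> carrier R" "l \<in> carrier R" "n \<in> carrier R" "s \<in> carrier R"
    "c \<in> carrier R" "x \<in> carrier R" "line_cubic R (a \<oplus> b) (a \<otimes> b) l n s c x"
  shows "line_cubic R (\<ominus> a \<oplus> (b \<ominus> a)) (\<ominus> a \<otimes> (b \<ominus> a)) l (n \<ominus> l \<otimes> a) (s \<oplus> a \<oplus> a) (c \<oplus> a \<otimes> s \<oplus> a \<otimes> a) (x \<oplus> a)"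
proof -
  define A B L N S C X where d: "A = lift R a" "B = lift R b" "L = lift R l" "N = lift R n" "S = lift R s" "C = lift R c" "X = lift R x"
  have "S + X = L * L - (A + B)" "C + S * X = A * B - 2 * (L * N)" "C * X = N * N"
    using c by (simp_all add: line_cubic_lift d)
  then have e: "B = L * L - A - S - X" and f: "C = A * B - 2 * (L * N) - S * X" and g: "C * X = N * N"
    by (simp_all add: algebra_simps)
  have 1: "S + A + A + (X + A) = L * L - (- A + (B - A))" unfolding e by (simp add: algebra_simps)
  have 2: "C + A * S + A * A + (S + A + A) * (X + A) = - A * (B - A) - 2 * (L * (N - L * A))"
    unfolding f e by (simp add: algebra_simps)
  have "(C + A * S + A * A) * (X + A) - (N - L * A) * (N - L * A) = (C * X - N * N) + A * (C - (A * B - 2 * (L * N) - S * X))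
    + A * A * (S + X - (L * L - A - B))" by (simp add: algebra_simps)
  also have "\<dots> = 0" using e f g by simp
  finally have 3: "(C + A * S + A * A) * (X + A) = (N - L * A) * (N - L * A)" by simp
  show ?thesis using c 1 2 3 by (subst line_cubic_lift) (simp_all add: d)
qed

lemma (in nonsquare) quad_pointI:
  assumes c: "a2 \<in> carrier R" "a4 \<in> carrier R" "u \<in> carrier R" "v \<in> carrier R" "r \<in> carrier R" "s \<in> carrier R"
    and "lift R r * lift R r + lift R d * (lift R s * lift R s) = lift R u * lift R u * lift R u
      + 3 * (lift R d * lift R u * lift R v * lift R v) + lift R a2 * (lift R u * lift R u + lift R d * lift R v * lift R v) + lift R a4 * lift R u"
    and "2 * (lift R r * lift R s) = lift R v * (3 * (lift R u * lift R u) + lift R d * lift R v * lift R v + 2 * (lift R a2 * lift R u) + lift R a4)"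
  shows "Some ((u, v), (r, s)) \<in> ec_points K (a2, \<zero>) (a4, \<zero>)"
proof -
  have f: "fst ((r, s) \<otimes>\<^bsub>K\<^esub> (r, s)) = fst (cubic K (a2, \<zero>) (a4, \<zero>) (u, v))"
    by (rule lift_eqI) (use assms in \<open>simp_all add: algebra_simps\<close>)
  have g: "snd ((r, s) \<otimes>\<^bsub>K\<^esub> (r, s)) = snd (cubic K (a2, \<zero>) (a4, \<zero>) (u, v))"
    by (rule lift_eqI) (use assms in \<open>simp_all add: algebra_simps\<close>)
  have "(r, s) \<otimes>\<^bsub>K\<^esub> (r, s) = cubic K (a2, \<zero>) (a4, \<zero>) (u, v)"
    using f g by (rule prod_eqI)
  then show ?thesis unfolding ec_points_def using c by simp
qed

text \<open>With X_i = x - e_i for the roots e_i of the cubic and X_i r_i^2 - d X_i = k independent of i, the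
  slope of the line through R and its conjugate is l = y (r_1 r_2 + r_1 r_3 + r_2 r_3 + d) / k. Writing
  m for y r_1 keeps the formula valid at the torsion point with X_1 = 0.\<close>
lemma ring_kramer1:
  fixes k :: "'k::comm_ring_1"
  assumes "k * l = m * A + y * B" "k * W = X2 * X3 + l * y" "A = r2 + r3" "B = r2 * r3 + d"
    "k = X2 * (r2 * r2 - d)" "k = X3 * (r3 * r3 - d)" "y * y = X1 * X2 * X3"
    "m * m = X2 * X3 * k + d * (y * y)"
  shows "k * k * (l * l) = k * k * (X2 + X3 - X1 + 2 * (B * W))"
proof -
  have y: "k * k * X1 = (y * y) * ((r2 * r2 - d) * (r3 * r3 - d))"
  proof -
    have "k * k * X1 = (X2 * (r2 * r2 - d)) * (X3 * (r3 * r3 - d)) * X1" using assms(5,6) by metis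
    then show ?thesis by (simp add: assms(7) algebra_simps)
  qed
  have BA: "B * B - d * A * A = (r2 * r2 - d) * (r3 * r3 - d)"
    unfolding assms(3,4) by (simp add: algebra_simps)
  have AA: "A * A = (r2 * r2 - d) + (r3 * r3 - d) + 2 * B"
    unfolding assms(3,4) by (simp add: algebra_simps)
  have XA: "X2 * X3 * (A * A) = k * (X2 + X3) + 2 * B * X2 * X3"
  proof -
    have "X2 * X3 * (A * A) = X3 * (X2 * (r2 * r2 - d)) + X2 * (X3 * (r3 * r3 - d)) + 2 * B * X2 * X3"
      unfolding AA by (simp add: algebra_simps)
    also have "\<dots> = X3 * k + X2 * k + 2 * B * X2 * X3" using assms(5,6) by simp
    finally show ?thesis by (simp add: algebra_simps)
  qed
  have "k * k * (l * l) = (m * A + y * B) * (m * A + y * B)"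
    unfolding assms(1)[symmetric] by (simp add: algebra_simps)
  also have "\<dots> = (m * m) * (A * A) + 2 * B * y * (m * A + y * B) - (y * y) * (B * B)"
    by (simp add: algebra_simps)
  also have "\<dots> = k * (X2 * X3 * (A * A)) - (y * y) * (B * B - d * A * A) + 2 * B * y * (m * A + y * B)"
    unfolding assms(8) by (simp add: algebra_simps)
  also have "\<dots> = k * (k * (X2 + X3) + 2 * B * X2 * X3) - k * k * X1 + 2 * B * y * (k * l)"
    unfolding XA BA y assms(1) by simp
  also have "\<dots> = k * k * (X2 + X3 - X1) + 2 * B * k * (X2 * X3 + l * y)" by (simp add: algebra_simps)
  also have "\<dots> = k * k * (X2 + X3 - X1 + 2 * (B * W))"
    unfolding assms(2)[symmetric] by (simp add: algebra_simps)
  finally show ?thesis .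
qed

text \<open>With h = B W - X1 and v = A W this is the second Vieta relation in coordinates centred
  at x, multiplied by the factor X2 X3 that a field allows to be cancelled.\<close>

lemma ring_kramer2:
  fixes k :: "'k::comm_ring_1"
  assumes "l * l = X2 + X3 - X1 + 2 * (B * W)" "k * W = X2 * X3 + l * y" "A = r2 + r3" "B = r2 * r3 + d"
    "k = X2 * (r2 * r2 - d)" "k = X3 * (r3 * r3 - d)" "y * y = X1 * X2 * X3"
  shows "X2 * X3 * ((B * W - X1) * (B * W - X1) - d * (A * W * (A * W)))
    = X2 * X3 * (X1 * X2 + X1 * X3 + X2 * X3 + 2 * (l * y))"
proof -
  have BA: "B * B - d * A * A = (r2 * r2 - d) * (r3 * r3 - d)"
    unfolding assms(3,4) by (simp add: algebra_simps)
  have "X2 * X3 * ((B * W - X1) * (B * W - X1) - d * (A * W * (A * W)))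
    = X2 * X3 * (B * B - d * A * A) * (W * W) + X2 * X3 * (X1 * X1 - X1 * (2 * (B * W)))"
    by (simp add: algebra_simps)
  also have "X2 * X3 * (B * B - d * A * A) * (W * W) = (X2 * (r2 * r2 - d)) * (X3 * (r3 * r3 - d)) * (W * W)"
    unfolding BA by (simp add: algebra_simps)
  also have "\<dots> = (k * W) * (k * W)"
    unfolding assms(5)[symmetric] assms(6)[symmetric] by (simp add: algebra_simps)
  also have "\<dots> = X2 * X3 * (X2 * X3 + 2 * (l * y)) + (l * l) * (y * y)"
    unfolding assms(2) by (simp add: algebra_simps)
  also have "\<dots> = X2 * X3 * (X2 * X3 + 2 * (l * y) + X1 * (l * l))"
    unfolding assms(7) by (simp add: algebra_simps)
  also have "\<dots> + X2 * X3 * (X1 * X1 - X1 * (2 * (B * W))) = X2 * X3 * (X1 * X2 + X1 * X3 + X2 * X3 + 2 * (l * y))"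
    unfolding assms(1) by (simp add: algebra_simps)
  finally show ?thesis .
qed

section \<open>Constructing a line from equal square classes\<close>

locale square_class_nonsquare = square_class_field + nonsquare
begin

text \<open>The value t = 0 is allowed and gets r = 0; this covers the torsion points of the
  twist.\<close>

lemma root_of_class:
  assumes "X \<in> carrier R" "t \<in> carrier R" "X \<noteq> \<zero>" "t \<noteq> \<zero> \<Longrightarrow> cl X = cl t"
  obtains r where "r \<in> carrier R" "t = X \<otimes> (r \<otimes> r)"
proof (cases "t = \<zero>")
  case True
  then show ?thesis using that[of \<zero>] assms by simp
next
  case False
  then obtain z where z: "z \<in> carrier R" "z \<otimes> z = X \<otimes> t" using assms cl_eq_iff[of X t] by auto
  have i: "inv X \<in> carrier R" "X \<otimes> inv X = \<one>" using assms field_Units by auto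
  have "X \<otimes> ((z \<otimes> inv X) \<otimes> (z \<otimes> inv X)) = (X \<otimes> inv X) \<otimes> ((z \<otimes> z) \<otimes> inv X)"
    using z(1) i(1) assms(1) by (simp add: m_ac)
  also have "\<dots> = (X \<otimes> t) \<otimes> inv X" unfolding i(2) z(2) using i(1) assms(1,2) by simp
  also have "\<dots> = t \<otimes> (X \<otimes> inv X)" using i(1) assms(1,2) by (simp add: m_ac)
  also have "\<dots> = t" using i assms by simp
  finally show ?thesis using that[of "z \<otimes> inv X"] z i by simp
qed

text \<open>X1, X2, X3 are the three factors of the cubic at P, in an order where only X1 may
  vanish, and t1, t2, t3 those of the twist. The wanted abscissa over K is x + h + v sqrt d, and the
  two equations are Vieta relations relative to x.\<close>

lemma kramer_core:
  assumes c: "y \<in> carrier R" "X1 \<in> carrier R" "X2 \<in> carrier R" "X3 \<in> carrier R" "k \<in> carrier R"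
    and nz: "X2 \<noteq> \<zero>" "X3 \<noteq> \<zero>" and y: "y \<otimes> y = X1 \<otimes> X2 \<otimes> X3"
    and t: "t1 = k \<oplus> d \<otimes> X1" "t2 = k \<oplus> d \<otimes> X2" "t3 = k \<oplus> d \<otimes> X3"
    and 1: "X1 \<noteq> \<zero> \<Longrightarrow> t1 \<noteq> \<zero> \<Longrightarrow> cl X1 = cl t1"
    and 10: "X1 = \<zero> \<Longrightarrow> t1 \<noteq> \<zero> \<Longrightarrow> cl (X2 \<otimes> X3) = cl t1"
    and 2: "t2 \<noteq> \<zero> \<Longrightarrow> cl X2 = cl t2"
    and 3: "t3 \<noteq> \<zero> \<Longrightarrow> cl X3 = cl t3"
  obtains l h v where "l \<in> carrier R" "h \<in> carrier R" "v \<in> carrier R"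
    "lift R l * lift R l = lift R X1 + lift R X2 + lift R X3 + 2 * lift R h"
    "lift R h * lift R h - lift R d * (lift R v * lift R v)
      = lift R X1 * lift R X2 + lift R X1 * lift R X3 + lift R X2 * lift R X3 + 2 * (lift R l * lift R y)"
proof -
  have tc: "t1 \<in> carrier R" "t2 \<in> carrier R" "t3 \<in> carrier R" using t c by auto
  obtain r2 where r2: "r2 \<in> carrier R" "t2 = X2 \<otimes> (r2 \<otimes> r2)" using root_of_class[of X2 t2] c tc nz 2 by blast
  obtain r3 where r3: "r3 \<in> carrier R" "t3 = X3 \<otimes> (r3 \<otimes> r3)" using root_of_class[of X3 t3] c tc nz 3 by blast
  \<comment> \<open>m stands for y r1. If X1 = 0, the class at this root is that of X2 X3, and m =
    X2 X3 r has the same square X2 X3 t1.\<close>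
  obtain m where m: "m \<in> carrier R" "m \<otimes> m = X2 \<otimes> X3 \<otimes> t1"
  proof (cases "X1 = \<zero>")
    case True
    have "t1 \<noteq> \<zero> \<Longrightarrow> cl (X2 \<otimes> X3) = cl t1" using 10 True by blast
    then obtain r where "r \<in> carrier R" "t1 = X2 \<otimes> X3 \<otimes> (r \<otimes> r)"
      using root_of_class[of "X2 \<otimes> X3" t1] c tc nz nz_mult[of X2 X3] by auto
    then show ?thesis using that[of "X2 \<otimes> X3 \<otimes> r"] c by (simp add: m_ac)
  next
    case False
    then obtain r where r: "r \<in> carrier R" "t1 = X1 \<otimes> (r \<otimes> r)" using root_of_class[of X1 t1] c tc 1 by blast
    have "(y \<otimes> r) \<otimes> (y \<otimes> r) = (y \<otimes> y) \<otimes> (r \<otimes> r)" using r c by (simp add: m_ac)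
    also have "\<dots> = X2 \<otimes> X3 \<otimes> t1" unfolding y r(2) using r(1) c by (simp add: m_ac)
    finally show ?thesis using that[of "y \<otimes> r"] r c by simp
  qed
  have k2: "k = X2 \<otimes> (r2 \<otimes> r2 \<ominus> d)"
  proof (rule lift_eqI)
    have "lift R (k \<oplus> d \<otimes> X2) = lift R (X2 \<otimes> (r2 \<otimes> r2))" using r2 t by simp
    then show "lift R k = lift R (X2 \<otimes> (r2 \<otimes> r2 \<ominus> d))" using c r2(1) by (simp add: algebra_simps flip: eq_diff_eq)
  qed (use c r2 in simp_all)
  have k3: "k = X3 \<otimes> (r3 \<otimes> r3 \<ominus> d)"
  proof (rule lift_eqI)
    have "lift R (k \<oplus> d \<otimes> X3) = lift R (X3 \<otimes> (r3 \<otimes> r3))" using r3 t by simp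
    then show "lift R k = lift R (X3 \<otimes> (r3 \<otimes> r3 \<ominus> d))" using c r3(1) by (simp add: algebra_simps flip: eq_diff_eq)
  qed (use c r3 in simp_all)
  \<comment> \<open>Since d is not a square, k = X2 (r2^2 - d) is nonzero and may be divided
    by.\<close>
  have "r2 \<otimes> r2 \<ominus> d \<noteq> \<zero>" using d_nonsquare[of r2] r2(1) by simp
  then have knz: "k \<noteq> \<zero>" using k2 nz_mult[of X2 "r2 \<otimes> r2 \<ominus> d"] c r2(1) nz by auto
  define A where "A = r2 \<oplus> r3"
  define B where "B = r2 \<otimes> r3 \<oplus> d"
  define l where "l = (m \<otimes> A \<oplus> y \<otimes> B) \<otimes> inv k"
  define W where "W = (X2 \<otimes> X3 \<oplus> l \<otimes> y) \<otimes> inv k"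
  have AB: "A \<in> carrier R" "B \<in> carrier R" unfolding A_def B_def using r2 r3 by auto
  have l: "l \<in> carrier R" "l \<otimes> k = m \<otimes> A \<oplus> y \<otimes> B"
    unfolding l_def using mult_inv_cancel[of "m \<otimes> A \<oplus> y \<otimes> B" k] AB m c knz by auto
  have W: "W \<in> carrier R" "W \<otimes> k = X2 \<otimes> X3 \<oplus> l \<otimes> y"
    unfolding W_def using mult_inv_cancel[of "X2 \<otimes> X3 \<oplus> l \<otimes> y" k] l AB m c knz by auto
  have e1: "lift R k * lift R l = lift R m * lift R A + lift R y * lift R B"
    using arg_cong[OF l(2), of "lift R"] l(1) AB m(1) c by (simp add: mult.commute)
  have e2: "lift R k * lift R W = lift R X2 * lift R X3 + lift R l * lift R y"
    using arg_cong[OF W(2), of "lift R"] l(1) W(1) c by (simp add: mult.commute)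
  have e3: "lift R A = lift R r2 + lift R r3" "lift R B = lift R r2 * lift R r3 + lift R d"
    using r2(1) r3(1) by (simp_all add: A_def B_def)
  have e5: "lift R k = lift R X2 * (lift R r2 * lift R r2 - lift R d)"
    using arg_cong[OF k2, of "lift R"] r2(1) c by simp
  have e6: "lift R k = lift R X3 * (lift R r3 * lift R r3 - lift R d)"
    using arg_cong[OF k3, of "lift R"] r3(1) c by simp
  have e7: "lift R y * lift R y = lift R X1 * lift R X2 * lift R X3"
    using arg_cong[OF y, of "lift R"] c by simp
  have e8: "lift R m * lift R m = lift R X2 * lift R X3 * lift R k + lift R d * (lift R y * lift R y)"
    using arg_cong[OF m(2), of "lift R"] m(1) c unfolding e7 t(1) by (simp add: algebra_simps)
  have "k \<otimes> k \<otimes> (l \<otimes> l) = k \<otimes> k \<otimes> (X2 \<oplus> X3 \<ominus> X1 \<oplus> (B \<otimes> W \<oplus> B \<otimes> W))"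
    by (rule lift_eqI) (use ring_kramer1[OF e1 e2 e3 e5 e6 e7 e8] l(1) W(1) AB c in simp_all)
  then have "l \<otimes> l = X2 \<oplus> X3 \<ominus> X1 \<oplus> (B \<otimes> W \<oplus> B \<otimes> W)"
    by (rule iffD1[OF m_lcancel[OF nz_mult[OF _ _ knz knz]], rotated -1]) (use l(1) W(1) AB c in simp_all)
  then have "lift R (l \<otimes> l) = lift R (X2 \<oplus> X3 \<ominus> X1 \<oplus> (B \<otimes> W \<oplus> B \<otimes> W))" by simp
  then have f1: "lift R l * lift R l = lift R X2 + lift R X3 - lift R X1 + 2 * (lift R B * lift R W)"
    using l(1) W(1) AB c by simp
  define h v where "h = B \<otimes> W \<ominus> X1" and "v = A \<otimes> W"
  have hv: "h \<in> carrier R" "v \<in> carrier R" unfolding h_def v_def using W(1) AB c by auto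
  have "X2 \<otimes> X3 \<otimes> (h \<otimes> h \<ominus> d \<otimes> (v \<otimes> v)) = X2 \<otimes> X3 \<otimes> (X1 \<otimes> X2 \<oplus> X1 \<otimes> X3 \<oplus> X2 \<otimes> X3 \<oplus> (l \<otimes> y \<oplus> l \<otimes> y))"
    by (rule lift_eqI) (use ring_kramer2[OF f1 e2 e3 e5 e6 e7] l(1) W(1) AB c in \<open>simp_all add: h_def v_def\<close>)
  then have "h \<otimes> h \<ominus> d \<otimes> (v \<otimes> v) = X1 \<otimes> X2 \<oplus> X1 \<otimes> X3 \<oplus> X2 \<otimes> X3 \<oplus> (l \<otimes> y \<oplus> l \<otimes> y)"
    by (rule iffD1[OF m_lcancel[OF nz_mult[OF _ _ nz]], rotated -1]) (use l(1) hv c in simp_all)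
  then have "lift R (h \<otimes> h \<ominus> d \<otimes> (v \<otimes> v)) = lift R (X1 \<otimes> X2 \<oplus> X1 \<otimes> X3 \<oplus> X2 \<otimes> X3 \<oplus> (l \<otimes> y \<oplus> l \<otimes> y))" by simp
  then have f2: "lift R h * lift R h - lift R d * (lift R v * lift R v)
      = lift R X1 * lift R X2 + lift R X1 * lift R X3 + lift R X2 * lift R X3 + 2 * (lift R l * lift R y)"
    using l(1) hv c by simp
  have f3: "lift R l * lift R l = lift R X1 + lift R X2 + lift R X3 + 2 * lift R h"
    unfolding f1 h_def using W(1) AB c by (simp add: algebra_simps)
  show ?thesis using that[OF l(1) hv f3 f2] .
qed

end

section \<open>The Kummer map and Kramer's criterion\<close>

definition ec_neg :: "'a ring \<Rightarrow> ('a \<times> 'a) option \<Rightarrow> ('a \<times> 'a) option" where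
  "ec_neg R = map_option (\<lambda>(x, y). (x, a_inv R y))"

locale elliptic_curve = square_class_field +
  fixes a b
  assumes ab_carrier [simp]: "a \<in> carrier R" "b \<in> carrier R"
    and ab_nz: "a \<noteq> \<zero>" "b \<noteq> \<zero>" "a \<noteq> b"
begin

abbreviation E where "E \<equiv> ec_points R (a \<oplus> b) (a \<otimes> b)"
abbreviation pls where "pls \<equiv> ec_add R (a \<oplus> b) (a \<otimes> b)"
abbreviation k0 where "k0 x \<equiv> root_class (a \<otimes> b) x"
abbreviation ka where "ka x \<equiv> root_class (\<ominus> a \<otimes> (b \<ominus> a)) (x \<oplus> a)"
abbreviation kb where "kb x \<equiv> root_class (\<ominus> b \<otimes> (a \<ominus> b)) (x \<oplus> b)"

text \<open>The class at the third root -b is left out: by \<open>k_sum\<close> it is the sum of the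
  other two.\<close>

definition kummer :: "('a \<times> 'a) option \<Rightarrow> 'b \<times> 'b" where
  "kummer P = (case P of None \<Rightarrow> (0, 0) | Some (x, y) \<Rightarrow> (k0 x, ka x))"

lemma ab_nz' [simp]: "a \<otimes> b \<noteq> \<zero>" "\<ominus> a \<otimes> (b \<ominus> a) \<noteq> \<zero>" "\<ominus> b \<otimes> (a \<ominus> b) \<noteq> \<zero>" "a \<ominus> b \<noteq> \<zero>" "b \<ominus> a \<noteq> \<zero>"
  "\<ominus> a \<noteq> \<zero>" "\<ominus> b \<noteq> \<zero>"
proof -
  show 1: "\<ominus> a \<noteq> \<zero>" "\<ominus> b \<noteq> \<zero>" "a \<ominus> b \<noteq> \<zero>" "b \<ominus> a \<noteq> \<zero>"
    using ab_nz r_right_minus_eq[of a b] r_right_minus_eq[of b a] by (auto simp: add.inv_eq_1_iff)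
  show "a \<otimes> b \<noteq> \<zero>" "\<ominus> a \<otimes> (b \<ominus> a) \<noteq> \<zero>" "\<ominus> b \<otimes> (a \<ominus> b) \<noteq> \<zero>"
    by (rule nz_mult; use 1 ab_nz in simp)+
qed

lemma mem_E: "Some (x, y) \<in> E \<longleftrightarrow> x \<in> carrier R \<and> y \<in> carrier R \<and> y \<otimes> y = cubic R (a \<oplus> b) (a \<otimes> b) x"
  by (auto simp: ec_points_def)

lemma cubic_factor: "x \<in> carrier R \<Longrightarrow> cubic R (a \<oplus> b) (a \<otimes> b) x = x \<otimes> (x \<oplus> a) \<otimes> (x \<oplus> b)"
  by (rule lift_eqI) (simp_all add: algebra_simps)

lemma root_cases:
  assumes "x \<in> carrier R"
  shows "x \<oplus> a = \<zero> \<Longrightarrow> \<ominus> a = x" "x \<oplus> b = \<zero> \<Longrightarrow> \<ominus> b = x"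
    "x \<oplus> a = \<zero> \<Longrightarrow> b \<ominus> a = x \<oplus> b" "x \<oplus> b = \<zero> \<Longrightarrow> a \<ominus> b = x \<oplus> a"
proof -
  show 1: "x \<oplus> a = \<zero> \<Longrightarrow> \<ominus> a = x" "x \<oplus> b = \<zero> \<Longrightarrow> \<ominus> b = x"
    using assms by (auto intro: minus_equality)
  show "x \<oplus> a = \<zero> \<Longrightarrow> b \<ominus> a = x \<oplus> b" "x \<oplus> b = \<zero> \<Longrightarrow> a \<ominus> b = x \<oplus> a"
    using 1 assms by (auto simp: a_minus_def a_comm)
qed

text \<open>The three factors multiply to y^2. At a root the vanishing factor is replaced by the
  product of the other two, so that the total is again a square.\<close>

lemma k_sum:
  assumes P: "Some (x, y) \<in> E"
  shows "k0 x + ka x + kb x = 0"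
proof -
  have c: "x \<in> carrier R" "y \<in> carrier R" and e: "y \<otimes> y = x \<otimes> (x \<oplus> a) \<otimes> (x \<oplus> b)"
    using P by (auto simp: mem_E cubic_factor)
  have *: "cl (u \<otimes> v) + cl u + cl v = 0" if "u \<in> carrier R" "v \<in> carrier R" "u \<noteq> \<zero>" "v \<noteq> \<zero>" for u v
    using cl_mult[OF that] cl_double[of "u \<otimes> v"] nz_mult that by (simp add: add.assoc)
  consider "x = \<zero>" | "x \<oplus> a = \<zero>" | "x \<oplus> b = \<zero>" | "x \<noteq> \<zero>" "x \<oplus> a \<noteq> \<zero>" "x \<oplus> b \<noteq> \<zero>" by blast
  then show ?thesis
  proof cases
    case 1
    then show ?thesis using *[of a b] ab_nz by (simp add: root_class_def)
  next
    case 2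
    note r = root_cases(1,3)[OF c(1) 2]
    have nz: "x \<noteq> \<zero>" "x \<oplus> b \<noteq> \<zero>" using ab_nz'(5,6) by (simp_all only: r) auto
    show ?thesis unfolding root_class_def r using *[of x "x \<oplus> b"] nz 2 c by (simp add: ac_simps)
  next
    case 3
    note r = root_cases(2,4)[OF c(1) 3]
    have nz: "x \<noteq> \<zero>" "x \<oplus> a \<noteq> \<zero>" using ab_nz'(4,7) by (simp_all only: r) auto
    show ?thesis unfolding root_class_def r using *[of x "x \<oplus> a"] nz 3 c by (simp add: ac_simps)
  next
    case 4
    have "cl (x \<otimes> (x \<oplus> a) \<otimes> (x \<oplus> b)) = 0"
      using cl_eq_0_iff[of "x \<otimes> (x \<oplus> a) \<otimes> (x \<oplus> b)"] e c 4 nz_mult by auto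
    then show ?thesis using 4 c nz_mult by (simp add: root_class_def cl_mult)
  qed
qed

lemma k_double:
  assumes "x \<in> carrier R" shows "k0 x + k0 x = 0" "ka x + ka x = 0"
  using assms ab_nz' unfolding root_class_def by (auto intro!: cl_double simp del: l_minus)

lemma kummer_double: "P \<in> E \<Longrightarrow> kummer P + kummer P = 0"
  by (cases P) (auto simp: kummer_def mem_E k_double zero_prod_def)

text \<open>At a root the derivative of the cubic is the product of the differences to the other two
  roots.\<close>

lemma nonsingular:
  assumes "x \<in> carrier R" "cubic R (a \<oplus> b) (a \<otimes> b) x = \<zero>"
    and d: "3 * (lift R x * lift R x) + 2 * (lift R (a \<oplus> b) * lift R x) + lift R (a \<otimes> b) = 0"
  shows False
proof -
  have "x \<otimes> (x \<oplus> a) \<otimes> (x \<oplus> b) = \<zero>" using assms cubic_factor by simp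
  then have "x = \<zero> \<or> x \<oplus> a = \<zero> \<or> x \<oplus> b = \<zero>"
    using assms(1) nz_mult[of "x \<otimes> (x \<oplus> a)" "x \<oplus> b"] nz_mult[of x "x \<oplus> a"] by auto
  moreover have "x \<noteq> \<zero>"
  proof
    assume "x = \<zero>"
    then have "a \<otimes> b = \<zero>" by (intro lift_eqI) (use d in simp_all)
    then show False by simp
  qed
  moreover have "x \<oplus> a \<noteq> \<zero>"
  proof
    assume "x \<oplus> a = \<zero>"
    then have x: "x = \<ominus> a" using root_cases assms by blast
    have "\<ominus> a \<otimes> (b \<ominus> a) = \<zero>"
      by (rule lift_eqI) (use d in \<open>simp_all add: x algebra_simps\<close>)
    then show False using ab_nz' by blast
  qed
  moreover have "x \<oplus> b \<noteq> \<zero>"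
  proof
    assume "x \<oplus> b = \<zero>"
    then have x: "x = \<ominus> b" using root_cases assms by blast
    have "\<ominus> b \<otimes> (a \<ominus> b) = \<zero>"
      by (rule lift_eqI) (use d in \<open>simp_all add: x algebra_simps\<close>)
    then show False using ab_nz' by blast
  qed
  ultimately show False by blast
qed

lemma line_cubic_shift_points:
  assumes c: "l \<in> carrier R" "n \<in> carrier R" "x1 \<in> carrier R" "x2 \<in> carrier R" "x3 \<in> carrier R"
    and lc: "line_cubic R (a \<oplus> b) (a \<otimes> b) l n (x1 \<oplus> x2) (x1 \<otimes> x2) x3"
  shows "line_cubic R (\<ominus> a \<oplus> (b \<ominus> a)) (\<ominus> a \<otimes> (b \<ominus> a)) l (n \<ominus> l \<otimes> a) ((x1 \<oplus> a) \<oplus> (x2 \<oplus> a)) ((x1 \<oplus> a) \<otimes> (x2 \<oplus> a)) (x3 \<oplus> a)"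
proof -
  have "(x1 \<oplus> a) \<oplus> (x2 \<oplus> a) = (x1 \<oplus> x2) \<oplus> a \<oplus> a"
    "(x1 \<oplus> a) \<otimes> (x2 \<oplus> a) = x1 \<otimes> x2 \<oplus> a \<otimes> (x1 \<oplus> x2) \<oplus> a \<otimes> a"
    using c by (auto intro!: lift_eqI simp: algebra_simps)
  then show ?thesis using line_cubic_shift[OF _ _ _ _ _ _ _ lc] c by simp
qed

lemma kummer_add:
  assumes P: "P \<in> E" and Q: "Q \<in> E"
  shows "pls P Q \<in> E" "kummer (pls P Q) = kummer P + kummer Q"
proof -
  have "pls P Q \<in> E \<and> kummer (pls P Q) = kummer P + kummer Q"
  proof (cases "P = None \<or> Q = None")
    case True
    then show ?thesis using P Q by (auto simp: ec_add_def kummer_def zero_prod_def split: option.splits)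
  next
    case False
    then obtain x1 y1 x2 y2 where eq: "P = Some (x1, y1)" "Q = Some (x2, y2)" by auto
    have c: "x1 \<in> carrier R" "y1 \<in> carrier R" "x2 \<in> carrier R" "y2 \<in> carrier R"
      and on: "y1 \<otimes> y1 = cubic R (a \<oplus> b) (a \<otimes> b) x1" "y2 \<otimes> y2 = cubic R (a \<oplus> b) (a \<otimes> b) x2"
      using P Q eq by (auto simp: mem_E)
    show ?thesis
    proof (cases "x1 = x2 \<and> y1 = \<ominus> y2")
      case True
      then have "pls P Q = None" by (simp add: eq ec_add_def)
      then show ?thesis using True c by (simp add: eq kummer_def k_double zero_prod_def ec_points_def)
    next
      case False
      obtain l n x3 where o: "l \<in> carrier R" "n \<in> carrier R" "x3 \<in> carrier R"
        and lc: "line_cubic R (a \<oplus> b) (a \<otimes> b) l n (x1 \<oplus> x2) (x1 \<otimes> x2) x3"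
        and s: "pls (Some (x1, y1)) (Some (x2, y2)) = Some (x3, \<ominus> (l \<otimes> x3 \<oplus> n))"
        by (rule ec_add_line[OF _ _ c on False]) auto
      have "(l \<otimes> x3 \<oplus> n) \<otimes> (l \<otimes> x3 \<oplus> n) = cubic R (a \<oplus> b) (a \<otimes> b) x3"
        by (rule line_cubic_on_curve[OF _ _ o(1,2) _ _ o(3) lc]) (use c in simp_all)
      moreover have "\<ominus> (l \<otimes> x3 \<oplus> n) \<otimes> \<ominus> (l \<otimes> x3 \<oplus> n) = (l \<otimes> x3 \<oplus> n) \<otimes> (l \<otimes> x3 \<oplus> n)"
        by (rule lift_eqI) (use o in \<open>simp_all add: algebra_simps\<close>)
      ultimately have "pls P Q \<in> E" using o by (simp add: eq s mem_E)
      moreover have "k0 x3 = k0 x1 + k0 x2"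
        by (rule root_class_three_points[OF _ _ o(1,2) c(1,3) o(3) lc]) simp_all
      moreover have "ka x3 = ka x1 + ka x2"
        by (rule root_class_three_points[OF _ _ _ _ _ _ _ line_cubic_shift_points[OF o(1,2) c(1,3) o(3) lc]]) (use c o in \<open>simp_all del: l_minus\<close>)
      ultimately show ?thesis by (simp add: eq s kummer_def)
    qed
  qed
  then show "pls P Q \<in> E" "kummer (pls P Q) = kummer P + kummer Q" by auto
qed

lemma neg_E: "P \<in> E \<Longrightarrow> ec_neg R P \<in> E"
  by (cases P) (auto simp: ec_neg_def mem_E l_minus r_minus ec_points_def)

lemma kummer_neg: "P \<in> E \<Longrightarrow> kummer (ec_neg R P) = kummer P"
  by (cases P) (auto simp: ec_neg_def kummer_def)

text \<open>The only instance of associativity that is needed.\<close>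
lemma add_neg_cancel:
  assumes P: "P \<in> E" and Q: "Q \<in> E"
  shows "pls P (pls (ec_neg R P) Q) = Q"
proof (cases P)
  case None
  then show ?thesis by (simp add: ec_neg_def ec_add_def)
next
  case (Some p)
  then obtain x1 y1 where eP: "P = Some (x1, y1)" by (cases p) auto
  have c1: "x1 \<in> carrier R" "y1 \<in> carrier R" and on1: "y1 \<otimes> y1 = cubic R (a \<oplus> b) (a \<otimes> b) x1"
    using P eP by (auto simp: mem_E)
  have nP: "ec_neg R P = Some (x1, \<ominus> y1)" by (simp add: eP ec_neg_def)
  show ?thesis
  proof (cases Q)
    case None
    then show ?thesis using c1 by (simp add: eP ec_add_def ec_neg_def)
  next
    case (Some q)
    then obtain x2 y2 where eQ: "Q = Some (x2, y2)" by (cases q) auto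
    have c2: "x2 \<in> carrier R" "y2 \<in> carrier R" and on2: "y2 \<otimes> y2 = cubic R (a \<oplus> b) (a \<otimes> b) x2"
      using Q eQ by (auto simp: mem_E)
    show ?thesis
    proof (cases "x1 = x2 \<and> \<ominus> y1 = \<ominus> y2")
      case True
      then have "y1 = y2" using c1 c2 by (metis minus_minus)
      then show ?thesis using True by (simp add: eP eQ ec_neg_def ec_add_def)
    next
      case False
      have on1': "\<ominus> y1 \<otimes> \<ominus> y1 = cubic R (a \<oplus> b) (a \<otimes> b) x1" using on1 c1 by (simp add: l_minus r_minus)
      obtain l n x3 where o: "l \<in> carrier R" "n \<in> carrier R" "x3 \<in> carrier R"
        and y: "\<ominus> y1 = l \<otimes> x1 \<oplus> n" "y2 = l \<otimes> x2 \<oplus> n"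
        and lc: "line_cubic R (a \<oplus> b) (a \<otimes> b) l n (x1 \<oplus> x2) (x1 \<otimes> x2) x3"
        and s: "pls (Some (x1, \<ominus> y1)) (Some (x2, y2)) = Some (x3, \<ominus> (l \<otimes> x3 \<oplus> n))"
        by (rule ec_add_line[OF _ _ c1(1) _ c2 on1' on2 False]) (use c1 in auto)
      \<comment> \<open>The reflected line y = - l x - n passes through P and -P + Q, and its third
        point is -Q.\<close>
      have lc': "line_cubic R (a \<oplus> b) (a \<otimes> b) (\<ominus> l) (\<ominus> n) (x1 \<oplus> x3) (x1 \<otimes> x3) x2"
      proof -
        have "lift R x1 + lift R x2 + lift R x3 = lift R l * lift R l - (lift R a + lift R b)"
          "lift R x1 * lift R x2 + (lift R x1 + lift R x2) * lift R x3 = lift R a * lift R b - 2 * (lift R l * lift R n)"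
          "lift R x1 * lift R x2 * lift R x3 = lift R n * lift R n"
          using lc o c1 c2 by (simp_all add: line_cubic_lift)
        then show ?thesis using o c1 c2 by (simp add: line_cubic_lift algebra_simps)
      qed
      \<comment> \<open>If P and -P + Q were opposite, then y1 = 0 and the line would touch the
        curve at a point of order two, where the tangent is vertical.\<close>
      have ne: "\<not> (x1 = x3 \<and> y1 = \<ominus> (\<ominus> (l \<otimes> x3 \<oplus> n)))"
      proof
        assume h: "x1 = x3 \<and> y1 = \<ominus> (\<ominus> (l \<otimes> x3 \<oplus> n))"
        then have "y1 = \<ominus> y1" using y o c1 by simp
        then have y0: "y1 = \<zero>" using eq_uminus_self c1 by blast
        have L: "lift R x1 * lift R x1 + (lift R x1 + lift R x1) * lift R x2 = lift R (a \<otimes> b) - 2 * (lift R (\<ominus> l) * lift R (\<ominus> n))"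
          "lift R x1 + lift R x1 + lift R x2 = lift R (\<ominus> l) * lift R (\<ominus> l) - lift R (a \<oplus> b)"
          using lc' h o c1 c2 by (simp_all add: line_cubic_lift)
        have "lift R (\<ominus> l) * lift R x1 + lift R (\<ominus> n) = - lift R (\<ominus> y1)" unfolding y(1) using o c1 by simp
        also have "\<dots> = 0" using y0 by simp
        finally have "3 * (lift R x1 * lift R x1) + 2 * (lift R (a \<oplus> b) * lift R x1) + lift R (a \<otimes> b) = 0"
          using ring_tangent_rev[OF L] by simp
        moreover have "cubic R (a \<oplus> b) (a \<otimes> b) x1 = \<zero>" using on1 y0 by simp
        ultimately show False using nonsingular c1 by blast
      qed
      have "pls (Some (x1, y1)) (Some (x3, \<ominus> (l \<otimes> x3 \<oplus> n))) = Some (x2, \<ominus> (\<ominus> l \<otimes> x2 \<oplus> \<ominus> n))"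
      proof (rule ec_add_eqI[OF _ _ c1(1) o(3) c2(1) _ _ _ _ lc' ne])
        have "y1 = \<ominus> (\<ominus> y1)" using c1 by simp
        also have "\<dots> = \<ominus> l \<otimes> x1 \<oplus> \<ominus> n" unfolding y(1) by (rule lift_eqI) (use o c1 in simp_all)
        finally show "y1 = \<ominus> l \<otimes> x1 \<oplus> \<ominus> n" .
        show "\<ominus> (l \<otimes> x3 \<oplus> n) = \<ominus> l \<otimes> x3 \<oplus> \<ominus> n" by (rule lift_eqI) (use o in simp_all)
      qed (use o in auto)
      moreover have "\<ominus> (\<ominus> l \<otimes> x2 \<oplus> \<ominus> n) = y2" unfolding y(2) by (rule lift_eqI) (use o c2 in simp_all)
      ultimately show ?thesis unfolding nP eQ s by (simp add: eP)
    qed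
  qed
qed

end

text \<open>c and c + a s + a^2 are the products of the factors x and x + a over the other two
  intersections, which need not be rational. For a conjugate pair they are norms from K.\<close>

lemma (in elliptic_curve) kummer_line_cubic:
  assumes c: "l \<in> carrier R" "n \<in> carrier R" "s \<in> carrier R" "c \<in> carrier R" "x \<in> carrier R"
    and lc: "line_cubic R (a \<oplus> b) (a \<otimes> b) l n s c x"
    and nz: "c \<noteq> \<zero>" "c \<oplus> a \<otimes> s \<oplus> a \<otimes> a \<noteq> \<zero>"
  shows "Some (x, \<ominus> (l \<otimes> x \<oplus> n)) \<in> E"
    and "kummer (Some (x, \<ominus> (l \<otimes> x \<oplus> n))) = (cl c, cl (c \<oplus> a \<otimes> s \<oplus> a \<otimes> a))"
proof -
  have "(l \<otimes> x \<oplus> n) \<otimes> (l \<otimes> x \<oplus> n) = cubic R (a \<oplus> b) (a \<otimes> b) x"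
    by (rule line_cubic_on_curve[OF _ _ c lc]) simp_all
  moreover have "\<ominus> (l \<otimes> x \<oplus> n) \<otimes> \<ominus> (l \<otimes> x \<oplus> n) = (l \<otimes> x \<oplus> n) \<otimes> (l \<otimes> x \<oplus> n)"
    by (rule lift_eqI) (use c in \<open>simp_all add: algebra_simps\<close>)
  ultimately show "Some (x, \<ominus> (l \<otimes> x \<oplus> n)) \<in> E" using c by (simp add: mem_E)
  have "k0 x = cl c" by (rule root_class_line_cubic[OF _ _ c lc nz(1)]) simp_all
  moreover have "ka x = cl (c \<oplus> a \<otimes> s \<oplus> a \<otimes> a)"
    by (rule root_class_line_cubic[OF _ _ _ _ _ _ _ line_cubic_shift[OF _ _ c lc] nz(2)]) (use c in \<open>simp_all del: l_minus\<close>)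
  ultimately show "kummer (Some (x, \<ominus> (l \<otimes> x \<oplus> n))) = (cl c, cl (c \<oplus> a \<otimes> s \<oplus> a \<otimes> a))"
    by (simp add: kummer_def)
qed

text \<open>An abscissa counted twice makes the line a tangent. The ordinate is nonzero there, for
  otherwise the derivative of the cubic would vanish at a root.\<close>

lemma (in elliptic_curve) line_cubic_double:
  assumes c: "l \<in> carrier R" "n \<in> carrier R" "u \<in> carrier R" "x \<in> carrier R"
    and lc': "line_cubic R (a \<oplus> b) (a \<otimes> b) l n (u \<oplus> u) (u \<otimes> u) x"
  shows "Some (u, l \<otimes> u \<oplus> n) \<in> E"
    and "pls (Some (u, l \<otimes> u \<oplus> n)) (Some (u, l \<otimes> u \<oplus> n)) = Some (x, \<ominus> (l \<otimes> x \<oplus> n))"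
    and "l \<otimes> u \<oplus> n \<noteq> \<zero>"
    and "2 * (lift R l * (lift R l * lift R u + lift R n)) = 3 * (lift R u * lift R u) + 2 * (lift R (a \<oplus> b) * lift R u) + lift R (a \<otimes> b)"
proof -
  have L: "lift R u + lift R u + lift R x = lift R l * lift R l - lift R (a \<oplus> b)"
    "lift R u * lift R u + (lift R u + lift R u) * lift R x = lift R (a \<otimes> b) - 2 * (lift R l * lift R n)"
    "lift R u * lift R u * lift R x = lift R n * lift R n"
    using lc' c by (simp_all add: line_cubic_lift)
  have on: "(l \<otimes> u \<oplus> n) \<otimes> (l \<otimes> u \<oplus> n) = cubic R (a \<oplus> b) (a \<otimes> b) u"
  proof (subst curve_lift)
    show "lift R (l \<otimes> u \<oplus> n) * lift R (l \<otimes> u \<oplus> n) =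
      lift R u * (lift R u * lift R u) + lift R (a \<oplus> b) * (lift R u * lift R u) + lift R (a \<otimes> b) * lift R u"
      using ring_line_cubic[OF L, of "lift R u"] c by (simp add: algebra_simps)
  qed (use c in simp_all)
  have ynz: "\<not> (u = u \<and> l \<otimes> u \<oplus> n = \<ominus> (l \<otimes> u \<oplus> n))"
  proof
    assume "u = u \<and> l \<otimes> u \<oplus> n = \<ominus> (l \<otimes> u \<oplus> n)"
    then have y0: "l \<otimes> u \<oplus> n = \<zero>" using eq_uminus_self[of "l \<otimes> u \<oplus> n"] c by simp
    have "lift R (l \<otimes> u \<oplus> n) = lift R l * lift R u + lift R n" using c by simp
    then have "lift R l * lift R u + lift R n = 0" by (simp add: y0)
    then have "3 * (lift R u * lift R u) + 2 * (lift R (a \<oplus> b) * lift R u) + lift R (a \<otimes> b) = 0"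
      using ring_tangent_rev[OF L(2,1)] by simp
    moreover have "cubic R (a \<oplus> b) (a \<otimes> b) u = \<zero>" using on y0 by simp
    ultimately show False using nonsingular c by blast
  qed
  show "pls (Some (u, l \<otimes> u \<oplus> n)) (Some (u, l \<otimes> u \<oplus> n)) = Some (x, \<ominus> (l \<otimes> x \<oplus> n))"
    by (rule ec_add_eqI[OF _ _ c(3) c(3) c(4) c(1,2) refl refl lc' ynz]) simp_all
  show "Some (u, l \<otimes> u \<oplus> n) \<in> E" using on c by (simp add: mem_E)
  show "l \<otimes> u \<oplus> n \<noteq> \<zero>" using ynz by auto
  show "2 * (lift R l * (lift R l * lift R u + lift R n)) = 3 * (lift R u * lift R u) + 2 * (lift R (a \<oplus> b) * lift R u) + lift R (a \<otimes> b)"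
    by (rule ring_tangent_rev[OF L(2,1)])
qed

text \<open>The other two abscissas are x + h plus or minus a square root of w, which need not exist
  in R. The assumptions are the first two Vieta relations in coordinates centred at x, and the third
  follows from (x, y) being on the curve. Norms use w = d v^2 and halves use w = 0.\<close>

lemma (in elliptic_curve) line_cubicI:
  assumes P: "Some (x, y) \<in> E"
    and c: "l \<in> carrier R" "h \<in> carrier R" "w \<in> carrier R"
    and 1: "lift R l * lift R l = 3 * lift R x + (lift R a + lift R b) + 2 * lift R h"
    and 2: "lift R h * lift R h - lift R w
      = 3 * (lift R x * lift R x) + 2 * (lift R a + lift R b) * lift R x + lift R a * lift R b + 2 * (lift R l * lift R y)"
  defines "n \<equiv> \<ominus> y \<ominus> l \<otimes> x" and "u \<equiv> x \<oplus> h"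
  shows "line_cubic R (a \<oplus> b) (a \<otimes> b) l n (u \<oplus> u) (u \<otimes> u \<ominus> w) x" "\<ominus> (l \<otimes> x \<oplus> n) = y"
proof -
  have xy: "x \<in> carrier R" "y \<in> carrier R" and on: "y \<otimes> y = cubic R (a \<oplus> b) (a \<otimes> b) x"
    using P by (auto simp: mem_E)
  have on': "lift R y * lift R y = lift R x * (lift R x * lift R x) + (lift R a + lift R b) * (lift R x * lift R x) + lift R a * lift R b * lift R x"
    using on xy by (subst (asm) curve_lift) simp_all
  have nu: "n \<in> carrier R" "u \<in> carrier R" unfolding n_def u_def using c xy by auto
  show "line_cubic R (a \<oplus> b) (a \<otimes> b) l n (u \<oplus> u) (u \<otimes> u \<ominus> w) x"
  proof (subst line_cubic_lift)
    define X Y L H W A B where d: "X = lift R x" "Y = lift R y" "L = lift R l" "H = lift R h" "W = lift R w"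
      "A = lift R a" "B = lift R b"
    have LL: "L * L = 3 * X + (A + B) + 2 * H" using 1 by (simp add: d)
    have HH: "H * H - W = 3 * (X * X) + 2 * (A + B) * X + A * B + 2 * (L * Y)" using 2 by (simp add: d)
    have YY: "Y * Y = X * (X * X) + (A + B) * (X * X) + A * B * X" using on' by (simp add: d)
    have U: "(X + H) * (X + H) - W = X * X + 2 * (X * H) + (3 * (X * X) + 2 * (A + B) * X + A * B + 2 * (L * Y))"
      unfolding HH[symmetric] by (simp add: algebra_simps)
    have 1: "(X + H) + (X + H) + X = L * L - (A + B)" unfolding LL by (simp add: algebra_simps)
    have "A * B - 2 * (L * (- Y - L * X)) = A * B + 2 * (L * Y) + 2 * (L * L) * X" by (simp add: algebra_simps)
    also have "\<dots> = (X + H) * (X + H) - W + (X + H + (X + H)) * X"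
      unfolding U LL by (simp add: algebra_simps)
    finally have 2: "(X + H) * (X + H) - W + (X + H + (X + H)) * X = A * B - 2 * (L * (- Y - L * X))" by simp
    have "(- Y - L * X) * (- Y - L * X) = Y * Y + 2 * (L * Y) * X + (L * L) * X * X" by (simp add: algebra_simps)
    also have "\<dots> = ((X + H) * (X + H) - W) * X"
      unfolding U LL YY by (simp add: algebra_simps)
    finally have 3: "((X + H) * (X + H) - W) * X = (- Y - L * X) * (- Y - L * X)" by simp
    show "lift R (u \<oplus> u) + lift R x = lift R l * lift R l - lift R (a \<oplus> b) \<and>
      lift R (u \<otimes> u \<ominus> w) + lift R (u \<oplus> u) * lift R x = lift R (a \<otimes> b) - 2 * (lift R l * lift R n) \<and>
      lift R (u \<otimes> u \<ominus> w) * lift R x = lift R n * lift R n"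
      using 1 2 3 c xy unfolding u_def n_def by (simp add: d)
  qed (use c xy nu in simp_all)
  show "\<ominus> (l \<otimes> x \<oplus> n) = y" by (rule lift_eqI) (use c xy in \<open>simp_all add: n_def\<close>)
qed

text \<open>All three factors are squares, so y is the product of the roots up to a sign, which is
  absorbed into \<alpha>.\<close>

lemma (in elliptic_curve) sqrt_coords:
  assumes P: "Some (x, y) \<in> E" "kummer (Some (x, y)) = 0"
  obtains \<alpha> \<beta> \<gamma> where "\<alpha> \<in> carrier R" "\<beta> \<in> carrier R" "\<gamma> \<in> carrier R"
    "\<alpha> \<otimes> \<alpha> = x" "\<beta> \<otimes> \<beta> = x \<oplus> a" "\<gamma> \<otimes> \<gamma> = x \<oplus> b" "y = \<alpha> \<otimes> \<beta> \<otimes> \<gamma>"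
proof -
  have xy: "x \<in> carrier R" "y \<in> carrier R" and on: "y \<otimes> y = x \<otimes> (x \<oplus> a) \<otimes> (x \<oplus> b)"
    using P by (auto simp: mem_E cubic_factor)
  have ks: "k0 x = 0" "ka x = 0" using P by (auto simp: kummer_def zero_prod_def)
  then have kb: "kb x = 0" using k_sum[of x y] P by simp
  have sq: "\<exists>s\<in>carrier R. s \<otimes> s = X" if "X \<in> carrier R" "root_class w X = 0" for w X
  proof (cases "X = \<zero>")
    case True
    then show ?thesis by (auto intro: bexI[of _ \<zero>])
  next
    case False
    then show ?thesis using cl_eq_0_iff that by (simp add: root_class_def)
  qed
  obtain \<alpha> where al: "\<alpha> \<in> carrier R" "\<alpha> \<otimes> \<alpha> = x" using sq ks(1) xy by blast
  obtain \<beta> where be: "\<beta> \<in> carrier R" "\<beta> \<otimes> \<beta> = x \<oplus> a" using sq[OF _ ks(2)] xy by auto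
  obtain \<gamma> where ga: "\<gamma> \<in> carrier R" "\<gamma> \<otimes> \<gamma> = x \<oplus> b" using sq[OF _ kb] xy by auto
  have "y \<otimes> y = (\<alpha> \<otimes> \<beta> \<otimes> \<gamma>) \<otimes> (\<alpha> \<otimes> \<beta> \<otimes> \<gamma>)"
  proof -
    have "y \<otimes> y = (\<alpha> \<otimes> \<alpha>) \<otimes> (\<beta> \<otimes> \<beta>) \<otimes> (\<gamma> \<otimes> \<gamma>)"
      unfolding on al(2) be(2) ga(2) ..
    then show ?thesis using al(1) be(1) ga(1) by (simp add: m_ac)
  qed
  then have "y = \<alpha> \<otimes> \<beta> \<otimes> \<gamma> \<or> y = \<ominus> (\<alpha> \<otimes> \<beta> \<otimes> \<gamma>)"
    using square_eq_square[of y "\<alpha> \<otimes> \<beta> \<otimes> \<gamma>"] al(1) be(1) ga(1) xy by simp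
  then show ?thesis
  proof
    assume "y = \<alpha> \<otimes> \<beta> \<otimes> \<gamma>"
    then show ?thesis using that al be ga by blast
  next
    assume "y = \<ominus> (\<alpha> \<otimes> \<beta> \<otimes> \<gamma>)"
    then show ?thesis using that[of "\<ominus> \<alpha>"] al be ga xy(1) by (simp add: l_minus r_minus)
  qed
qed

section \<open>Norms and the quadratic twist\<close>

locale quadratic_twist_curve = elliptic_curve + square_class_nonsquare
begin

lemma d_nz: "d \<noteq> \<zero>"
  using d_nonsquare[of \<zero>] by auto

sublocale tw: elliptic_curve R cl "d \<otimes> a" "d \<otimes> b"
proof unfold_locales
  show "d \<otimes> a \<noteq> \<zero>" "d \<otimes> b \<noteq> \<zero>" using nz_mult d_nz ab_nz by auto
  show "d \<otimes> a \<noteq> d \<otimes> b" using m_lcancel[OF d_nz] ab_nz by auto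
qed simp_all

abbreviation norms where
  "norms \<equiv> ec_norm R d (a \<oplus> b) (a \<otimes> b) ` ec_points K (a \<oplus> b, \<zero>) (a \<otimes> b, \<zero>)"

text \<open>For v = 0 the two intersections coincide in a rational point, whose norm is its double;
  otherwise they are conjugate over K.\<close>

lemma line_cubic_norm:
  assumes c: "l \<in> carrier R" "n \<in> carrier R" "u \<in> carrier R" "v \<in> carrier R" "x \<in> carrier R"
    and lc: "line_cubic R (a \<oplus> b) (a \<otimes> b) l n (u \<oplus> u) (u \<otimes> u \<ominus> d \<otimes> (v \<otimes> v)) x"
  shows "Some (x, \<ominus> (l \<otimes> x \<oplus> n)) \<in> norms"
proof (cases "v = \<zero>")
  case False
  show ?thesis
    using quad_point[OF _ _ c lc] ec_norm_affine[OF _ _ c False lc]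
    by (metis (no_types, lifting) ab_carrier a_closed m_closed imageI)
next
  case True
  have lc': "line_cubic R (a \<oplus> b) (a \<otimes> b) l n (u \<oplus> u) (u \<otimes> u) x"
    using lc True c by (simp add: a_minus_def)
  have pt: "Some ((u, \<zero>), (l \<otimes> u \<oplus> n, \<zero>)) \<in> ec_points K (a \<oplus> b, \<zero>) (a \<otimes> b, \<zero>)"
    using quad_point[OF _ _ c lc] True c by simp
  note D = line_cubic_double[OF c(1-3,5) lc']
  have "(l \<otimes> u \<oplus> n) \<otimes> (l \<otimes> u \<oplus> n) = cubic R (a \<oplus> b) (a \<otimes> b) u" using D(1) by (simp add: mem_E)
  note on = this
  have "pls (Some (u, l \<otimes> u \<oplus> n)) (Some (u, l \<otimes> u \<oplus> n)) = Some (x, \<ominus> (l \<otimes> x \<oplus> n))" by (rule D(2))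
  then have "ec_norm R d (a \<oplus> b) (a \<otimes> b) (Some ((u, \<zero>), (l \<otimes> u \<oplus> n, \<zero>))) = Some (x, \<ominus> (l \<otimes> x \<oplus> n))"
    using ec_norm_base[OF _ _ c(3) _ on] c by simp
  then show ?thesis using pt by (metis imageI)
qed

lemma mem_normsI:
  assumes P: "Some (x, y) \<in> E"
    and c: "l \<in> carrier R" "h \<in> carrier R" "v \<in> carrier R"
    and 1: "lift R l * lift R l = 3 * lift R x + (lift R a + lift R b) + 2 * lift R h"
    and 2: "lift R h * lift R h - lift R d * (lift R v * lift R v)
      = 3 * (lift R x * lift R x) + 2 * (lift R a + lift R b) * lift R x + lift R a * lift R b + 2 * (lift R l * lift R y)"
  shows "Some (x, y) \<in> norms"
proof -
  have xy: "x \<in> carrier R" "y \<in> carrier R" using P by (auto simp: mem_E)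
  have w: "d \<otimes> (v \<otimes> v) \<in> carrier R" using c by simp
  have e2: "lift R h * lift R h - lift R (d \<otimes> (v \<otimes> v))
      = 3 * (lift R x * lift R x) + 2 * (lift R a + lift R b) * lift R x + lift R a * lift R b + 2 * (lift R l * lift R y)"
    using 2 c by simp
  note L = line_cubicI[OF P c(1,2) w 1 e2]
  have "Some (x, \<ominus> (l \<otimes> x \<oplus> (\<ominus> y \<ominus> l \<otimes> x))) \<in> norms"
    by (rule line_cubic_norm[OF c(1) _ _ c(3) xy(1) L(1)]) (use c xy in simp_all)
  then show ?thesis using L(2) by simp
qed

text \<open>Such a point has a rational half, and doubling is the norm on rational points: the line
  through -P with slope \<alpha> + \<beta> + \<gamma> is a tangent, so that v = 0.\<close>

lemma kramer_trivial_class: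
  assumes P: "P \<in> E" and k: "kummer P = 0"
  shows "P \<in> norms"
proof (cases P)
  case None
  have "ec_norm R d (a \<oplus> b) (a \<otimes> b) None = None" by (simp add: ec_norm_def ec_add_def)
  moreover have "None \<in> ec_points K (a \<oplus> b, \<zero>) (a \<otimes> b, \<zero>)" by (simp add: ec_points_def)
  ultimately show ?thesis unfolding None by (metis imageI)
next
  case (Some p)
  then obtain x y where eP: "P = Some (x, y)" by (cases p) auto
  have xy: "x \<in> carrier R" "y \<in> carrier R" using P eP by (auto simp: mem_E)
  obtain \<alpha>' \<beta> \<gamma> where al': "\<alpha>' \<in> carrier R" "\<alpha>' \<otimes> \<alpha>' = x" "y = \<alpha>' \<otimes> \<beta> \<otimes> \<gamma>"
    and be: "\<beta> \<in> carrier R" "\<beta> \<otimes> \<beta> = x \<oplus> a" and ga: "\<gamma> \<in> carrier R" "\<gamma> \<otimes> \<gamma> = x \<oplus> b"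
    using sqrt_coords[of x y] P k eP by metis
  have x: "lift R x = lift R \<alpha>' * lift R \<alpha>'" using arg_cong[OF al'(2), of "lift R"] al'(1) by simp
  have a: "lift R a = lift R \<beta> * lift R \<beta> - lift R x" using arg_cong[OF be(2), of "lift R"] be(1) xy by simp
  have b: "lift R b = lift R \<gamma> * lift R \<gamma> - lift R x" using arg_cong[OF ga(2), of "lift R"] ga(1) xy by simp
  have y: "lift R y = lift R \<alpha>' * lift R \<beta> * lift R \<gamma>" using arg_cong[OF al'(3), of "lift R"] al'(1) be(1) ga(1) by simp
  have "Some (x, y) \<in> norms"
  proof (rule mem_normsI)
    show "Some (x, y) \<in> E" using P eP by simp
    show "lift R (\<alpha>' \<oplus> \<beta> \<oplus> \<gamma>) * lift R (\<alpha>' \<oplus> \<beta> \<oplus> \<gamma>) =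
      3 * lift R x + (lift R a + lift R b) + 2 * lift R (\<alpha>' \<otimes> \<beta> \<oplus> \<alpha>' \<otimes> \<gamma> \<oplus> \<beta> \<otimes> \<gamma>)"
      unfolding a b x using al'(1) be(1) ga(1) by (simp add: algebra_simps)
    show "lift R (\<alpha>' \<otimes> \<beta> \<oplus> \<alpha>' \<otimes> \<gamma> \<oplus> \<beta> \<otimes> \<gamma>) * lift R (\<alpha>' \<otimes> \<beta> \<oplus> \<alpha>' \<otimes> \<gamma> \<oplus> \<beta> \<otimes> \<gamma>) -
      lift R d * (lift R \<zero> * lift R \<zero>) =
      3 * (lift R x * lift R x) + 2 * (lift R a + lift R b) * lift R x + lift R a * lift R b +
      2 * (lift R (\<alpha>' \<oplus> \<beta> \<oplus> \<gamma>) * lift R y)"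
      unfolding a b x y using al'(1) be(1) ga(1) by (simp add: algebra_simps)
  qed (use al'(1) be(1) ga(1) in simp_all)
  then show ?thesis using eP by simp
qed

lemma kramer_backward:
  assumes P: "P \<in> E" and T: "T \<in> tw.E" and k: "kummer P = tw.kummer T"
  shows "P \<in> norms"
proof (cases "P = None \<or> T = None")
  case True
  then have "kummer P = 0" using k by (auto simp: kummer_def tw.kummer_def zero_prod_def)
  then show ?thesis using kramer_trivial_class P by blast
next
  case False
  then obtain x y t s where eq: "P = Some (x, y)" "T = Some (t, s)" by auto
  have xy: "x \<in> carrier R" "y \<in> carrier R" and on: "y \<otimes> y = x \<otimes> (x \<oplus> a) \<otimes> (x \<oplus> b)"
    using P eq by (auto simp: mem_E cubic_factor)
  have ts: "t \<in> carrier R" using T eq by (auto simp: tw.mem_E)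
  have ks: "k0 x = tw.k0 t" "ka x = tw.ka t" using k eq by (auto simp: kummer_def tw.kummer_def)
  have kb: "kb x = tw.kb t"
    using k_sum[of x y] tw.k_sum[of t s] P T ks by (simp add: eq) (metis add_left_cancel)
  define k where "k = t \<ominus> d \<otimes> x"
  have kc: "k \<in> carrier R" using ts xy by (simp add: k_def)
  have te: "t = k \<oplus> d \<otimes> x" "t \<oplus> d \<otimes> a = k \<oplus> d \<otimes> (x \<oplus> a)" "t \<oplus> d \<otimes> b = k \<oplus> d \<otimes> (x \<oplus> b)"
    by (rule lift_eqI; use ts xy in \<open>simp add: k_def algebra_simps\<close>)+
  have cls: "x \<noteq> \<zero> \<Longrightarrow> t \<noteq> \<zero> \<Longrightarrow> cl x = cl t"
    "x \<oplus> a \<noteq> \<zero> \<Longrightarrow> t \<oplus> d \<otimes> a \<noteq> \<zero> \<Longrightarrow> cl (x \<oplus> a) = cl (t \<oplus> d \<otimes> a)"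
    "x \<oplus> b \<noteq> \<zero> \<Longrightarrow> t \<oplus> d \<otimes> b \<noteq> \<zero> \<Longrightarrow> cl (x \<oplus> b) = cl (t \<oplus> d \<otimes> b)"
    using ks kb by (simp_all add: root_class_def)
  have fin: "Some (x, y) \<in> norms"
    if "l \<in> carrier R" "h \<in> carrier R" "v \<in> carrier R"
    "lift R l * lift R l = lift R x + lift R (x \<oplus> a) + lift R (x \<oplus> b) + 2 * lift R h"
    "lift R h * lift R h - lift R d * (lift R v * lift R v)
      = lift R x * lift R (x \<oplus> a) + lift R x * lift R (x \<oplus> b) + lift R (x \<oplus> a) * lift R (x \<oplus> b) + 2 * (lift R l * lift R y)"
    for l h v
    by (rule mem_normsI[OF _ that(1-3)]) (use P eq xy that(4,5) in \<open>simp_all add: algebra_simps\<close>)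
  \<comment> \<open>A factor that vanishes has to take the place of X1 in
    \<open>kramer_core\<close>; in the third case this place is kept by x, zero or not.\<close>
  consider "x \<oplus> a = \<zero>" | "x \<oplus> b = \<zero>" | "x \<oplus> a \<noteq> \<zero>" "x \<oplus> b \<noteq> \<zero>" by blast
  then have "Some (x, y) \<in> norms"
  proof cases
    case 1
    note r = root_cases(1,3)[OF xy(1) 1]
    have nz: "x \<noteq> \<zero>" "x \<oplus> b \<noteq> \<zero>" using ab_nz'(5,6) by (simp_all only: r) auto
    have y: "y \<otimes> y = (x \<oplus> a) \<otimes> x \<otimes> (x \<oplus> b)" using on xy by (simp add: m_ac)
    have c0: "t \<oplus> d \<otimes> a \<noteq> \<zero> \<Longrightarrow> cl (x \<otimes> (x \<oplus> b)) = cl (t \<oplus> d \<otimes> a)"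
      using ks(2) 1 unfolding root_class_def r by simp
    show ?thesis
    proof (rule kramer_core[OF xy(2) _ xy(1) _ kc nz y te(2) te(1) te(3)])
      fix l h v
      assume h: "l \<in> carrier R" "h \<in> carrier R" "v \<in> carrier R"
        "lift R l * lift R l = lift R (x \<oplus> a) + lift R x + lift R (x \<oplus> b) + 2 * lift R h"
        "lift R h * lift R h - lift R d * (lift R v * lift R v) = lift R (x \<oplus> a) * lift R x + lift R (x \<oplus> a) * lift R (x \<oplus> b)
          + lift R x * lift R (x \<oplus> b) + 2 * (lift R l * lift R y)"
      show "Some (x, y) \<in> norms" by (rule fin[OF h(1-3)]) (use h(4,5) in \<open>simp_all add: ac_simps\<close>)
    qed (use xy cls c0 nz in simp_all)
  next
    case 2
    note r = root_cases(2,4)[OF xy(1) 2]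
    have nz: "x \<noteq> \<zero>" "x \<oplus> a \<noteq> \<zero>" using ab_nz'(4,7) by (simp_all only: r) auto
    have y: "y \<otimes> y = (x \<oplus> b) \<otimes> x \<otimes> (x \<oplus> a)" using on xy by (simp add: m_ac)
    have c0: "t \<oplus> d \<otimes> b \<noteq> \<zero> \<Longrightarrow> cl (x \<otimes> (x \<oplus> a)) = cl (t \<oplus> d \<otimes> b)"
      using kb 2 unfolding root_class_def r by simp
    show ?thesis
    proof (rule kramer_core[OF xy(2) _ xy(1) _ kc nz y te(3) te(1) te(2)])
      fix l h v
      assume h: "l \<in> carrier R" "h \<in> carrier R" "v \<in> carrier R"
        "lift R l * lift R l = lift R (x \<oplus> b) + lift R x + lift R (x \<oplus> a) + 2 * lift R h"
        "lift R h * lift R h - lift R d * (lift R v * lift R v) = lift R (x \<oplus> b) * lift R x + lift R (x \<oplus> b) * lift R (x \<oplus> a)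
          + lift R x * lift R (x \<oplus> a) + 2 * (lift R l * lift R y)"
      show "Some (x, y) \<in> norms" by (rule fin[OF h(1-3)]) (use h(4,5) in \<open>simp_all add: ac_simps\<close>)
    qed (use xy cls c0 nz in simp_all)
  next
    case 3
    have c0: "x = \<zero> \<Longrightarrow> t \<noteq> \<zero> \<Longrightarrow> cl ((x \<oplus> a) \<otimes> (x \<oplus> b)) = cl t"
      using ks(1) by (simp add: root_class_def)
    show ?thesis
      by (rule kramer_core[OF xy(2,1) _ _ kc 3 on te]) (use xy cls c0 3 fin in simp_all)
  qed
  then show ?thesis using eq by simp
qed

lemma cl_dd: "c \<in> carrier R \<Longrightarrow> c \<noteq> \<zero> \<Longrightarrow> cl (d \<otimes> d \<otimes> c) = cl c"
  using cl_double[OF d_carrier d_nz] nz_mult d_nz by (simp add: cl_mult)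

lemma kramer_forward:
  assumes P: "P \<in> norms"
  shows "P \<in> E" "kummer P \<in> tw.kummer ` tw.E"
proof -
  obtain Q where Q: "Q \<in> ec_points K (a \<oplus> b, \<zero>) (a \<otimes> b, \<zero>)" "P = ec_norm R d (a \<oplus> b) (a \<otimes> b) Q"
    using P by blast
  have O: "None \<in> E" "None \<in> tw.E" "kummer None = 0" "tw.kummer None = 0"
    by (auto simp: ec_points_def kummer_def tw.kummer_def zero_prod_def)
  have "P \<in> E \<and> kummer P \<in> tw.kummer ` tw.E"
  proof (cases Q)
    case None
    then have "P = None" using Q by (simp add: ec_norm_def ec_add_def)
    then show ?thesis using O by (metis imageI)
  next
    case (Some q)
    then obtain u v r s where eQ: "Q = Some ((u, v), (r, s))" by (metis surj_pair)
    have ab: "a \<oplus> b \<in> carrier R" "a \<otimes> b \<in> carrier R" by auto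
    note q = quad_point_cases[OF ab Q(1)[unfolded eQ]]
    show ?thesis
    proof (cases "v = \<zero>")
      case True
      have "r \<otimes> s \<oplus> r \<otimes> s = \<zero>"
        by (rule lift_eqI) (use q True in simp_all)
      then have "r \<otimes> s = \<zero>" using double_eq_0[of "r \<otimes> s"] q(3,4) by simp
      \<comment> \<open>With v = 0 the point is either rational or comes from the twist; in the
        second case its conjugate is its negative and the norm is O.\<close>
      then consider "s = \<zero>" | "r = \<zero>" using integral[of r s] q(3,4) by blast
      then show ?thesis
      proof cases
        case 1
        have on: "r \<otimes> r = cubic R (a \<oplus> b) (a \<otimes> b) u"
          by (subst curve_lift) (use q True 1 in \<open>simp_all add: algebra_simps\<close>)
        have "P = pls (Some (u, r)) (Some (u, r))"
          unfolding Q(2) eQ True 1 by (rule ec_norm_base[OF ab q(1,3) on])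
        moreover have m: "Some (u, r) \<in> E" using on q(1-4) by (simp add: mem_E)
        ultimately show ?thesis using kummer_add[OF m m] kummer_double[OF m] O by (metis imageI)
      next
        case 2
        have "P = None" unfolding Q(2) eQ True 2 ec_norm_def ec_add_def using q(1-4) by (simp add: quad_conj_def)
        then show ?thesis using O by (metis imageI)
      qed
    next
      case False
      obtain l n x where o: "l \<in> carrier R" "n \<in> carrier R" "x \<in> carrier R"
        and rs: "r = l \<otimes> u \<oplus> n" "s = l \<otimes> v"
        and lc: "line_cubic R (a \<oplus> b) (a \<otimes> b) l n (u \<oplus> u) (u \<otimes> u \<ominus> d \<otimes> (v \<otimes> v)) x"
        using quad_point_line_cubic[OF ab Q(1)[unfolded eQ] False] by metis
      have P': "P = Some (x, \<ominus> (l \<otimes> x \<oplus> n))"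
        unfolding Q(2) eQ rs using ec_norm_affine[OF ab o(1,2) q(1,2) o(3) False lc] .
      define c where "c = u \<otimes> u \<ominus> d \<otimes> (v \<otimes> v)"
      define c' where "c' = (u \<oplus> a) \<otimes> (u \<oplus> a) \<ominus> d \<otimes> (v \<otimes> v)"
      have cc: "c \<in> carrier R" "c' \<in> carrier R" unfolding c_def c'_def using q(1-4) by auto
      have cnz: "c \<noteq> \<zero>" "c' \<noteq> \<zero>" unfolding c_def c'_def using norm_nz q(1,2) False by auto
      have c': "c \<oplus> a \<otimes> (u \<oplus> u) \<oplus> a \<otimes> a = c'"
        by (rule lift_eqI) (use q(1-4) in \<open>simp_all add: c_def c'_def algebra_simps\<close>)
      have kP: "P \<in> E" "kummer P = (cl c, cl c')"
        using kummer_line_cubic[OF o(1,2) _ cc(1) o(3) lc[folded c_def]] cnz q(1-4) unfolding P' c' by auto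
      have dab: "d \<otimes> a \<oplus> d \<otimes> b \<in> carrier R" "d \<otimes> a \<otimes> (d \<otimes> b) \<in> carrier R" by auto
      \<comment> \<open>The image of Q under the isomorphism (X, Y) -> (d X, d sqrt d Y) from E to
        its twist, which is defined over K.\<close>
      have Q': "Some ((d \<otimes> u, d \<otimes> v), (d \<otimes> (d \<otimes> s), d \<otimes> r)) \<in> ec_points K (d \<otimes> a \<oplus> d \<otimes> b, \<zero>) (d \<otimes> a \<otimes> (d \<otimes> b), \<zero>)"
      proof (rule quad_pointI[OF dab])
        have "lift R (d \<otimes> (d \<otimes> s)) * lift R (d \<otimes> (d \<otimes> s)) + lift R d * (lift R (d \<otimes> r) * lift R (d \<otimes> r))
          = lift R d * lift R d * lift R d * (lift R r * lift R r + lift R d * (lift R s * lift R s))"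
          using q(1-4) by (simp add: algebra_simps)
        also have "\<dots> = lift R (d \<otimes> u) * lift R (d \<otimes> u) * lift R (d \<otimes> u)
          + 3 * (lift R d * lift R (d \<otimes> u) * lift R (d \<otimes> v) * lift R (d \<otimes> v))
          + lift R (d \<otimes> a \<oplus> d \<otimes> b) * (lift R (d \<otimes> u) * lift R (d \<otimes> u) + lift R d * lift R (d \<otimes> v) * lift R (d \<otimes> v))
          + lift R (d \<otimes> a \<otimes> (d \<otimes> b)) * lift R (d \<otimes> u)"
          unfolding q(5) using q(1-4) by (simp add: algebra_simps)
        finally show "lift R (d \<otimes> (d \<otimes> s)) * lift R (d \<otimes> (d \<otimes> s)) + lift R d * (lift R (d \<otimes> r) * lift R (d \<otimes> r)) =
          lift R (d \<otimes> u) * lift R (d \<otimes> u) * lift R (d \<otimes> u)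
          + 3 * (lift R d * lift R (d \<otimes> u) * lift R (d \<otimes> v) * lift R (d \<otimes> v))
          + lift R (d \<otimes> a \<oplus> d \<otimes> b) * (lift R (d \<otimes> u) * lift R (d \<otimes> u) + lift R d * lift R (d \<otimes> v) * lift R (d \<otimes> v))
          + lift R (d \<otimes> a \<otimes> (d \<otimes> b)) * lift R (d \<otimes> u)" .
        have "2 * (lift R (d \<otimes> (d \<otimes> s)) * lift R (d \<otimes> r)) = lift R d * lift R d * lift R d * (2 * (lift R r * lift R s))"
          using q(1-4) by (simp add: algebra_simps)
        also have "\<dots> = lift R (d \<otimes> v) * (3 * (lift R (d \<otimes> u) * lift R (d \<otimes> u)) + lift R d * lift R (d \<otimes> v) * lift R (d \<otimes> v)
          + 2 * (lift R (d \<otimes> a \<oplus> d \<otimes> b) * lift R (d \<otimes> u)) + lift R (d \<otimes> a \<otimes> (d \<otimes> b)))"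
          unfolding q(6) using q(1-4) by (simp add: algebra_simps)
        finally show "2 * (lift R (d \<otimes> (d \<otimes> s)) * lift R (d \<otimes> r)) =
          lift R (d \<otimes> v) * (3 * (lift R (d \<otimes> u) * lift R (d \<otimes> u)) + lift R d * lift R (d \<otimes> v) * lift R (d \<otimes> v)
          + 2 * (lift R (d \<otimes> a \<oplus> d \<otimes> b) * lift R (d \<otimes> u)) + lift R (d \<otimes> a \<otimes> (d \<otimes> b)))" .
      qed (use q(1-4) in auto)
      have dv: "d \<otimes> v \<noteq> \<zero>" using nz_mult d_nz False q(2) by simp
      obtain l' n' x' where o': "l' \<in> carrier R" "n' \<in> carrier R" "x' \<in> carrier R"
        and lc': "line_cubic R (d \<otimes> a \<oplus> d \<otimes> b) (d \<otimes> a \<otimes> (d \<otimes> b)) l' n' (d \<otimes> u \<oplus> d \<otimes> u)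
          (d \<otimes> u \<otimes> (d \<otimes> u) \<ominus> d \<otimes> (d \<otimes> v \<otimes> (d \<otimes> v))) x'"
        using quad_point_line_cubic[OF dab Q' dv] by metis
      \<comment> \<open>The norms of both factors are multiplied by d^2, so their classes do not
        change.\<close>
      have dc: "d \<otimes> u \<otimes> (d \<otimes> u) \<ominus> d \<otimes> (d \<otimes> v \<otimes> (d \<otimes> v)) = d \<otimes> d \<otimes> c"
        by (rule lift_eqI) (use q(1-4) in \<open>simp_all add: c_def algebra_simps\<close>)
      have dc': "d \<otimes> d \<otimes> c \<oplus> d \<otimes> a \<otimes> (d \<otimes> u \<oplus> d \<otimes> u) \<oplus> d \<otimes> a \<otimes> (d \<otimes> a) = d \<otimes> d \<otimes> c'"
        by (rule lift_eqI) (use q(1-4) in \<open>simp_all add: c_def c'_def algebra_simps\<close>)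
      have dnz: "d \<otimes> d \<otimes> c \<noteq> \<zero>" "d \<otimes> d \<otimes> c' \<noteq> \<zero>" using nz_mult d_nz cnz cc by auto
      have "Some (x', \<ominus> (l' \<otimes> x' \<oplus> n')) \<in> tw.E" "tw.kummer (Some (x', \<ominus> (l' \<otimes> x' \<oplus> n'))) = (cl c, cl c')"
        using tw.kummer_line_cubic[OF o'(1,2) _ _ o'(3) lc'[unfolded dc]] dnz cc q(1-4) cl_dd cnz unfolding dc' by auto
      then show ?thesis using kP by (metis imageI)
    qed
  qed
  then show "P \<in> E" "kummer P \<in> tw.kummer ` tw.E" by auto
qed

text \<open>Cosets of the norm group are preimages of cosets of the Kummer image of the twist.\<close>
theorem norm_index_eq:
  "norm_index R d (a \<oplus> b) (a \<otimes> b) = card ((\<lambda>g. (+) g ` (tw.kummer ` tw.E)) ` (kummer ` E))"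
proof -
  define J where "J = tw.kummer ` tw.E"
  have J0: "0 \<in> J"
    unfolding J_def by (rule image_eqI[of _ _ None]) (auto simp: tw.kummer_def zero_prod_def ec_points_def)
  have Jadd: "g + h \<in> J" if gh: "g \<in> J" "h \<in> J" for g h
  proof -
    obtain T U where TU: "T \<in> tw.E" "U \<in> tw.E" "g = tw.kummer T" "h = tw.kummer U"
      using gh unfolding J_def by (auto elim!: imageE)
    show ?thesis using tw.kummer_add[OF TU(1,2)] unfolding J_def TU(3,4) by (metis imageI)
  qed
  have Jdbl: "g + g = 0" if "g \<in> J" for g using that tw.kummer_double unfolding J_def by (auto elim!: imageE)
  define \<Phi> where "\<Phi> C = {Q \<in> E. kummer Q \<in> C}" for C
  have N: "M \<in> norms \<longleftrightarrow> M \<in> E \<and> kummer M \<in> J" for M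
    using kramer_forward[of M] kramer_backward[of M] unfolding J_def by blast
  have coset: "kummer Q \<in> (+) (kummer P) ` J \<longleftrightarrow> kummer P + kummer Q \<in> J" if "P \<in> E" for P Q
  proof
    assume "kummer Q \<in> (+) (kummer P) ` J"
    then obtain h where "h \<in> J" "kummer Q = kummer P + h" by blast
    then show "kummer P + kummer Q \<in> J" using kummer_double[OF that] by (simp add: add.assoc[symmetric])
  next
    assume "kummer P + kummer Q \<in> J"
    moreover have "kummer Q = kummer P + (kummer P + kummer Q)" using kummer_double[OF that] by (simp add: add.assoc[symmetric])
    ultimately show "kummer Q \<in> (+) (kummer P) ` J" by blast
  qed
  have 1: "pls P ` norms = \<Phi> ((+) (kummer P) ` J)" if P: "P \<in> E" for P
  proof (intro equalityI subsetI)
    fix Q assume "Q \<in> pls P ` norms"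
    then obtain M where M: "M \<in> E" "kummer M \<in> J" "Q = pls P M" using N by blast
    then show "Q \<in> \<Phi> ((+) (kummer P) ` J)" using kummer_add[OF P M(1)] by (auto simp: \<Phi>_def)
  next
    fix Q assume "Q \<in> \<Phi> ((+) (kummer P) ` J)"
    then have Q: "Q \<in> E" "kummer P + kummer Q \<in> J" using coset[OF P] by (auto simp: \<Phi>_def)
    define M where "M = pls (ec_neg R P) Q"
    have "M \<in> norms" unfolding N M_def using kummer_add[OF neg_E[OF P] Q(1)] kummer_neg[OF P] Q by simp
    moreover have "Q = pls P M" unfolding M_def using add_neg_cancel[OF P Q(1)] by simp
    ultimately show "Q \<in> pls P ` norms" by blast
  qed
  have "norm_index R d (a \<oplus> b) (a \<otimes> b) = card ((\<lambda>P. pls P ` norms) ` E)"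
    by (simp add: norm_index_def Let_def)
  also have "(\<lambda>P. pls P ` norms) ` E = \<Phi> ` ((\<lambda>g. (+) g ` J) ` (kummer ` E))"
    using 1 by (auto simp: image_image)
  \<comment> \<open>Cosets meeting the Kummer image are determined by their preimages: equal
    preimages share the point P, and two cosets with a common element agree.\<close>
  also have "card \<dots> = card ((\<lambda>g. (+) g ` J) ` (kummer ` E))"
  proof (rule card_image, rule inj_onI)
    fix C C' assume C: "C \<in> (\<lambda>g. (+) g ` J) ` (kummer ` E)" and C': "C' \<in> (\<lambda>g. (+) g ` J) ` (kummer ` E)"
      and e: "\<Phi> C = \<Phi> C'"
    obtain P P' where P: "P \<in> E" "C = (+) (kummer P) ` J" and P': "P' \<in> E" "C' = (+) (kummer P') ` J" using C C' by blast
    have "P \<in> \<Phi> C" using P J0 kummer_double[OF P(1)] coset[OF P(1)] by (auto simp: \<Phi>_def)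
    then have "kummer P \<in> (+) (kummer P') ` J" unfolding e P'(2) by (simp add: \<Phi>_def)
    then obtain h where h: "h \<in> J" "kummer P = kummer P' + h" by blast
    have "(+) (kummer P) ` J = (+) (kummer P') ` J"
    proof (intro equalityI subsetI)
      fix z assume "z \<in> (+) (kummer P) ` J"
      then obtain j where j: "j \<in> J" "z = kummer P + j" by blast
      have "z = kummer P' + (h + j)" by (simp only: j(2) h(2) add.assoc)
      then show "z \<in> (+) (kummer P') ` J" using Jadd[OF h(1) j(1)] by blast
    next
      fix z assume "z \<in> (+) (kummer P') ` J"
      then obtain j where j: "j \<in> J" "z = kummer P' + j" by blast
      have "z = kummer P + (h + j)" using j(2) h(2) Jdbl[OF h(1)]
        by (metis add.assoc add.right_neutral)
      then show "z \<in> (+) (kummer P) ` J" using Jadd[OF h(1) j(1)] by blast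
    qed
    then show "C = C'" using P P' by simp
  qed
  finally show ?thesis unfolding J_def .
qed

end

section \<open>Counting over finite fields\<close>

context elliptic_curve
begin

text \<open>The tangent at the half has slope \<alpha> + \<beta> + \<gamma>. The last equation is
  the tangent condition, from which this slope can be recovered.\<close>

lemma half_point:
  assumes P: "Some (x, y) \<in> E" and c: "\<alpha> \<in> carrier R" "\<beta> \<in> carrier R" "\<gamma> \<in> carrier R"
    and e: "\<alpha> \<otimes> \<alpha> = x" "\<beta> \<otimes> \<beta> = x \<oplus> a" "\<gamma> \<otimes> \<gamma> = x \<oplus> b" "y = \<alpha> \<otimes> \<beta> \<otimes> \<gamma>"
  obtains u w where "Some (u, w) \<in> E" "pls (Some (u, w)) (Some (u, w)) = Some (x, y)" "w \<noteq> \<zero>"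
    "(\<alpha> \<oplus> \<beta> \<oplus> \<gamma>) \<otimes> w \<oplus> (\<alpha> \<oplus> \<beta> \<oplus> \<gamma>) \<otimes> w = u \<otimes> u \<oplus> u \<otimes> u \<oplus> u \<otimes> u \<oplus> ((a \<oplus> b) \<otimes> u \<oplus> (a \<oplus> b) \<otimes> u) \<oplus> a \<otimes> b"
proof -
  have xy: "x \<in> carrier R" "y \<in> carrier R" using P by (auto simp: mem_E)
  have lx: "lift R x = lift R \<alpha> * lift R \<alpha>" using arg_cong[OF e(1), of "lift R"] c by simp
  have la: "lift R a = lift R \<beta> * lift R \<beta> - lift R x" using arg_cong[OF e(2), of "lift R"] c xy by simp
  have lb: "lift R b = lift R \<gamma> * lift R \<gamma> - lift R x" using arg_cong[OF e(3), of "lift R"] c xy by simp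
  have ly: "lift R y = lift R \<alpha> * lift R \<beta> * lift R \<gamma>" using arg_cong[OF e(4), of "lift R"] c by simp
  define l h where "l = \<alpha> \<oplus> \<beta> \<oplus> \<gamma>" and "h = \<alpha> \<otimes> \<beta> \<oplus> \<alpha> \<otimes> \<gamma> \<oplus> \<beta> \<otimes> \<gamma>"
  have lh: "l \<in> carrier R" "h \<in> carrier R" unfolding l_def h_def using c by auto
  have 1: "lift R l * lift R l = 3 * lift R x + (lift R a + lift R b) + 2 * lift R h"
    unfolding la lb lx l_def h_def using c by (simp add: algebra_simps)
  have 2: "lift R h * lift R h - lift R \<zero> = 3 * (lift R x * lift R x) + 2 * (lift R a + lift R b) * lift R x + lift R a * lift R b +
      2 * (lift R l * lift R y)"
    unfolding la lb lx ly l_def h_def using c by (simp add: algebra_simps)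
  define u n where "u = x \<oplus> h" and "n = \<ominus> y \<ominus> l \<otimes> x"
  have un: "u \<in> carrier R" "n \<in> carrier R" unfolding u_def n_def using lh xy by auto
  note L = line_cubicI[OF P lh zero_closed 1 2, folded u_def n_def]
  have lc: "line_cubic R (a \<oplus> b) (a \<otimes> b) l n (u \<oplus> u) (u \<otimes> u) x"
    using L(1) un by (simp add: a_minus_def)
  note D = line_cubic_double[OF lh(1) un(2,1) xy(1) lc]
  have "l \<otimes> (l \<otimes> u \<oplus> n) \<oplus> l \<otimes> (l \<otimes> u \<oplus> n) = u \<otimes> u \<oplus> u \<otimes> u \<oplus> u \<otimes> u \<oplus> ((a \<oplus> b) \<otimes> u \<oplus> (a \<oplus> b) \<otimes> u) \<oplus> a \<otimes> b"
    by (rule lift_eqI) (use D(4) lh un in \<open>simp_all add: algebra_simps\<close>)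
  then show ?thesis using that[of u "l \<otimes> u \<oplus> n"] D(1-3) L(2) unfolding l_def[symmetric] by simp
qed

text \<open>The tangent condition is linear in l with coefficient 2 w, so a point with nonzero
  ordinate has only one tangent slope.\<close>

lemma half_unique_slope:
  assumes "l \<in> carrier R" "l' \<in> carrier R" "w \<in> carrier R" "w \<noteq> \<zero>" "l \<otimes> w \<oplus> l \<otimes> w = l' \<otimes> w \<oplus> l' \<otimes> w"
  shows "l = l'"
proof -
  have "(l \<ominus> l') \<otimes> w \<oplus> (l \<ominus> l') \<otimes> w = (l \<otimes> w \<oplus> l \<otimes> w) \<ominus> (l' \<otimes> w \<oplus> l' \<otimes> w)"
    by (rule lift_eqI) (use assms(1-3) in \<open>simp_all add: algebra_simps\<close>)
  also have "\<dots> = \<zero>" using assms by simp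
  finally have "(l \<ominus> l') \<otimes> w = \<zero>" using double_eq_0[of "(l \<ominus> l') \<otimes> w"] assms by simp
  then show ?thesis using integral[of "l \<ominus> l'" w] assms by auto
qed

lemma sum_zero_contra:
  assumes "\<beta> \<in> carrier R" "\<gamma> \<in> carrier R" "(\<beta> \<oplus> \<gamma>) \<oplus> (\<beta> \<oplus> \<gamma>) = \<zero>"
  shows "\<beta> \<otimes> \<beta> = \<gamma> \<otimes> \<gamma>"
proof -
  have "\<beta> \<oplus> \<gamma> = \<zero>" using assms double_eq_0[of "\<beta> \<oplus> \<gamma>"] by simp
  then have "\<ominus> \<gamma> = \<beta>" using assms by (intro minus_equality) auto
  then show ?thesis using assms by (auto simp: l_minus r_minus)
qed

text \<open>A point with trivial Kummer class has the halves with slopes \<alpha> + \<beta> + \<gamma>, where the signs of the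
  square roots vary with fixed product; different slopes give different points.\<close>
lemma four_halves:
  assumes P: "P \<in> E" "kummer P = 0" and fin: "finite (carrier R)"
  shows "4 \<le> card {Q \<in> E. pls Q Q = P}"
proof -
  have finE: "finite E"
    by (rule finite_subset[of _ "insert None (Some ` (carrier R \<times> carrier R))"])
      (use fin in \<open>auto simp: ec_points_def\<close>)
  have four: "4 \<le> card {Q \<in> E. pls Q Q = P}"
    if "A \<in> E" "B \<in> E" "C \<in> E" "D \<in> E" "pls A A = P" "pls B B = P" "pls C C = P" "pls D D = P"
      "A \<noteq> B" "A \<noteq> C" "A \<noteq> D" "B \<noteq> C" "B \<noteq> D" "C \<noteq> D" for A B C D
  proof -
    have "card {A, B, C, D} \<le> card {Q \<in> E. pls Q Q = P}"
      by (rule card_mono) (use that finE in auto)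
    then show ?thesis using that by simp
  qed
  show ?thesis
  proof (cases P)
    case None
    \<comment> \<open>The halves of the point at infinity are the four 2-torsion points.\<close>
    have "\<ominus> a \<noteq> \<ominus> b" using ab_nz by (metis ab_carrier minus_minus)
    moreover have "cubic R (a \<oplus> b) (a \<otimes> b) (\<ominus> a) = \<zero>" "cubic R (a \<oplus> b) (a \<otimes> b) (\<ominus> b) = \<zero>"
      by (simp_all only: cubic_factor a_inv_closed ab_carrier) (simp_all add: l_neg)
    moreover have "\<zero> \<noteq> \<ominus> a" "\<zero> \<noteq> \<ominus> b" using ab_nz'(6,7) by metis+
    ultimately show ?thesis
      by (intro four[of None "Some (\<zero>, \<zero>)" "Some (\<ominus> a, \<zero>)" "Some (\<ominus> b, \<zero>)"])
        (auto simp: None mem_E ec_add_def ec_points_def)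
  next
    case (Some p)
    then obtain x y where eP: "P = Some (x, y)" by (cases p) auto
    obtain \<alpha> \<beta> \<gamma> where c: "\<alpha> \<in> carrier R" "\<beta> \<in> carrier R" "\<gamma> \<in> carrier R"
      and e: "\<alpha> \<otimes> \<alpha> = x" "\<beta> \<otimes> \<beta> = x \<oplus> a" "\<gamma> \<otimes> \<gamma> = x \<oplus> b" "y = \<alpha> \<otimes> \<beta> \<otimes> \<gamma>"
      using sqrt_coords P eP by metis
    have xc: "x \<in> carrier R" using P eP by (auto simp: mem_E)
    have sq: "\<ominus> z \<otimes> \<ominus> z = z \<otimes> z" if "z \<in> carrier R" for z using that by (simp add: l_minus r_minus)
    have H: "\<exists>Q w. Q \<in> E \<and> pls Q Q = P \<and> w \<in> carrier R \<and> w \<noteq> \<zero> \<and> (\<exists>u. Q = Some (u, w) \<and>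
      l \<otimes> w \<oplus> l \<otimes> w = u \<otimes> u \<oplus> u \<otimes> u \<oplus> u \<otimes> u \<oplus> ((a \<oplus> b) \<otimes> u \<oplus> (a \<oplus> b) \<otimes> u) \<oplus> a \<otimes> b)"
      if "l = \<alpha>' \<oplus> \<beta>' \<oplus> \<gamma>'" "\<alpha>' \<in> carrier R" "\<beta>' \<in> carrier R" "\<gamma>' \<in> carrier R" "\<alpha>' \<otimes> \<alpha>' = x"
        "\<beta>' \<otimes> \<beta>' = x \<oplus> a" "\<gamma>' \<otimes> \<gamma>' = x \<oplus> b" "y = \<alpha>' \<otimes> \<beta>' \<otimes> \<gamma>'" for l \<alpha>' \<beta>' \<gamma>'
      using half_point[OF P(1)[unfolded eP] that(2-8)] unfolding eP that(1) by (metis mem_E)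
    define l1 l2 l3 l4 where l: "l1 = \<alpha> \<oplus> \<beta> \<oplus> \<gamma>" "l2 = \<alpha> \<oplus> \<ominus> \<beta> \<oplus> \<ominus> \<gamma>" "l3 = \<ominus> \<alpha> \<oplus> \<beta> \<oplus> \<ominus> \<gamma>" "l4 = \<ominus> \<alpha> \<oplus> \<ominus> \<beta> \<oplus> \<gamma>"
    have lc: "l1 \<in> carrier R" "l2 \<in> carrier R" "l3 \<in> carrier R" "l4 \<in> carrier R" unfolding l using c by auto
    have y': "y = \<alpha> \<otimes> \<ominus> \<beta> \<otimes> \<ominus> \<gamma>" "y = \<ominus> \<alpha> \<otimes> \<beta> \<otimes> \<ominus> \<gamma>" "y = \<ominus> \<alpha> \<otimes> \<ominus> \<beta> \<otimes> \<gamma>"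
      using e(4) c by (simp_all add: l_minus r_minus)
    obtain A u1 w1 where A: "A \<in> E" "pls A A = P" "w1 \<in> carrier R" "w1 \<noteq> \<zero>" "A = Some (u1, w1)"
      "l1 \<otimes> w1 \<oplus> l1 \<otimes> w1 = u1 \<otimes> u1 \<oplus> u1 \<otimes> u1 \<oplus> u1 \<otimes> u1 \<oplus> ((a \<oplus> b) \<otimes> u1 \<oplus> (a \<oplus> b) \<otimes> u1) \<oplus> a \<otimes> b"
      using H[OF l(1) c e] by metis
    obtain B u2 w2 where B: "B \<in> E" "pls B B = P" "w2 \<in> carrier R" "w2 \<noteq> \<zero>" "B = Some (u2, w2)"
      "l2 \<otimes> w2 \<oplus> l2 \<otimes> w2 = u2 \<otimes> u2 \<oplus> u2 \<otimes> u2 \<oplus> u2 \<otimes> u2 \<oplus> ((a \<oplus> b) \<otimes> u2 \<oplus> (a \<oplus> b) \<otimes> u2) \<oplus> a \<otimes> b"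
      using H[OF l(2) _ _ _ _ _ _ y'(1)] c e sq by (metis a_inv_closed)
    obtain C u3 w3 where C: "C \<in> E" "pls C C = P" "w3 \<in> carrier R" "w3 \<noteq> \<zero>" "C = Some (u3, w3)"
      "l3 \<otimes> w3 \<oplus> l3 \<otimes> w3 = u3 \<otimes> u3 \<oplus> u3 \<otimes> u3 \<oplus> u3 \<otimes> u3 \<oplus> ((a \<oplus> b) \<otimes> u3 \<oplus> (a \<oplus> b) \<otimes> u3) \<oplus> a \<otimes> b"
      using H[OF l(3) _ _ _ _ _ _ y'(2)] c e sq by (metis a_inv_closed)
    obtain D u4 w4 where D: "D \<in> E" "pls D D = P" "w4 \<in> carrier R" "w4 \<noteq> \<zero>" "D = Some (u4, w4)"
      "l4 \<otimes> w4 \<oplus> l4 \<otimes> w4 = u4 \<otimes> u4 \<oplus> u4 \<otimes> u4 \<oplus> u4 \<otimes> u4 \<oplus> ((a \<oplus> b) \<otimes> u4 \<oplus> (a \<oplus> b) \<otimes> u4) \<oplus> a \<otimes> b"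
      using H[OF l(4) _ _ _ _ _ _ y'(3)] c e sq by (metis a_inv_closed)
    have ne: "\<alpha> \<otimes> \<alpha> \<noteq> \<beta> \<otimes> \<beta>" "\<alpha> \<otimes> \<alpha> \<noteq> \<gamma> \<otimes> \<gamma>" "\<beta> \<otimes> \<beta> \<noteq> \<gamma> \<otimes> \<gamma>"
    proof -
      have "a = b" if "x \<oplus> a = x \<oplus> b"
        by (rule lift_eqI) (use arg_cong[OF that, of "lift R"] xc in simp_all)
      then show "\<alpha> \<otimes> \<alpha> \<noteq> \<beta> \<otimes> \<beta>" "\<alpha> \<otimes> \<alpha> \<noteq> \<gamma> \<otimes> \<gamma>" "\<beta> \<otimes> \<beta> \<noteq> \<gamma> \<otimes> \<gamma>"
        unfolding e using xc ab_nz by auto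
    qed
    \<comment> \<open>The difference of two slopes is twice a sum of two signed roots, which is
      nonzero because x, x + a and x + b are distinct.\<close>
    have df: "l1 \<ominus> l2 = (\<beta> \<oplus> \<gamma>) \<oplus> (\<beta> \<oplus> \<gamma>)" "l1 \<ominus> l3 = (\<alpha> \<oplus> \<gamma>) \<oplus> (\<alpha> \<oplus> \<gamma>)" "l1 \<ominus> l4 = (\<alpha> \<oplus> \<beta>) \<oplus> (\<alpha> \<oplus> \<beta>)"
      "l2 \<ominus> l3 = (\<alpha> \<oplus> \<ominus> \<beta>) \<oplus> (\<alpha> \<oplus> \<ominus> \<beta>)" "l2 \<ominus> l4 = (\<alpha> \<oplus> \<ominus> \<gamma>) \<oplus> (\<alpha> \<oplus> \<ominus> \<gamma>)" "l3 \<ominus> l4 = (\<beta> \<oplus> \<ominus> \<gamma>) \<oplus> (\<beta> \<oplus> \<ominus> \<gamma>)"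
      unfolding l by (rule lift_eqI; use c in \<open>simp add: algebra_simps\<close>)+
    have sep: "Some (u, w) \<noteq> Some (u', w')"
      if "l \<otimes> w \<oplus> l \<otimes> w = u \<otimes> u \<oplus> u \<otimes> u \<oplus> u \<otimes> u \<oplus> ((a \<oplus> b) \<otimes> u \<oplus> (a \<oplus> b) \<otimes> u) \<oplus> a \<otimes> b"
        "l' \<otimes> w' \<oplus> l' \<otimes> w' = u' \<otimes> u' \<oplus> u' \<otimes> u' \<oplus> u' \<otimes> u' \<oplus> ((a \<oplus> b) \<otimes> u' \<oplus> (a \<oplus> b) \<otimes> u') \<oplus> a \<otimes> b"
        "w \<in> carrier R" "w \<noteq> \<zero>" "l \<in> carrier R" "l' \<in> carrier R"
        "l \<ominus> l' = (\<beta>' \<oplus> \<gamma>') \<oplus> (\<beta>' \<oplus> \<gamma>')" "\<beta>' \<in> carrier R" "\<gamma>' \<in> carrier R" "\<beta>' \<otimes> \<beta>' \<noteq> \<gamma>' \<otimes> \<gamma>'"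
      for l l' u u' w w' \<beta>' \<gamma>'
    proof
      assume "Some (u, w) = Some (u', w')"
      then have "l \<otimes> w \<oplus> l \<otimes> w = l' \<otimes> w \<oplus> l' \<otimes> w" using that(1,2) by simp
      then have "l = l'" using half_unique_slope that(3-6) by blast
      then have "l \<ominus> l' = \<zero>" using that(6) by simp
      then have "(\<beta>' \<oplus> \<gamma>') \<oplus> (\<beta>' \<oplus> \<gamma>') = \<zero>" by (simp only: that(7))
      then show False using sum_zero_contra that(8-10) by blast
    qed
    have "A \<noteq> B" unfolding A(5) B(5)
      by (rule sep[OF A(6) B(6) A(3,4) lc(1,2) df(1)]) (use c ne sq in simp_all)
    moreover have "A \<noteq> C" unfolding A(5) C(5)
      by (rule sep[OF A(6) C(6) A(3,4) lc(1,3) df(2)]) (use c ne sq in simp_all)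
    moreover have "A \<noteq> D" unfolding A(5) D(5)
      by (rule sep[OF A(6) D(6) A(3,4) lc(1,4) df(3)]) (use c ne sq in simp_all)
    moreover have "B \<noteq> C" unfolding B(5) C(5)
      by (rule sep[OF B(6) C(6) B(3,4) lc(2,3) df(4)]) (use c ne sq in simp_all)
    moreover have "B \<noteq> D" unfolding B(5) D(5)
      by (rule sep[OF B(6) D(6) B(3,4) lc(2,4) df(5)]) (use c ne sq in simp_all)
    moreover have "C \<noteq> D" unfolding C(5) D(5)
      by (rule sep[OF C(6) D(6) C(3,4) lc(3,4) df(6)]) (use c ne sq in simp_all)
    ultimately show ?thesis by (rule four[OF A(1) B(1) C(1) D(1) A(2) B(2) C(2) D(2)])
  qed
qed

text \<open>Every fibre of the Kummer map has the size of the kernel Z, while the points of Z have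
  disjoint sets of at least four halves. Counting E in both ways gives the bound.\<close>

lemma card_kummer_ge_4:
  assumes fin: "finite (carrier R)"
  shows "4 \<le> card (kummer ` E)"
proof -
  have finE: "finite E"
    by (rule finite_subset[of _ "insert None (Some ` (carrier R \<times> carrier R))"])
      (use fin in \<open>auto simp: ec_points_def\<close>)
  define Z where "Z = {P \<in> E. kummer P = 0}"
  have Z0: "None \<in> Z" by (simp add: Z_def ec_points_def kummer_def zero_prod_def)
  have nn: "ec_neg R (ec_neg R P) = P" if "P \<in> E" for P
    using that by (cases P) (auto simp: ec_neg_def mem_E)
  have fib: "card {Q \<in> E. kummer Q = kummer P} = card Z" if P: "P \<in> E" for P
  proof -
    have "{Q \<in> E. kummer Q = kummer P} = pls P ` Z"
    proof (intro equalityI subsetI)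
      fix Q assume Q: "Q \<in> {Q \<in> E. kummer Q = kummer P}"
      have "pls (ec_neg R P) Q \<in> Z"
        using kummer_add[OF neg_E[OF P], of Q] kummer_neg[OF P] kummer_double[OF P] Q by (simp add: Z_def)
      moreover have "Q = pls P (pls (ec_neg R P) Q)" using add_neg_cancel[OF P] Q by simp
      ultimately show "Q \<in> pls P ` Z" by blast
    next
      fix Q assume "Q \<in> pls P ` Z"
      then show "Q \<in> {Q \<in> E. kummer Q = kummer P}" using kummer_add[OF P] by (auto simp: Z_def)
    qed
    moreover have "inj_on (pls P) Z"
      by (rule inj_on_inverseI[of _ "pls (ec_neg R P)"])
        (use add_neg_cancel[OF neg_E[OF P]] nn[OF P] in \<open>auto simp: Z_def\<close>)
    ultimately show ?thesis by (simp add: card_image)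
  qed
  have "card E = (\<Sum>g\<in>kummer ` E. card {Q \<in> E. kummer Q = g})"
    using sum.image_gen[OF finE, of "\<lambda>_. 1::nat" kummer] by simp
  also have "\<dots> = (\<Sum>g\<in>kummer ` E. card Z)" by (rule sum.cong) (use fib in auto)
  also have "\<dots> = card (kummer ` E) * card Z" by simp
  finally have 1: "card E = card (kummer ` E) * card Z" .
  have "4 * card Z = (\<Sum>P\<in>Z. 4)" by simp
  also have "\<dots> \<le> (\<Sum>P\<in>Z. card {Q \<in> E. pls Q Q = P})"
    by (rule sum_mono) (use four_halves fin in \<open>auto simp: Z_def\<close>)
  also have "\<dots> = card (\<Union>P\<in>Z. {Q \<in> E. pls Q Q = P})"
    by (rule card_UN_disjoint[symmetric]) (use finE in \<open>auto simp: Z_def\<close>)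
  also have "\<dots> \<le> card E" by (rule card_mono) (use finE in auto)
  finally have "4 * card Z \<le> card (kummer ` E) * card Z" using 1 by simp
  moreover have "0 < card Z" using Z0 finE by (auto simp: card_gt_0_iff Z_def)
  ultimately show ?thesis by simp
qed

end

section \<open>Places and rational square classes\<close>

text \<open>The image of the Kummer map, computed with rational abscissas: the four torsion points come first.\<close>
definition kummer_image :: "(rat \<Rightarrow> 'g::ab_group_add) \<Rightarrow> rat \<Rightarrow> rat \<Rightarrow> ('g \<times> 'g) set" where
  "kummer_image c a b = {(0, 0), (c (a * b), c a), (c (- a), c (- a * (b - a))), (c (- b), c (a - b))} \<union>
     {(c x, c (x + a)) | x. x \<noteq> 0 \<and> x + a \<noteq> 0 \<and> x + b \<noteq> 0 \<and> c x + c (x + a) + c (x + b) = 0}"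

text \<open>\<open>approx\<close> unites the density of Q with the local constancy of square
  classes: one rational x serves all shifts in C at once. The class map is given on Q only and is
  extended by means of it.\<close>

locale place = odd_char_field +
  fixes \<iota> :: "rat \<Rightarrow> 'a" and rat_class :: "rat \<Rightarrow> 'g::ab_group_add"
  assumes \<iota>_closed [simp]: "\<iota> x \<in> carrier R"
    and \<iota>_add: "\<iota> (x + y) = \<iota> x \<oplus> \<iota> y"
    and \<iota>_mult: "\<iota> (x * y) = \<iota> x \<otimes> \<iota> y"
    and \<iota>_eq_0: "\<iota> x = \<zero> \<Longrightarrow> x = 0"
    and rat_class_mult: "x \<noteq> 0 \<Longrightarrow> y \<noteq> 0 \<Longrightarrow> rat_class (x * y) = rat_class x + rat_class y"
    and rat_class_eq_0: "x \<noteq> 0 \<Longrightarrow> rat_class x = 0 \<longleftrightarrow> (\<exists>s\<in>carrier R. s \<otimes> s = \<iota> x)"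
    and approx: "z \<in> carrier R \<Longrightarrow> finite C \<Longrightarrow> (\<And>c. c \<in> C \<Longrightarrow> z \<oplus> \<iota> c \<noteq> \<zero>) \<Longrightarrow>
      \<exists>x. \<forall>c\<in>C. x + c \<noteq> 0 \<and> (\<exists>s\<in>carrier R. s \<otimes> s = (z \<oplus> \<iota> c) \<otimes> \<iota> (x + c))"
begin

lemma \<iota>_0 [simp]: "\<iota> 0 = \<zero>"
  using \<iota>_add[of 0 0] by (metis \<iota>_closed add.r_cancel_one add_0)

lemma \<iota>_minus: "\<iota> (- x) = \<ominus> \<iota> x"
proof -
  have "\<iota> (- x) \<oplus> \<iota> x = \<zero>" using \<iota>_add[of "- x" x] by simp
  then show ?thesis using minus_equality[of "\<iota> (- x)" "\<iota> x"] by simp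
qed

lemma \<iota>_diff: "\<iota> (x - y) = \<iota> x \<ominus> \<iota> y"
  using \<iota>_add[of x "- y"] by (simp add: \<iota>_minus a_minus_def)

lemma \<iota>_nz: "x \<noteq> 0 \<Longrightarrow> \<iota> x \<noteq> \<zero>"
  using \<iota>_eq_0 by blast

lemma square_cancel:
  assumes "z \<in> carrier R" "w \<in> carrier R" "w \<noteq> \<zero>" "s \<in> carrier R" "s \<otimes> s = z \<otimes> (w \<otimes> w)"
  shows "\<exists>t\<in>carrier R. t \<otimes> t = z"
proof -
  have i: "inv w \<in> carrier R" "w \<otimes> inv w = \<one>" using assms field_Units by auto
  have "(s \<otimes> inv w) \<otimes> (s \<otimes> inv w) = (s \<otimes> s) \<otimes> (inv w \<otimes> inv w)" using assms(1,2,4) i(1) by (simp add: m_ac)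
  also have "\<dots> = z \<otimes> ((w \<otimes> inv w) \<otimes> (w \<otimes> inv w))"
    unfolding assms(5) using assms(1,2) i(1) by (simp only: m_ac m_closed)
  also have "\<dots> = z" using i assms(1) by simp
  finally show ?thesis using i assms by (intro bexI[of _ "s \<otimes> inv w"]) auto
qed

section \<open>Extending rational square classes to the local field\<close>

definition repr :: "'a \<Rightarrow> rat \<Rightarrow> bool" where
  "repr z x \<longleftrightarrow> x \<noteq> 0 \<and> (\<exists>s\<in>carrier R. s \<otimes> s = z \<otimes> \<iota> x)"

definition cl :: "'a \<Rightarrow> 'g" where
  "cl z = rat_class (SOME x. repr z x)"

lemma repr_mult:
  assumes "z \<in> carrier R" "w \<in> carrier R" "repr z x" "repr w y"
  shows "repr (z \<otimes> w) (x * y)"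
proof -
  obtain s t where "s \<in> carrier R" "t \<in> carrier R" "s \<otimes> s = z \<otimes> \<iota> x" "t \<otimes> t = w \<otimes> \<iota> y"
    using assms by (auto simp: repr_def)
  moreover from this have "(s \<otimes> t) \<otimes> (s \<otimes> t) = (z \<otimes> \<iota> x) \<otimes> (w \<otimes> \<iota> y)"
    by (metis (no_types, lifting) m_assoc m_closed m_lcomm)
  ultimately show ?thesis
    using assms by (auto simp: repr_def \<iota>_mult m_ac intro!: bexI[of _ "s \<otimes> t"])
qed

text \<open>If z x and z y are squares, so is x y, and classes are killed by two.\<close>

lemma repr_unique:
  assumes z: "z \<in> carrier R" "z \<noteq> \<zero>" and x: "repr z x" and y: "repr z y"
  shows "rat_class x = rat_class y"
proof -
  have nz: "x \<noteq> 0" "y \<noteq> 0" using x y by (auto simp: repr_def)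
  have "repr (z \<otimes> z) (x * y)" using repr_mult x y z by blast
  then obtain s where "s \<in> carrier R" "s \<otimes> s = \<iota> (x * y) \<otimes> (z \<otimes> z)"
    using z by (auto simp: repr_def m_ac)
  then have "rat_class (x * y) = 0" using square_cancel z nz by (simp add: rat_class_eq_0)
  then have 1: "rat_class x + rat_class y = 0" using rat_class_mult nz by simp
  have "rat_class (x * x) = 0" using nz rat_class_eq_0[of "x * x"] by (auto simp: \<iota>_mult)
  then have "rat_class x + rat_class x = 0" using rat_class_mult nz by simp
  then show ?thesis using 1 by (metis add_left_cancel)
qed

lemma cl_repr: "z \<in> carrier R \<Longrightarrow> z \<noteq> \<zero> \<Longrightarrow> repr z x \<Longrightarrow> cl z = rat_class x"
  unfolding cl_def by (rule repr_unique[of z]) (auto intro: someI)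

lemma repr_ex: "z \<in> carrier R \<Longrightarrow> z \<noteq> \<zero> \<Longrightarrow> \<exists>x. repr z x"
  using approx[of z "{0}"] by (auto simp: repr_def)

lemma cl_\<iota>: "x \<noteq> 0 \<Longrightarrow> cl (\<iota> x) = rat_class x"
  by (rule cl_repr) (auto simp: repr_def \<iota>_nz intro!: bexI[of _ "\<iota> x"])

sublocale square_class_field R cl
proof
  fix x y assume xy: "x \<in> carrier R" "y \<in> carrier R" "x \<noteq> \<zero>" "y \<noteq> \<zero>"
  obtain u v where uv: "repr x u" "repr y v" using repr_ex xy by blast
  have "x \<otimes> y \<noteq> \<zero>" using integral xy by blast
  then have "cl (x \<otimes> y) = rat_class (u * v)" using cl_repr[OF _ _ repr_mult[OF xy(1,2) uv]] xy by simp
  then show "cl (x \<otimes> y) = cl x + cl y"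
    using rat_class_mult uv cl_repr xy by (auto simp: repr_def)
next
  fix x assume x: "x \<in> carrier R" "x \<noteq> \<zero>"
  obtain u where u: "repr x u" using repr_ex x by blast
  then obtain s where s: "s \<in> carrier R" "s \<otimes> s = x \<otimes> \<iota> u" and unz: "u \<noteq> 0" by (auto simp: repr_def)
  have c: "cl x = rat_class u" using cl_repr x u by blast
  show "cl x = 0 \<longleftrightarrow> (\<exists>s\<in>carrier R. s \<otimes> s = x)"
  proof
    assume "cl x = 0"
    then obtain t where t: "t \<in> carrier R" "t \<otimes> t = \<iota> u" using c rat_class_eq_0 unz by auto
    then have "t \<noteq> \<zero>" using \<iota>_nz[OF unz] by auto
    then show "\<exists>s\<in>carrier R. s \<otimes> s = x" using square_cancel[of x t s] s t x by simp
  next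
    assume "\<exists>s\<in>carrier R. s \<otimes> s = x"
    then obtain t where t: "t \<in> carrier R" "t \<otimes> t = x" by blast
    then have "t \<noteq> \<zero>" using x by auto
    then have "\<exists>r\<in>carrier R. r \<otimes> r = \<iota> u"
      using square_cancel[of "\<iota> u" t s] s t x by (simp add: m_comm)
    then show "cl x = 0" using c rat_class_eq_0 unz by simp
  qed
qed

lemma curve_\<iota>:
  assumes "a \<noteq> 0" "b \<noteq> 0" "a \<noteq> b"
  shows "elliptic_curve R cl (\<iota> a) (\<iota> b)"
proof unfold_locales
  show "\<iota> a \<noteq> \<iota> b"
  proof
    assume "\<iota> a = \<iota> b"
    then have "\<iota> (a - b) = \<zero>" by (simp add: \<iota>_diff)
    then show False using \<iota>_eq_0 assms by fastforce
  qed
qed (use assms \<iota>_nz in auto)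

text \<open>Away from torsion, a local abscissa is approximated for the shifts 0, a and b
  simultaneously. Conversely, a rational x with trivial total class makes x (x + a) (x + b) a
  square, which supplies the ordinate.\<close>

lemma kummer_image_eq:
  assumes ab: "a \<noteq> 0" "b \<noteq> 0" "a \<noteq> b"
  shows "elliptic_curve.kummer R cl (\<iota> a) (\<iota> b) ` ec_points R (\<iota> a \<oplus> \<iota> b) (\<iota> a \<otimes> \<iota> b) = kummer_image rat_class a b"
proof -
  interpret C: elliptic_curve R cl "\<iota> a" "\<iota> b" by (rule curve_\<iota>[OF ab])
  have k0: "root_class w (\<iota> x) = (if x = 0 then cl w else rat_class x)" for w x
    by (simp add: root_class_def cl_\<iota> \<iota>_nz)
  have w: "cl (\<iota> a \<otimes> \<iota> b) = rat_class (a * b)" "cl (\<ominus> \<iota> a \<otimes> (\<iota> b \<ominus> \<iota> a)) = rat_class (- a * (b - a))"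
    using ab by (simp_all flip: \<iota>_mult \<iota>_diff \<iota>_minus add: cl_\<iota>)
  have kr: "C.kummer (Some (\<iota> x, y)) = (if x = 0 then rat_class (a * b) else rat_class x, if x + a = 0 then rat_class (- a * (b - a)) else rat_class (x + a))" for x y
    by (simp add: C.kummer_def k0 w del: l_minus flip: \<iota>_add)
  have on: "cubic R (\<iota> a \<oplus> \<iota> b) (\<iota> a \<otimes> \<iota> b) (\<iota> x) = \<iota> (x * (x + a) * (x + b))" for x
    by (simp flip: \<iota>_add \<iota>_mult add: algebra_simps)
  show ?thesis
  proof (intro equalityI subsetI)
    fix g assume "g \<in> C.kummer ` C.E"
    then obtain P where P: "P \<in> C.E" "g = C.kummer P" by (auto elim!: imageE)
    show "g \<in> kummer_image rat_class a b"
    proof (cases P)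
      case None
      then show ?thesis using P by (simp add: C.kummer_def kummer_image_def)
    next
      case (Some p)
      then obtain z y where eP: "P = Some (z, y)" by (cases p) auto
      have zc: "z \<in> carrier R" using P eP by (simp add: C.mem_E)
      consider "z = \<iota> 0" | "z = \<iota> (- a)" | "z = \<iota> (- b)" | "z \<noteq> \<zero>" "z \<oplus> \<iota> a \<noteq> \<zero>" "z \<oplus> \<iota> b \<noteq> \<zero>"
        using C.root_cases(1,2)[OF zc] by (force simp: \<iota>_minus)
      then show ?thesis
      proof cases
        case 1
        have "g = (rat_class (a * b), rat_class a)" using P eP 1 kr[of 0 y] ab by simp
        then show ?thesis by (simp add: kummer_image_def)
      next
        case 2
        have "g = (rat_class (- a), rat_class (- a * (b - a)))" using P eP kr[of "- a" y] ab by (simp add: 2)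
        then show ?thesis by (simp add: kummer_image_def)
      next
        case 3
        have "g = (rat_class (- b), rat_class (a - b))" using P eP kr[of "- b" y] ab by (simp add: 3)
        then show ?thesis by (simp add: kummer_image_def)
      next
        case 4
        have "\<And>c. c \<in> {0, a, b} \<Longrightarrow> z \<oplus> \<iota> c \<noteq> \<zero>" using 4 zc by auto
        then obtain x where x: "\<forall>c\<in>{0, a, b}. x + c \<noteq> 0 \<and> (\<exists>s\<in>carrier R. s \<otimes> s = (z \<oplus> \<iota> c) \<otimes> \<iota> (x + c))"
          using approx[OF zc, of "{0, a, b}"] by blast
        then have "repr z x" "repr (z \<oplus> \<iota> a) (x + a)" "repr (z \<oplus> \<iota> b) (x + b)"
          using zc by (auto simp: repr_def)
        then have c: "cl z = rat_class x" "cl (z \<oplus> \<iota> a) = rat_class (x + a)" "cl (z \<oplus> \<iota> b) = rat_class (x + b)"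
          using cl_repr 4 zc by auto
        have "rat_class x + rat_class (x + a) + rat_class (x + b) = 0"
          using C.k_sum[of z y] P eP 4 by (simp add: root_class_def c)
        moreover have "g = (rat_class x, rat_class (x + a))" using P eP 4 by (simp add: C.kummer_def root_class_def c)
        ultimately show ?thesis using x unfolding kummer_image_def by auto
      qed
    qed
  next
    fix g assume g: "g \<in> kummer_image rat_class a b"
    have pt: "Some (\<iota> x, y) \<in> C.E" if "y \<in> carrier R" "y \<otimes> y = \<iota> (x * (x + a) * (x + b))" for x y
      using that by (simp add: C.mem_E on)
    have tor: "C.kummer (Some (\<iota> x, \<zero>)) \<in> C.kummer ` C.E" if "x = 0 \<or> x = - a \<or> x = - b" for x
      by (rule imageI, rule pt) (use that in auto)
    have "C.kummer None = (0, 0)" "None \<in> C.E" by (simp_all add: C.kummer_def ec_points_def)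
    then have 0: "(0, 0) \<in> C.kummer ` C.E" by (metis imageI)
    consider "g = (0, 0)" | "g = (rat_class (a * b), rat_class a)" | "g = (rat_class (- a), rat_class (- a * (b - a)))" | "g = (rat_class (- b), rat_class (a - b))"
      | x where "x \<noteq> 0" "x + a \<noteq> 0" "x + b \<noteq> 0" "rat_class x + rat_class (x + a) + rat_class (x + b) = 0" "g = (rat_class x, rat_class (x + a))"
      using g unfolding kummer_image_def by blast
    then show "g \<in> C.kummer ` C.E"
    proof cases
      case 1 then show ?thesis using 0 by simp
    next
      case 2 then show ?thesis using tor[of 0] ab by (simp only: kr) simp
    next
      case 3 then show ?thesis using tor[of "- a"] ab by (simp only: kr) simp
    next
      case 4 then show ?thesis using tor[of "- b"] ab by (simp only: kr) simp
    next
      case 5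
      then have "rat_class (x * (x + a) * (x + b)) = 0" by (simp add: rat_class_mult)
      then obtain s where s: "s \<in> carrier R" "s \<otimes> s = \<iota> (x * (x + a) * (x + b))" using rat_class_eq_0[of "x * (x + a) * (x + b)"] 5 by auto
      have "C.kummer (Some (\<iota> x, s)) = g" using 5 by (simp only: kr) simp
      then show ?thesis using imageI[OF pt[OF s], of C.kummer] by simp
    qed
  qed
qed

theorem local_delta_eq:
  assumes ab: "a2 = a + b" "a4 = a * b" "a \<noteq> 0" "b \<noteq> 0" "a \<noteq> b" and d: "d \<noteq> 0"
    and emb: "\<And>k. emb k = \<iota> (of_int k)"
  shows "local_delta R emb a2 a4 d = (if rat_class (of_int d) = 0 then 0
    else log 2 (real (card ((\<lambda>g. (+) g ` kummer_image rat_class (of_int (d * a)) (of_int (d * b))) ` kummer_image rat_class (of_int a) (of_int b)))))"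
proof (cases "rat_class (of_int d) = 0")
  case True
  then have "\<exists>s\<in>carrier R. s \<otimes> s = emb d" using rat_class_eq_0[of "of_int d"] d by (simp add: emb)
  then show ?thesis using True by (simp add: local_delta_def)
next
  case False
  then have ns: "\<not> (\<exists>s\<in>carrier R. s \<otimes> s = emb d)" using rat_class_eq_0[of "of_int d"] d by (simp add: emb)
  interpret C: elliptic_curve R cl "\<iota> (of_int a)" "\<iota> (of_int b)" using curve_\<iota> ab by simp
  interpret C: quadratic_twist_curve R cl "\<iota> (of_int a)" "\<iota> (of_int b)" "\<iota> (of_int d)"
    by unfold_locales (use ns emb in auto)
  have "C.tw.kummer ` C.tw.E = kummer_image rat_class (of_int (d * a)) (of_int (d * b))"
    using kummer_image_eq[of "of_int (d * a)" "of_int (d * b)"] ab d by (simp add: \<iota>_mult)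
  moreover have "C.kummer ` C.E = kummer_image rat_class (of_int a) (of_int b)" using kummer_image_eq ab by simp
  ultimately show ?thesis
    using C.norm_index_eq ns False ab by (simp add: local_delta_def emb \<iota>_add \<iota>_mult)
qed

end

section \<open>The p-adic valuation\<close>

text \<open>x = l^N m / n with m and n prime to l, not necessarily in lowest terms, so that such
  forms can simply be multiplied.\<close>

definition unit_form :: "nat \<Rightarrow> rat \<Rightarrow> int \<Rightarrow> int \<Rightarrow> int \<Rightarrow> bool" where
  "unit_form l x N m n \<longleftrightarrow> \<not> int l dvd m \<and> \<not> int l dvd n \<and> x * of_int n = of_nat l powi N * of_int m"

definition val_ge :: "nat \<Rightarrow> int \<Rightarrow> rat \<Rightarrow> bool" where
  "val_ge l N x \<longleftrightarrow> x = 0 \<or> N \<le> padic_val_rat l x"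

locale prime_place =
  fixes l :: nat
  assumes l_prime: "prime l"
begin

lemma l_pos [simp]: "0 < l" "l \<noteq> 0" "(of_nat l :: rat) \<noteq> 0"
  using prime_gt_0_nat[OF l_prime] by auto

lemma pl: "prime (int l)" using l_prime by simp

lemma dvd_mult_l: "int l dvd m * n \<longleftrightarrow> int l dvd m \<or> int l dvd n"
  using pl prime_dvd_mult_iff by blast

lemma unit_form_nz: "unit_form l x N m n \<Longrightarrow> x \<noteq> 0 \<and> m \<noteq> 0 \<and> n \<noteq> 0"
  unfolding unit_form_def by (auto simp: power_int_eq_0_iff)

lemma int_split:
  assumes "a \<noteq> (0::int)"
  obtains u where "a = int l ^ multiplicity (int l) a * u" "\<not> int l dvd u"
proof -
  have "\<not> is_unit (int l)" using pl not_prime_unit by blast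
  then show ?thesis using multiplicity_decompose'[of a "int l"] assms that by metis
qed

lemma unit_form_quotient:
  assumes "x \<noteq> 0"
  obtains m n where "unit_form l x (padic_val_rat l x) m n"
proof -
  obtain a b where ab: "quotient_of x = (a, b)" by force
  have x: "x = of_int a / of_int b" and b: "b > 0" using quotient_of_div[OF ab] quotient_of_denom_pos[OF ab] by auto
  have a: "a \<noteq> 0" using x assms by auto
  obtain u where u: "a = int l ^ multiplicity (int l) a * u" "\<not> int l dvd u" using int_split[OF a] .
  obtain v where v: "b = int l ^ multiplicity (int l) b * v" "\<not> int l dvd v" using int_split[of b] b by auto
  define i j where "i = multiplicity (int l) a" and "j = multiplicity (int l) b"
  have "x * of_int v = of_nat l powi (int i - int j) * of_int u"
  proof -
    have ra: "(of_int a :: rat) = of_nat l ^ i * of_int u" using arg_cong[OF u(1), of "of_int :: int \<Rightarrow> rat"] by (simp add: i_def)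
    have rb: "(of_int b :: rat) = of_nat l ^ j * of_int v" using arg_cong[OF v(1), of "of_int :: int \<Rightarrow> rat"] by (simp add: j_def)
    have "v \<noteq> 0" using v by auto
    then show ?thesis unfolding x ra rb by (simp add: power_int_diff)
  qed
  then have "unit_form l x (padic_val_rat l x) u v"
    using u v by (simp add: unit_form_def padic_val_rat_def ab i_def j_def)
  then show ?thesis using that by blast
qed

lemma powi_eq_imp:
  assumes "of_nat l powi N * (of_int m :: rat) = of_nat l powi N' * of_int m'" "\<not> int l dvd m" "\<not> int l dvd m'"
  shows "N = N' \<and> m = m'"
proof -
  have *: "M = M'" if e: "of_nat l powi M * (of_int k :: rat) = of_nat l powi M' * of_int k'" and "\<not> int l dvd k" "\<not> int l dvd k'" "M \<le> M'"
    for M M' k k'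
  proof (rule ccontr)
    assume "M \<noteq> M'"
    define j where "j = nat (M' - M - 1)"
    have gt: "M' = M + int (Suc j)" using \<open>M \<noteq> M'\<close> that(4) by (simp add: j_def)
    have "of_nat l powi M * (of_int k :: rat) = of_nat l powi M * (of_nat l powi int (Suc j) * of_int k')"
      using e unfolding gt by (simp add: power_int_add)
    then have "(of_int k :: rat) = of_nat l powi int (Suc j) * of_int k'" by simp
    then have "(of_int k :: rat) = of_int (int l ^ Suc j * k')" by (simp only: power_int_of_nat of_int_mult of_int_power of_int_of_nat_eq)
    then have "k = int l ^ Suc j * k'" by (simp only: of_int_eq_iff)
    then show False using that by simp
  qed
  have N: "N = N'" using *[OF assms] *[OF assms(1)[symmetric] assms(3,2)] by linarith
  then show ?thesis using assms(1) by simp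
qed

lemma unit_form_unique:
  assumes "unit_form l x N m n" "unit_form l x N' m' n'"
  shows "N = N' \<and> m * n' = m' * n"
proof -
  have "x * of_int (n * n') = of_nat l powi N * of_int (m * n')" "x * of_int (n * n') = of_nat l powi N' * of_int (m' * n)"
    using assms by (simp_all add: unit_form_def algebra_simps)
  then have "of_nat l powi N * (of_int (m * n') :: rat) = of_nat l powi N' * of_int (m' * n)" by (simp only:)
  then show ?thesis using powi_eq_imp[of N "m * n'" N' "m' * n"] assms unfolding unit_form_def dvd_mult_l by blast
qed

lemma val_unit_form: "unit_form l x N m n \<Longrightarrow> padic_val_rat l x = N"
  using unit_form_quotient[of x] unit_form_nz unit_form_unique by metis

lemma unit_form_mult: "unit_form l x N m n \<Longrightarrow> unit_form l y N' m' n' \<Longrightarrow> unit_form l (x * y) (N + N') (m * m') (n * n')"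
  by (auto simp: unit_form_def dvd_mult_l power_int_add algebra_simps)

lemma unit_form_inverse: "unit_form l x N m n \<Longrightarrow> unit_form l (inverse x) (- N) n m"
  using unit_form_nz[of x N m n] by (auto simp: unit_form_def power_int_minus field_simps)

text \<open>Here m may be divisible by l or zero, so the form survives the addition of fractions;
  this is the source of the ultrametric inequality.\<close>

lemma val_ge_iff: "val_ge l N x \<longleftrightarrow> (\<exists>m n. \<not> int l dvd n \<and> x * of_int n = of_nat l powi N * of_int m)"
proof (cases "x = 0")
  case True
  then show ?thesis using pl not_prime_unit by (auto simp: val_ge_def intro!: exI[of _ 0] exI[of _ 1])
next
  case False
  obtain m0 n0 where f: "unit_form l x (padic_val_rat l x) m0 n0" using unit_form_quotient[OF False] .
  show ?thesis
  proof
    assume "val_ge l N x"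
    then have N: "N \<le> padic_val_rat l x" using False by (simp add: val_ge_def)
    define k where "k = nat (padic_val_rat l x - N)"
    have v: "padic_val_rat l x = N + int k" using N by (simp add: k_def)
    have "x * of_int n0 = of_nat l powi (N + int k) * of_int m0" using f unfolding unit_form_def v by blast
    then have "x * of_int n0 = of_nat l powi N * of_int (int l ^ k * m0)" by (simp add: power_int_add)
    then show "\<exists>m n. \<not> int l dvd n \<and> x * of_int n = of_nat l powi N * of_int m" using f unit_form_def by blast
  next
    assume "\<exists>m n. \<not> int l dvd n \<and> x * of_int n = of_nat l powi N * of_int m"
    then obtain m n where mn: "\<not> int l dvd n" "x * of_int n = of_nat l powi N * of_int m" by blast
    then have "m \<noteq> 0" using False by auto
    obtain u where u: "m = int l ^ multiplicity (int l) m * u" "\<not> int l dvd u" using int_split[OF \<open>m \<noteq> 0\<close>] .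
    have "unit_form l x (N + int (multiplicity (int l) m)) u n"
    proof -
      define j where "j = multiplicity (int l) m"
      have "(of_int m :: rat) = of_nat l ^ j * of_int u"
        using arg_cong[OF u(1), of "of_int :: int \<Rightarrow> rat"] by (simp add: j_def)
      then show ?thesis using mn u(2) unfolding unit_form_def j_def[symmetric] by (simp add: power_int_add)
    qed
    then show "val_ge l N x" using val_unit_form by (simp add: val_ge_def)
  qed
qed

lemma val_ge_0 [simp]: "val_ge l N 0" by (simp add: val_ge_def)

lemma val_ge_mono: "val_ge l N x \<Longrightarrow> M \<le> N \<Longrightarrow> val_ge l M x" by (auto simp: val_ge_def)

lemma val_ge_add: "val_ge l N x \<Longrightarrow> val_ge l N y \<Longrightarrow> val_ge l N (x + y)"
proof -
  assume "val_ge l N x" "val_ge l N y"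
  then obtain m n m' n' where "\<not> int l dvd n" "x * of_int n = of_nat l powi N * of_int m"
    "\<not> int l dvd n'" "y * of_int n' = of_nat l powi N * of_int m'" by (auto simp: val_ge_iff)
  moreover have "(x + y) * of_int (n * n') = (x * of_int n) * of_int n' + (y * of_int n') * of_int n"
    by (simp add: algebra_simps)
  ultimately have "\<not> int l dvd n * n' \<and> (x + y) * of_int (n * n') = of_nat l powi N * of_int (m * n' + m' * n)"
    by (simp add: dvd_mult_l algebra_simps)
  then show ?thesis unfolding val_ge_iff by blast
qed

lemma val_ge_minus: "val_ge l N (- x) \<longleftrightarrow> val_ge l N x"
proof -
  have "val_ge l N (- x)" if h: "val_ge l N x" for x
  proof -
    obtain m n where "\<not> int l dvd n" "x * of_int n = of_nat l powi N * of_int m" using h by (auto simp: val_ge_iff)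
    then have "\<not> int l dvd n \<and> - x * of_int n = of_nat l powi N * of_int (- m)" by simp
    then show ?thesis unfolding val_ge_iff by blast
  qed
  from this[of x] this[of "- x"] show ?thesis by auto
qed

lemma val_ge_diff: "val_ge l N x \<Longrightarrow> val_ge l N y \<Longrightarrow> val_ge l N (x - y)"
  using val_ge_add[of N x "- y"] by (simp add: val_ge_minus)

lemma val_ge_mult: "val_ge l N x \<Longrightarrow> val_ge l M y \<Longrightarrow> val_ge l (N + M) (x * y)"
proof -
  assume "val_ge l N x" "val_ge l M y"
  then obtain m n m' n' where "\<not> int l dvd n" "x * of_int n = of_nat l powi N * of_int m"
    "\<not> int l dvd n'" "y * of_int n' = of_nat l powi M * of_int m'" by (auto simp: val_ge_iff)
  moreover have "(x * y) * of_int (n * n') = (x * of_int n) * (y * of_int n')"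
    by (simp add: algebra_simps)
  ultimately have "\<not> int l dvd n * n' \<and> (x * y) * of_int (n * n') = of_nat l powi (N + M) * of_int (m * m')"
    by (simp add: dvd_mult_l power_int_add algebra_simps)
  then show ?thesis unfolding val_ge_iff by blast
qed

lemma not_dvd_1: "\<not> int l dvd 1"
  using pl not_prime_unit by blast

lemma val_ge_of_int: "val_ge l 0 (of_int k)"
proof -
  have "(of_int k :: rat) * of_int 1 = of_nat l powi 0 * of_int k" by simp
  then show ?thesis unfolding val_ge_iff using not_dvd_1 by blast
qed

lemma val_ge_exists: "\<exists>B. val_ge l B x"
  by (rule exI[of _ "padic_val_rat l x"]) (simp add: val_ge_def)

lemma val_ge_all_imp_0: "(\<And>N. val_ge l N x) \<Longrightarrow> x = 0"
  using val_ge_def[of l "padic_val_rat l x + 1" x] by auto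

lemma val_mult: "x \<noteq> 0 \<Longrightarrow> y \<noteq> 0 \<Longrightarrow> padic_val_rat l (x * y) = padic_val_rat l x + padic_val_rat l y"
  using unit_form_quotient[of x] unit_form_quotient[of y] unit_form_mult val_unit_form by metis

lemma val_inverse: "x \<noteq> 0 \<Longrightarrow> padic_val_rat l (inverse x) = - padic_val_rat l x"
  using unit_form_quotient[of x] unit_form_inverse val_unit_form by metis

lemma val_ge_inverse: "\<not> val_ge l N x \<Longrightarrow> val_ge l (- N) (inverse x)"
  by (auto simp: val_ge_def val_inverse)

lemma val_ge_dvd: "val_ge l (int c) (of_int k) \<longleftrightarrow> int l ^ c dvd k"
proof
  assume "val_ge l (int c) (of_int k)"
  then obtain m n where mn: "\<not> int l dvd n" "(of_int k :: rat) * of_int n = of_nat l powi (int c) * of_int m" by (auto simp: val_ge_iff)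
  then have "of_int (k * n) = (of_int (int l ^ c * m) :: rat)" by simp
  then have "k * n = int l ^ c * m" by (simp only: of_int_eq_iff)
  moreover have "coprime (int l ^ c) n" using mn pl by (metis coprime_power_left_iff prime_imp_coprime)
  ultimately show "int l ^ c dvd k" by (metis coprime_dvd_mult_left_iff dvd_triv_left)
next
  assume "int l ^ c dvd k"
  then obtain m where "k = int l ^ c * m" by blast
  then have "(of_int k :: rat) * of_int 1 = of_nat l powi (int c) * of_int m" by simp
  moreover have "\<not> int l dvd 1" using pl not_prime_unit by blast
  ultimately show "val_ge l (int c) (of_int k)" unfolding val_ge_iff by blast
qed

text \<open>The shift by one makes up for the strict inequalities in the definitions of null and
  Cauchy sequences.\<close>

lemma padic_abs_val_ge:
  shows "padic_abs l x < real l powr (- real_of_int N) \<Longrightarrow> val_ge l N x"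
    and "val_ge l (N + 1) x \<Longrightarrow> padic_abs l x < real l powr (- real_of_int N)"
  using prime_gt_1_nat[OF l_prime] by (cases "x = 0"; simp add: padic_abs_def val_ge_def)+

lemma small_powr: "e > 0 \<Longrightarrow> \<exists>N::int. real l powr (- real_of_int N) < e"
proof -
  assume e: "e > 0"
  have l1: "real l > 1" using prime_gt_1_nat[OF l_prime] by simp
  obtain N :: nat where "(1 / real l) ^ N < e" using real_arch_pow_inv[OF e, of "1 / real l"] l1 by auto
  then have "real l powr (- real N) < e" using l1 by (simp add: powr_minus powr_realpow power_one_over inverse_eq_divide)
  then show ?thesis by (intro exI[of _ "int N"]) simp
qed

section \<open>Null sequences and Cauchy sequences\<close>

lemma null_iff: "padic_null l X \<longleftrightarrow> (\<forall>N. \<exists>M. \<forall>m\<ge>M. val_ge l N (X m))"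
proof
  assume X: "padic_null l X"
  show "\<forall>N. \<exists>M. \<forall>m\<ge>M. val_ge l N (X m)"
  proof
    fix N :: int
    have "real l powr (- real_of_int N) > 0" by simp
    then obtain M where "\<forall>m\<ge>M. padic_abs l (X m) < real l powr (- real_of_int N)" using X unfolding padic_null_def by blast
    then show "\<exists>M. \<forall>m\<ge>M. val_ge l N (X m)" using padic_abs_val_ge(1) by blast
  qed
next
  assume X: "\<forall>N. \<exists>M. \<forall>m\<ge>M. val_ge l N (X m)"
  show "padic_null l X" unfolding padic_null_def
  proof (intro allI impI)
    fix e :: real assume "e > 0"
    then obtain N :: int where N: "real l powr (- real_of_int N) < e" using small_powr by blast
    obtain M where "\<forall>m\<ge>M. val_ge l (N + 1) (X m)" using X by blast
    then show "\<exists>N. \<forall>m\<ge>N. padic_abs l (X m) < e" using padic_abs_val_ge(2) N by (meson less_trans)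
  qed
qed

lemma cauchy_iff: "padic_cauchy l X \<longleftrightarrow> (\<forall>N. \<exists>M. \<forall>m\<ge>M. \<forall>k\<ge>M. val_ge l N (X m - X k))"
proof
  assume X: "padic_cauchy l X"
  show "\<forall>N. \<exists>M. \<forall>m\<ge>M. \<forall>k\<ge>M. val_ge l N (X m - X k)"
  proof
    fix N :: int
    have "real l powr (- real_of_int N) > 0" by simp
    then obtain M where "\<forall>m\<ge>M. \<forall>k\<ge>M. padic_abs l (X m - X k) < real l powr (- real_of_int N)" using X unfolding padic_cauchy_def by blast
    then show "\<exists>M. \<forall>m\<ge>M. \<forall>k\<ge>M. val_ge l N (X m - X k)" using padic_abs_val_ge(1) by blast
  qed
next
  assume X: "\<forall>N. \<exists>M. \<forall>m\<ge>M. \<forall>k\<ge>M. val_ge l N (X m - X k)"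
  show "padic_cauchy l X" unfolding padic_cauchy_def
  proof (intro allI impI)
    fix e :: real assume "e > 0"
    then obtain N :: int where N: "real l powr (- real_of_int N) < e" using small_powr by blast
    obtain M where "\<forall>m\<ge>M. \<forall>k\<ge>M. val_ge l (N + 1) (X m - X k)" using X by blast
    then show "\<exists>N. \<forall>m\<ge>N. \<forall>k\<ge>N. padic_abs l (X m - X k) < e" using padic_abs_val_ge(2) N by (meson less_trans)
  qed
qed

lemma null_add: "padic_null l X \<Longrightarrow> padic_null l Y \<Longrightarrow> padic_null l (\<lambda>n. X n + Y n)"
  unfolding null_iff by (metis (no_types, opaque_lifting) max.boundedE val_ge_add)

lemma null_minus: "padic_null l X \<Longrightarrow> padic_null l (\<lambda>n. - X n)"
  unfolding null_iff by (simp add: val_ge_minus)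

lemma cauchy_bounded:
  assumes "padic_cauchy l X"
  obtains B M where "\<And>m. m \<ge> M \<Longrightarrow> val_ge l B (X m)"
proof -
  obtain M where M: "\<forall>m\<ge>M. \<forall>k\<ge>M. val_ge l 0 (X m - X k)" using assms cauchy_iff by blast
  obtain B where B: "val_ge l B (X M)" using val_ge_exists by blast
  have "val_ge l (min 0 B) (X m)" if "m \<ge> M" for m
  proof -
    have "val_ge l (min 0 B) (X m - X M)" "val_ge l (min 0 B) (X M)"
      using M B that val_ge_mono by (meson le_refl min.cobounded1 min.cobounded2)+
    then show ?thesis using val_ge_add by fastforce
  qed
  then show ?thesis using that by blast
qed

lemma null_mult:
  assumes "padic_null l X" "padic_cauchy l Y"
  shows "padic_null l (\<lambda>n. X n * Y n)"
  unfolding null_iff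
proof
  fix N :: int
  obtain B M where B: "\<And>m. m \<ge> M \<Longrightarrow> val_ge l B (Y m)" using cauchy_bounded[OF assms(2)] by blast
  obtain M' where M': "\<forall>m\<ge>M'. val_ge l (N - B) (X m)" using assms(1) null_iff by blast
  have "val_ge l N (X m * Y m)" if "m \<ge> max M M'" for m
    using val_ge_mult[of "N - B" "X m" B "Y m"] M' B that by simp
  then show "\<exists>M. \<forall>m\<ge>M. val_ge l N (X m * Y m)" by blast
qed

lemma cauchy_const [simp]: "padic_cauchy l (\<lambda>_. r)"
  by (simp add: cauchy_iff)

lemma cauchy_add:
  assumes "padic_cauchy l X" "padic_cauchy l Y"
  shows "padic_cauchy l (\<lambda>n. X n + Y n)"
  unfolding cauchy_iff
proof
  fix N :: int
  obtain M M' where "\<forall>m\<ge>M. \<forall>k\<ge>M. val_ge l N (X m - X k)" "\<forall>m\<ge>M'. \<forall>k\<ge>M'. val_ge l N (Y m - Y k)"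
    using assms cauchy_iff by meson
  then have "val_ge l N ((X m + Y m) - (X k + Y k))" if "m \<ge> max M M'" "k \<ge> max M M'" for m k
    using val_ge_add[of N "X m - X k" "Y m - Y k"] that by (simp add: algebra_simps)
  then show "\<exists>M. \<forall>m\<ge>M. \<forall>k\<ge>M. val_ge l N ((X m + Y m) - (X k + Y k))" by blast
qed

lemma cauchy_minus: "padic_cauchy l X \<Longrightarrow> padic_cauchy l (\<lambda>n. - X n)"
  unfolding cauchy_iff by (metis (no_types, lifting) minus_diff_minus val_ge_minus)

lemma cauchy_mult:
  assumes "padic_cauchy l X" "padic_cauchy l Y"
  shows "padic_cauchy l (\<lambda>n. X n * Y n)"
  unfolding cauchy_iff
proof
  fix N :: int
  obtain B M where B: "\<And>m. m \<ge> M \<Longrightarrow> val_ge l B (Y m)" using cauchy_bounded[OF assms(2)] by blast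
  obtain B' M' where B': "\<And>m. m \<ge> M' \<Longrightarrow> val_ge l B' (X m)" using cauchy_bounded[OF assms(1)] by blast
  obtain M1 where M1: "\<forall>m\<ge>M1. \<forall>k\<ge>M1. val_ge l (N - B) (X m - X k)" using assms(1) cauchy_iff by blast
  obtain M2 where M2: "\<forall>m\<ge>M2. \<forall>k\<ge>M2. val_ge l (N - B') (Y m - Y k)" using assms(2) cauchy_iff by blast
  have "val_ge l N (X m * Y m - X k * Y k)" if "m \<ge> max (max M M') (max M1 M2)" "k \<ge> max (max M M') (max M1 M2)" for m k
  proof -
    have "val_ge l N ((X m - X k) * Y m)" "val_ge l N ((Y m - Y k) * X k)"
      using val_ge_mult[of "N - B" "X m - X k" B "Y m"] val_ge_mult[of "N - B'" "Y m - Y k" B' "X k"] M1 M2 B B' that by simp_all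
    then have "val_ge l N ((X m - X k) * Y m + (Y m - Y k) * X k)" by (rule val_ge_add)
    then show ?thesis by (simp add: algebra_simps)
  qed
  then show "\<exists>M. \<forall>m\<ge>M. \<forall>k\<ge>M. val_ge l N (X m * Y m - X k * Y k)" by blast
qed

text \<open>By the ultrametric inequality a single late term of valuation below N keeps all other
  late terms there.\<close>

lemma cauchy_nonnull:
  assumes "padic_cauchy l X" "\<not> padic_null l X"
  obtains N M where "\<And>m. m \<ge> M \<Longrightarrow> \<not> val_ge l N (X m)"
proof -
  obtain N where N: "\<And>M. \<exists>m\<ge>M. \<not> val_ge l N (X m)" using assms(2) null_iff by auto
  obtain M where M: "\<forall>m\<ge>M. \<forall>k\<ge>M. val_ge l N (X m - X k)" using assms(1) cauchy_iff by blast
  obtain k where k: "k \<ge> M" "\<not> val_ge l N (X k)" using N by blast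
  have "\<not> val_ge l N (X m)" if "m \<ge> M" for m
  proof
    assume "val_ge l N (X m)"
    then have "val_ge l N (X m - (X m - X k))" using M that k val_ge_diff by blast
    then show False using k by simp
  qed
  then show ?thesis using that by blast
qed

text \<open>Uses 1 / x - 1 / y = (y - x) / (x y) for terms bounded away from 0; finitely many early
  terms may be 0 and do not matter.\<close>

lemma cauchy_inverse:
  assumes "padic_cauchy l X" "\<not> padic_null l X"
  shows "padic_cauchy l (\<lambda>n. inverse (X n))"
  unfolding cauchy_iff
proof
  fix N :: int
  obtain B M where B: "\<And>m. m \<ge> M \<Longrightarrow> \<not> val_ge l B (X m)" using cauchy_nonnull[OF assms] by blast
  obtain M' where M': "\<forall>m\<ge>M'. \<forall>k\<ge>M'. val_ge l (N + B + B) (X m - X k)" using assms(1) cauchy_iff by blast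
  have "val_ge l N (inverse (X m) - inverse (X k))" if "m \<ge> max M M'" "k \<ge> max M M'" for m k
  proof -
    have nz: "X m \<noteq> 0" "X k \<noteq> 0" using B[of m] B[of k] that by auto
    have "val_ge l (- B + - B) (inverse (X m) * inverse (X k))" by (intro val_ge_mult val_ge_inverse B) (use that in auto)
    moreover have "val_ge l (N + B + B) (X k - X m)" using M' that by simp
    ultimately have "val_ge l ((N + B + B) + (- B + - B)) ((X k - X m) * (inverse (X m) * inverse (X k)))"
      by (rule val_ge_mult[rotated])
    moreover have "(X k - X m) * (inverse (X m) * inverse (X k)) = inverse (X m) - inverse (X k)"
      using nz by (simp add: field_simps)
    ultimately show ?thesis by simp
  qed
  then show "\<exists>M. \<forall>m\<ge>M. \<forall>k\<ge>M. val_ge l N (inverse (X m) - inverse (X k))" by blast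
qed

end

section \<open>The field of p-adic numbers\<close>

lemma of_int_bit_eq_0: "(of_int N :: bit) = 0 \<longleftrightarrow> even N"
  by (cases "even N") (auto elim!: evenE oddE)

context prime_place
begin

abbreviation cls where "cls \<equiv> padic_class l"

lemma null_zero [simp]: "padic_null l (\<lambda>_. 0)"
  by (simp add: null_iff)

lemma null_sym: "padic_null l (\<lambda>n. X n - Y n) \<Longrightarrow> padic_null l (\<lambda>n. Y n - X n)"
  using null_minus[of "\<lambda>n. X n - Y n"] by simp

lemma null_trans: "padic_null l (\<lambda>n. X n - Y n) \<Longrightarrow> padic_null l (\<lambda>n. Y n - Z n) \<Longrightarrow> padic_null l (\<lambda>n. X n - Z n)"
  using null_add[of "\<lambda>n. X n - Y n" "\<lambda>n. Y n - Z n"] by simp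

lemma cls_eq_iff:
  assumes "padic_cauchy l X" "padic_cauchy l Y"
  shows "cls X = cls Y \<longleftrightarrow> padic_null l (\<lambda>n. X n - Y n)"
proof
  assume e: "cls X = cls Y"
  have "Y \<in> cls Y" using assms by (simp add: padic_class_def)
  then have "Y \<in> cls X" by (simp only: e)
  then show "padic_null l (\<lambda>n. X n - Y n)" by (simp add: padic_class_def)
next
  assume h: "padic_null l (\<lambda>n. X n - Y n)"
  show "cls X = cls Y"
    unfolding padic_class_def using h null_sym[OF h] by (auto intro: null_trans)
qed

text \<open>The ring operations go through an arbitrarily chosen representative; choosing another
  one changes the sequence by a null sequence only.\<close>

lemma rep_cls:
  assumes "padic_cauchy l X"
  shows "padic_cauchy l (padic_rep (cls X))" "padic_null l (\<lambda>n. X n - padic_rep (cls X) n)"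
proof -
  have "X \<in> cls X" using assms by (simp add: padic_class_def)
  then have "padic_rep (cls X) \<in> cls X" unfolding padic_rep_def by (rule someI[of "\<lambda>Y. Y \<in> cls X"])
  then show "padic_cauchy l (padic_rep (cls X))" "padic_null l (\<lambda>n. X n - padic_rep (cls X) n)"
    by (auto simp: padic_class_def)
qed

lemma Qp_carrier: "carrier (Qp l) = cls ` {X. padic_cauchy l X}"
  by (simp add: Qp_def)

lemma Qp_add:
  assumes "padic_cauchy l X" "padic_cauchy l Y"
  shows "add (Qp l) (cls X) (cls Y) = cls (\<lambda>n. X n + Y n)"
proof -
  note r = rep_cls[OF assms(1)] rep_cls[OF assms(2)]
  have "cls (\<lambda>n. X n + Y n) = cls (\<lambda>n. padic_rep (cls X) n + padic_rep (cls Y) n)"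
    using null_add[OF r(2,4)] by (subst cls_eq_iff) (auto intro: cauchy_add assms r simp: algebra_simps)
  then show ?thesis by (simp add: Qp_def)
qed

lemma Qp_mult:
  assumes "padic_cauchy l X" "padic_cauchy l Y"
  shows "mult (Qp l) (cls X) (cls Y) = cls (\<lambda>n. X n * Y n)"
proof -
  note r = rep_cls[OF assms(1)] rep_cls[OF assms(2)]
  have "cls (\<lambda>n. X n * Y n) = cls (\<lambda>n. padic_rep (cls X) n * padic_rep (cls Y) n)"
  proof (subst cls_eq_iff)
    have "padic_null l (\<lambda>n. (X n - padic_rep (cls X) n) * Y n + (Y n - padic_rep (cls Y) n) * padic_rep (cls X) n)"
      by (intro null_add null_mult r assms)
    then show "padic_null l (\<lambda>n. X n * Y n - padic_rep (cls X) n * padic_rep (cls Y) n)"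
      by (simp add: algebra_simps)
  qed (intro cauchy_mult assms r)+
  then show ?thesis by (simp add: Qp_def)
qed

lemma Qp_one: "one (Qp l) = cls (\<lambda>_. 1)" and Qp_zero: "zero (Qp l) = cls (\<lambda>_. 0)"
  by (simp_all add: Qp_def)

lemma Qp_cring: "cring (Qp l)"
proof (rule cringI)
  have c: "cls X \<in> carrier (Qp l)" if "padic_cauchy l X" for X using that by (simp add: Qp_carrier)
  show "abelian_group (Qp l)"
  proof (rule abelian_groupI)
    fix x assume "x \<in> carrier (Qp l)"
    then obtain X where X: "padic_cauchy l X" "x = cls X" by (auto simp: Qp_carrier)
    show "\<exists>y\<in>carrier (Qp l). y \<oplus>\<^bsub>Qp l\<^esub> x = \<zero>\<^bsub>Qp l\<^esub>"
      by (rule bexI[of _ "cls (\<lambda>n. - X n)"]) (use X cauchy_minus in \<open>auto simp: Qp_add Qp_zero Qp_carrier\<close>)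
  qed (auto simp: Qp_carrier Qp_add Qp_zero cauchy_add ac_simps)
  show "comm_monoid (Qp l)"
    by (rule comm_monoidI) (auto simp: Qp_carrier Qp_mult Qp_one cauchy_mult ac_simps)
  fix x y z assume "x \<in> carrier (Qp l)" "y \<in> carrier (Qp l)" "z \<in> carrier (Qp l)"
  then show "(x \<oplus>\<^bsub>Qp l\<^esub> y) \<otimes>\<^bsub>Qp l\<^esub> z = x \<otimes>\<^bsub>Qp l\<^esub> z \<oplus>\<^bsub>Qp l\<^esub> y \<otimes>\<^bsub>Qp l\<^esub> z"
    by (auto simp: Qp_carrier Qp_mult Qp_add cauchy_mult cauchy_add algebra_simps)
qed

lemma cls_const_eq: "cls (\<lambda>_. r) = cls (\<lambda>_. s) \<longleftrightarrow> r = s"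
proof -
  have "padic_null l (\<lambda>_. r - s) \<longleftrightarrow> r = s" using val_ge_all_imp_0[of "r - s"] by (auto simp: null_iff)
  then show ?thesis by (simp add: cls_eq_iff)
qed

lemma Qp_field: "field (Qp l)"
proof -
  interpret cring "Qp l" by (rule Qp_cring)
  have ne: "\<one>\<^bsub>Qp l\<^esub> \<noteq> \<zero>\<^bsub>Qp l\<^esub>" by (simp add: Qp_one Qp_zero cls_const_eq)
  have inv: "x \<in> Units (Qp l)" if x: "x \<in> carrier (Qp l)" "x \<noteq> \<zero>\<^bsub>Qp l\<^esub>" for x
  proof -
    obtain X where X: "padic_cauchy l X" "x = cls X" using x by (auto simp: Qp_carrier)
    have nn: "\<not> padic_null l X" using x X cls_eq_iff[of X "\<lambda>_. 0"] by (simp add: Qp_zero)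
    note iX = cauchy_inverse[OF X(1) nn]
    obtain N M where NM: "\<And>m. m \<ge> M \<Longrightarrow> \<not> val_ge l N (X m)" using cauchy_nonnull[OF X(1) nn] by blast
    \<comment> \<open>This holds only eventually: an early term may be 0, and then its inverse is 0
      as well.\<close>
    have "X m * inverse (X m) - 1 = 0" if "m \<ge> M" for m
    proof -
      have "X m \<noteq> 0" using NM[OF that] val_ge_0 by metis
      then show ?thesis by simp
    qed
    then have "padic_null l (\<lambda>n. X n * inverse (X n) - 1)" unfolding null_iff by (metis val_ge_0)
    then have "cls (\<lambda>n. X n * inverse (X n)) = cls (\<lambda>_. 1)" using cauchy_mult[OF X(1) iX] by (simp add: cls_eq_iff)
    then have "x \<otimes>\<^bsub>Qp l\<^esub> cls (\<lambda>n. inverse (X n)) = \<one>\<^bsub>Qp l\<^esub>" using X iX by (simp add: Qp_mult Qp_one)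
    moreover have "cls (\<lambda>n. inverse (X n)) \<in> carrier (Qp l)" using iX by (simp add: Qp_carrier)
    ultimately show ?thesis
      using x m_comm[of x "cls (\<lambda>n. inverse (X n))"] unfolding Units_def by (simp add: bexI[of _ "cls (\<lambda>n. inverse (X n))"])
  qed
  have "\<zero>\<^bsub>Qp l\<^esub> \<notin> Units (Qp l)"
  proof
    assume u: "\<zero>\<^bsub>Qp l\<^esub> \<in> Units (Qp l)"
    then show False using Units_r_inv[OF u] l_null[OF Units_inv_closed[OF u]] ne by metis
  qed
  then have "Units (Qp l) = carrier (Qp l) - {\<zero>\<^bsub>Qp l\<^esub>}" using inv Units_closed by blast
  then show ?thesis by (rule cring_fieldI)
qed

lemma val_ge_1_unit:
  assumes "val_ge l 1 (s - 1)"
  shows "s \<noteq> 0" "padic_val_rat l s = 0"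
proof -
  have n1: "\<not> val_ge l 1 1" using val_ge_dvd[of 1 1] not_dvd_1 by simp
  have n: "\<not> val_ge l 1 s" using val_ge_diff[OF _ assms, of s] n1 by auto
  then show "s \<noteq> 0" by auto
  have "val_ge l 0 s" using val_ge_add[of 0 "s - 1" 1] val_ge_mono[OF assms] val_ge_of_int[of 1] by simp
  then show "padic_val_rat l s = 0" using n by (auto simp: val_ge_def)
qed

end

text \<open>The exponent c is what Hensel's lemma needs: units congruent to 1 modulo l^c are squares.\<close>
locale hensel_place = prime_place +
  fixes c :: nat and chi :: "int \<Rightarrow> 'h::ab_group_add"
  assumes c: "(l = 2 \<and> c = 3) \<or> (odd l \<and> c = 1)"
    and chi_mult: "\<not> int l dvd m \<Longrightarrow> \<not> int l dvd n \<Longrightarrow> chi (m * n) = chi m + chi n"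
    and chi_double: "\<not> int l dvd m \<Longrightarrow> chi m + chi m = 0"
    and chi_cong: "\<not> int l dvd m \<Longrightarrow> int l ^ c dvd m - n \<Longrightarrow> chi m = chi n"
    and chi_root: "\<not> int l dvd m \<Longrightarrow> chi m = 0 \<Longrightarrow> \<exists>s. int l ^ c dvd m - s * s"
begin

section \<open>Hensel's lemma and the square classes of Q_l\<close>

definition v2 :: int where "v2 = (if l = 2 then 1 else 0)"

lemma c_v2: "int c = 2 * v2 + 1" "v2 \<ge> 0" "c > 0"
  using c by (auto simp: v2_def)

lemma val_2: "padic_val_rat l 2 = v2"
proof (cases "l = 2")
  case True
  then have "unit_form l 2 1 1 1" by (simp add: unit_form_def)
  then have "padic_val_rat l 2 = 1" by (rule val_unit_form)
  moreover have "v2 = 1" unfolding v2_def using True by simp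
  ultimately show ?thesis by (simp only:)
next
  case False
  then have "odd l" using c by simp
  then have "\<not> int l dvd 2" using pl by (metis False l_prime of_nat_dvd_iff of_nat_numeral primes_dvd_imp_eq two_is_prime_nat)
  then have "unit_form l 2 0 2 1" using not_dvd_1 by (simp add: unit_form_def)
  then show ?thesis using val_unit_form False by (simp add: v2_def)
qed

text \<open>The Newton step s + e with e = (x - s^2) / (2 s) leaves the error e^2. Dividing by 2
  costs v2 digits, but 2 (c + k - v2) >= c + k + 1 because c = 2 v2 + 1. Keeping s congruent to 1
  modulo l^(v2 + 1) singles out one of the two roots.\<close>

lemma newton:
  assumes "val_ge l (int c) (x - 1)"
  shows "\<exists>s. val_ge l (int c + int k) (s * s - x) \<and> val_ge l (v2 + 1) (s - 1)"
proof (induction k)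
  case 0
  have "val_ge l (int c) (1 - x)" using assms val_ge_minus[of "int c" "x - 1"] by simp
  then show ?case by (intro exI[of _ 1]) simp
next
  case (Suc k)
  then obtain s where s: "val_ge l (int c + int k) (s * s - x)" "val_ge l (v2 + 1) (s - 1)" by blast
  have u: "s \<noteq> 0" "padic_val_rat l s = 0"
    using val_ge_1_unit[of s] val_ge_mono[OF s(2), of 1] c_v2 by auto
  define e where "e = (x - s * s) * inverse (2 * s)"
  have "padic_val_rat l (inverse (2 * s)) = - v2" using val_inverse[of "2 * s"] val_mult[of 2 s] u val_2 by simp
  then have "val_ge l (- v2) (inverse (2 * s))" by (simp add: val_ge_def)
  moreover have "val_ge l (int c + int k) (x - s * s)" using s(1) val_ge_minus[of _ "s * s - x"] by simp
  ultimately have e: "val_ge l ((int c + int k) + - v2) e" unfolding e_def by (intro val_ge_mult)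
  have "2 * s * e = x - s * s" unfolding e_def using u by (simp add: field_simps)
  then have "(s + e) * (s + e) - x = e * e" by (simp add: algebra_simps)
  moreover have "val_ge l (((int c + int k) + - v2) + ((int c + int k) + - v2)) (e * e)" using e by (intro val_ge_mult)
  ultimately have "val_ge l (int c + int (Suc k)) ((s + e) * (s + e) - x)"
    using val_ge_mono c_v2 by simp
  moreover have "val_ge l (v2 + 1) (s - 1 + e)"
    using val_ge_add[OF s(2)] val_ge_mono[OF e, of "v2 + 1"] c_v2 by simp
  ultimately show ?case by (intro exI[of _ "s + e"]) (simp add: algebra_simps)
qed

text \<open>Stated for Cauchy sequences and not only for constants, so that a limit can be compared
  with its terms. Each S m is a root of X m up to precision c + m. As all S m are near 1, S m + S k
  is close to 2, and S m - S k = (S m^2 - S k^2) / (S m + S k) is small.\<close>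

lemma hensel_seq:
  assumes X: "padic_cauchy l X" and M: "\<And>m. m \<ge> M \<Longrightarrow> val_ge l (int c) (X m - 1)"
  shows "\<exists>s\<in>carrier (Qp l). s \<otimes>\<^bsub>Qp l\<^esub> s = cls X"
proof -
  have "\<exists>s. m \<ge> M \<longrightarrow> val_ge l (int c + int m) (s * s - X m) \<and> val_ge l (v2 + 1) (s - 1)" for m
    using newton[OF M, of m m] by blast
  then obtain S where S: "\<And>m. m \<ge> M \<Longrightarrow> val_ge l (int c + int m) (S m * S m - X m) \<and> val_ge l (v2 + 1) (S m - 1)"
    by metis
  have inv: "val_ge l (- (v2 + 1)) (inverse (S m + S k))" "S m + S k \<noteq> 0" if "m \<ge> M" "k \<ge> M" for m k
  proof -
    have "\<not> val_ge l (v2 + 1) (S m + S k)"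
    proof
      assume "val_ge l (v2 + 1) (S m + S k)"
      then have "val_ge l (v2 + 1) (S m + S k - ((S m - 1) + (S k - 1)))"
        by (rule val_ge_diff[OF _ val_ge_add]) (use S[OF that(1)] S[OF that(2)] in auto)
      then show False using val_2 by (simp add: val_ge_def)
    qed
    then show "val_ge l (- (v2 + 1)) (inverse (S m + S k))" "S m + S k \<noteq> 0" using val_ge_inverse by (blast, auto)
  qed
  have SC: "padic_cauchy l S" unfolding cauchy_iff
  proof
    fix N :: int
    obtain M' where M': "\<forall>m\<ge>M'. \<forall>k\<ge>M'. val_ge l (N + v2 + 1) (X m - X k)" using X cauchy_iff by blast
    have "val_ge l N (S m - S k)" if m: "m \<ge> max (max M M') (nat (N + v2 + 1))" and k: "k \<ge> max (max M M') (nat (N + v2 + 1))" for m k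
    proof -
      have v: "val_ge l (N + v2 + 1) (S m * S m - X m)" "val_ge l (N + v2 + 1) (S k * S k - X k)"
        using S[of m] S[of k] m k by (auto intro: val_ge_mono)
      have "val_ge l (N + v2 + 1) (X m - X k)" using M' m k by simp
      then have "val_ge l (N + v2 + 1) ((S m * S m - X m) - (S k * S k - X k) + (X m - X k))"
        by (rule val_ge_add[OF val_ge_diff[OF v]])
      then have "val_ge l ((N + v2 + 1) + - (v2 + 1)) ((S m * S m - X m - (S k * S k - X k) + (X m - X k)) * inverse (S m + S k))"
        using inv m k by (intro val_ge_mult) auto
      moreover have "(S m * S m - X m - (S k * S k - X k) + (X m - X k)) * inverse (S m + S k) = S m - S k"
        using inv(2)[of m k] m k by (simp add: field_simps)
      ultimately show ?thesis by simp
    qed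
    then show "\<exists>M. \<forall>m\<ge>M. \<forall>k\<ge>M. val_ge l N (S m - S k)" by blast
  qed
  have "padic_null l (\<lambda>n. S n * S n - X n)" unfolding null_iff
  proof
    fix N :: int
    have "val_ge l N (S m * S m - X m)" if "m \<ge> max M (nat N)" for m
      using S[of m] that by (auto intro: val_ge_mono)
    then show "\<exists>M. \<forall>m\<ge>M. val_ge l N (S m * S m - X m)" by blast
  qed
  then have "cls S \<otimes>\<^bsub>Qp l\<^esub> cls S = cls X" using SC X cauchy_mult[OF SC SC] by (simp add: Qp_mult cls_eq_iff)
  moreover have "cls S \<in> carrier (Qp l)" using SC by (simp add: Qp_carrier)
  ultimately show ?thesis by blast
qed

text \<open>m and n are not unique, but m / n is. As the values of chi are killed by two, chi m +
  chi n is the class of this unit.\<close>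

definition rat_class :: "rat \<Rightarrow> bit \<times> 'h" where
  "rat_class x = (SOME g. \<exists>N m n. unit_form l x N m n \<and> g = (of_int N, chi m + chi n))"

lemma rat_class_unit_form:
  assumes "unit_form l x N m n"
  shows "rat_class x = (of_int N, chi m + chi n)"
proof -
  have "\<exists>N m n. unit_form l x N m n \<and> rat_class x = (of_int N, chi m + chi n)"
    unfolding rat_class_def by (rule someI_ex) (use assms in blast)
  then obtain N' m' n' where f: "unit_form l x N' m' n'" "rat_class x = (of_int N', chi m' + chi n')" by blast
  have u: "N = N'" "m * n' = m' * n" using unit_form_unique[OF assms f(1)] by auto
  have nd: "\<not> int l dvd m" "\<not> int l dvd n" "\<not> int l dvd m'" "\<not> int l dvd n'" using assms f by (auto simp: unit_form_def)
  have "chi m + chi n' = chi m' + chi n" using arg_cong[OF u(2), of chi] nd by (simp add: chi_mult)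
  then have "(chi m + chi n') + (chi n + chi n') = (chi m' + chi n) + (chi n + chi n')" by simp
  then have "chi m + chi n + (chi n' + chi n') = chi m' + chi n' + (chi n + chi n)" by (simp add: ac_simps)
  then have "chi m + chi n = chi m' + chi n'" using nd by (simp add: chi_double)
  then show ?thesis using f u by simp
qed

lemma rat_class_mult: "x \<noteq> 0 \<Longrightarrow> y \<noteq> 0 \<Longrightarrow> rat_class (x * y) = rat_class x + rat_class y"
proof -
  assume nz: "x \<noteq> 0" "y \<noteq> 0"
  obtain N m n where f: "unit_form l x N m n" using unit_form_quotient[OF nz(1)] by blast
  obtain N' m' n' where g: "unit_form l y N' m' n'" using unit_form_quotient[OF nz(2)] by blast
  have nd: "\<not> int l dvd m" "\<not> int l dvd n" "\<not> int l dvd m'" "\<not> int l dvd n'" using f g by (auto simp: unit_form_def)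
  show ?thesis
    unfolding rat_class_unit_form[OF f] rat_class_unit_form[OF g] rat_class_unit_form[OF unit_form_mult[OF f g]]
    using nd by (simp add: chi_mult ac_simps)
qed

lemma rat_class_double: "x \<noteq> 0 \<Longrightarrow> rat_class x + rat_class x = 0"
proof -
  assume nz: "x \<noteq> 0"
  obtain N m n where f: "unit_form l x N m n" using unit_form_quotient[OF nz(1)] by blast
  have nd: "\<not> int l dvd m" "\<not> int l dvd n" using f by (auto simp: unit_form_def)
  have "chi m + chi n + (chi m + chi n) = (chi m + chi m) + (chi n + chi n)" by (simp add: ac_simps)
  then show ?thesis using chi_double nd unfolding rat_class_unit_form[OF f] by (simp add: zero_prod_def)
qed

lemma rat_class_near_1:
  assumes "val_ge l (int c) (y - 1)"
  shows "rat_class y = 0"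
proof -
  have y: "y \<noteq> 0" "padic_val_rat l y = 0" using val_ge_1_unit[of y] val_ge_mono[OF assms, of 1] c_v2 by auto
  then obtain m n where f: "unit_form l y 0 m n" using unit_form_quotient[of y] by metis
  have "val_ge l (int c + 0) ((y - 1) * of_int n)" by (intro val_ge_mult assms val_ge_of_int)
  moreover have "(y - 1) * of_int n = of_int (m - n)" using f by (simp add: unit_form_def algebra_simps)
  ultimately have "int l ^ c dvd m - n" using val_ge_dvd[of c "m - n"] by simp
  then have "chi m = chi n" using chi_cong f by (auto simp: unit_form_def)
  then show ?thesis unfolding rat_class_unit_form[OF f] using f chi_double by (simp add: unit_form_def zero_prod_def)
qed

abbreviation \<iota> :: "rat \<Rightarrow> (nat \<Rightarrow> rat) set" where "\<iota> r \<equiv> cls (\<lambda>_. r)"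

lemma hensel_rat: "val_ge l (int c) (x - 1) \<Longrightarrow> \<exists>s\<in>carrier (Qp l). s \<otimes>\<^bsub>Qp l\<^esub> s = \<iota> x"
  by (rule hensel_seq) auto

lemma square_times:
  assumes "\<exists>s\<in>carrier (Qp l). s \<otimes>\<^bsub>Qp l\<^esub> s = cls X" "padic_cauchy l X"
  shows "\<exists>s\<in>carrier (Qp l). s \<otimes>\<^bsub>Qp l\<^esub> s = cls (\<lambda>n. X n * (r * r))"
proof -
  interpret field "Qp l" by (rule Qp_field)
  obtain s where s: "s \<in> carrier (Qp l)" "s \<otimes>\<^bsub>Qp l\<^esub> s = cls X" using assms by blast
  have r: "\<iota> r \<in> carrier (Qp l)" by (simp add: Qp_carrier)
  have "(s \<otimes>\<^bsub>Qp l\<^esub> \<iota> r) \<otimes>\<^bsub>Qp l\<^esub> (s \<otimes>\<^bsub>Qp l\<^esub> \<iota> r) = (s \<otimes>\<^bsub>Qp l\<^esub> s) \<otimes>\<^bsub>Qp l\<^esub> (\<iota> r \<otimes>\<^bsub>Qp l\<^esub> \<iota> r)"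
    using s(1) r by (simp add: m_ac)
  also have "\<dots> = cls (\<lambda>n. X n * (r * r))" unfolding s(2) using assms(2) by (simp add: Qp_mult)
  finally show ?thesis using s(1) r by (intro bexI[of _ "s \<otimes>\<^bsub>Qp l\<^esub> \<iota> r"]) auto
qed

lemma place_Qp: "place (Qp l) \<iota> rat_class"
proof -
  interpret field "Qp l" by (rule Qp_field)
  show ?thesis
  proof
    show "\<one>\<^bsub>Qp l\<^esub> \<oplus>\<^bsub>Qp l\<^esub> \<one>\<^bsub>Qp l\<^esub> \<noteq> \<zero>\<^bsub>Qp l\<^esub>"
      by (simp add: Qp_one Qp_zero Qp_add cls_const_eq)
    show "\<iota> x \<in> carrier (Qp l)" for x by (simp add: Qp_carrier)
    show "\<iota> (x + y) = \<iota> x \<oplus>\<^bsub>Qp l\<^esub> \<iota> y" for x y by (simp add: Qp_add)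
    show "\<iota> (x * y) = \<iota> x \<otimes>\<^bsub>Qp l\<^esub> \<iota> y" for x y by (simp add: Qp_mult)
    show "x = 0" if "\<iota> x = \<zero>\<^bsub>Qp l\<^esub>" for x using that by (simp add: Qp_zero cls_const_eq)
    show "rat_class (x * y) = rat_class x + rat_class y" if "x \<noteq> 0" "y \<noteq> 0" for x y using rat_class_mult that .
    show "rat_class x = 0 \<longleftrightarrow> (\<exists>s\<in>carrier (Qp l). s \<otimes>\<^bsub>Qp l\<^esub> s = \<iota> x)" if x: "x \<noteq> 0" for x
    proof
      assume x0: "rat_class x = 0"
      obtain N m n where f: "unit_form l x N m n" using unit_form_quotient[OF x] by blast
      have nd: "\<not> int l dvd m" "\<not> int l dvd n" using f by (auto simp: unit_form_def)
      have "even N" "chi (m * n) = 0"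
        using x0 nd unfolding rat_class_unit_form[OF f] by (auto simp: zero_prod_def chi_mult of_int_bit_eq_0)
      \<comment> \<open>Since x = l^(2 j) m / n and m n is congruent to s^2 modulo l^c, the number w
        = m n / s^2 is near 1, and x is w times the square of l^j s / n.\<close>
      then obtain j s where j: "N = 2 * j" and s: "int l ^ c dvd m * n - s * s"
        using chi_root[of "m * n"] nd by (auto simp: dvd_mult_l elim!: evenE)
      have sn: "\<not> int l dvd s"
      proof
        assume "int l dvd s"
        moreover have "int l dvd m * n - s * s" using s c_v2(3) by (meson dvd_power dvd_trans)
        ultimately have "int l dvd m * n" by (metis dvd_add dvd_mult diff_add_cancel)
        then show False using nd dvd_mult_l by blast
      qed
      then have s0: "s \<noteq> 0" by auto
      define w where "w = of_int (m * n) / (of_int (s * s) :: rat)"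
      have "unit_form l (of_int (s * s)) 0 (s * s) 1" using sn not_dvd_1 by (simp add: unit_form_def dvd_mult_l)
      then have "padic_val_rat l (inverse (of_int (s * s))) = 0" using unit_form_inverse val_unit_form by fastforce
      then have "val_ge l 0 (inverse (of_int (s * s)))" by (simp add: val_ge_def)
      moreover have "val_ge l (int c) (of_int (m * n - s * s))" using s val_ge_dvd by blast
      ultimately have "val_ge l (int c + 0) (of_int (m * n - s * s) * inverse (of_int (s * s)))" by (intro val_ge_mult)
      moreover have "of_int (m * n - s * s) * inverse (of_int (s * s)) = w - 1"
        unfolding w_def using s0 by (simp add: field_simps)
      ultimately have "val_ge l (int c) (w - 1)" by simp
      then have sq: "\<exists>t\<in>carrier (Qp l). t \<otimes>\<^bsub>Qp l\<^esub> t = \<iota> w" by (rule hensel_rat)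
      have "x = w * ((of_nat l powi j * of_int s / of_int n) * (of_nat l powi j * of_int s / of_int n))"
      proof -
        have n0: "n \<noteq> 0" using nd by auto
        have "x = of_nat l powi N * of_int m / of_int n" using f n0 by (simp add: unit_form_def field_simps)
        also have "of_nat l powi N = (of_nat l powi j * of_nat l powi j :: rat)" unfolding j by (simp flip: power_int_add)
        finally show ?thesis using n0 s0 by (simp add: w_def field_simps)
      qed
      then show "\<exists>s\<in>carrier (Qp l). s \<otimes>\<^bsub>Qp l\<^esub> s = \<iota> x"
        using square_times[OF sq, of "of_nat l powi j * of_int s / of_int n"] by simp
    next
      assume "\<exists>s\<in>carrier (Qp l). s \<otimes>\<^bsub>Qp l\<^esub> s = \<iota> x"
      then obtain S where S: "padic_cauchy l S" "cls S \<otimes>\<^bsub>Qp l\<^esub> cls S = \<iota> x" by (auto simp: Qp_carrier)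
      then have "padic_null l (\<lambda>n. S n * S n - x)" using cauchy_mult[OF S(1) S(1)] by (simp add: Qp_mult cls_eq_iff)
      \<comment> \<open>One late term of a sequence representing the root suffices: its square
        divided by x is near 1 and so has trivial class.\<close>
      then obtain m where m: "val_ge l (int c + padic_val_rat l x) (S m * S m - x)" unfolding null_iff by (metis le_refl)
      have "val_ge l (- padic_val_rat l x) (inverse x)" using val_inverse[OF x] by (simp add: val_ge_def)
      then have "val_ge l (int c + padic_val_rat l x + - padic_val_rat l x) ((S m * S m - x) * inverse x)" using m by (intro val_ge_mult)
      moreover have "(S m * S m - x) * inverse x = S m * S m * inverse x - 1" using x by (simp add: field_simps)
      ultimately have v: "val_ge l (int c) (S m * S m * inverse x - 1)" by simp
      have "val_ge l 1 (S m * S m * inverse x - 1)" by (rule val_ge_mono[OF v]) (use c_v2 in simp)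
      then have "S m * S m * inverse x \<noteq> 0" by (rule val_ge_1_unit(1))
      then have S0: "S m \<noteq> 0" by auto
      have "S m * S m = S m * S m * inverse x * x" using x by (simp add: field_simps)
      then have "rat_class (S m * S m) = rat_class (S m * S m * inverse x * x)" by (simp only:)
      also have "\<dots> = rat_class x" using rat_class_near_1[OF v] x S0 by (simp add: rat_class_mult)
      finally show "rat_class x = 0" using S0 rat_class_double by (simp add: rat_class_mult)
    qed
    show "\<exists>x. \<forall>c\<in>C. x + c \<noteq> 0 \<and> (\<exists>s\<in>carrier (Qp l). s \<otimes>\<^bsub>Qp l\<^esub> s = (z \<oplus>\<^bsub>Qp l\<^esub> \<iota> c) \<otimes>\<^bsub>Qp l\<^esub> \<iota> (x + c))"
      if z: "z \<in> carrier (Qp l)" and C: "finite C" and nz: "\<And>c. c \<in> C \<Longrightarrow> z \<oplus>\<^bsub>Qp l\<^esub> \<iota> c \<noteq> \<zero>\<^bsub>Qp l\<^esub>" for z C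
    proof -
      obtain X where X: "padic_cauchy l X" "z = cls X" using z by (auto simp: Qp_carrier)
      \<comment> \<open>For late m and k the quotients (X k + r) / (X m + r) are near 1, so their
        limit in k is a square and X m + r has the class of z + r. Finiteness of C then allows one m
        for all r.\<close>
      have "\<exists>M. \<forall>m\<ge>M. X m + r \<noteq> 0 \<and> (\<exists>s\<in>carrier (Qp l). s \<otimes>\<^bsub>Qp l\<^esub> s = (z \<oplus>\<^bsub>Qp l\<^esub> \<iota> r) \<otimes>\<^bsub>Qp l\<^esub> \<iota> (X m + r))" if r: "r \<in> C" for r
      proof -
        have Xr: "padic_cauchy l (\<lambda>n. X n + r)" using cauchy_add[OF X(1)] by simp
        have nn: "\<not> padic_null l (\<lambda>n. X n + r)"
          using nz[OF r] X Xr cls_eq_iff[of "\<lambda>n. X n + r" "\<lambda>_. 0"] by (simp add: Qp_add Qp_zero)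
        obtain B M where B: "\<And>m. m \<ge> M \<Longrightarrow> \<not> val_ge l B (X m + r)" using cauchy_nonnull[OF Xr nn] by blast
        obtain M' where M': "\<forall>m\<ge>M'. \<forall>k\<ge>M'. val_ge l (int c + B) (X m - X k)" using X(1) cauchy_iff by blast
        have "X m + r \<noteq> 0 \<and> (\<exists>s\<in>carrier (Qp l). s \<otimes>\<^bsub>Qp l\<^esub> s = (z \<oplus>\<^bsub>Qp l\<^esub> \<iota> r) \<otimes>\<^bsub>Qp l\<^esub> \<iota> (X m + r))"
          if m: "m \<ge> max M M'" for m
        proof -
          have nz: "X m + r \<noteq> 0" using B[of m] m by auto
          have Yc: "padic_cauchy l (\<lambda>k. (X k + r) * inverse (X m + r))" using cauchy_mult[OF Xr] by simp
          have "val_ge l (int c) ((X k + r) * inverse (X m + r) - 1)" if k: "k \<ge> max M M'" for k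
          proof -
            have "val_ge l ((int c + B) + - B) ((X k - X m) * inverse (X m + r))"
              using M' k m B[of m] by (intro val_ge_mult val_ge_inverse) auto
            moreover have "(X k - X m) * inverse (X m + r) = (X k + r) * inverse (X m + r) - 1"
              using nz by (simp add: field_simps)
            ultimately show ?thesis by simp
          qed
          then have sq: "\<exists>s\<in>carrier (Qp l). s \<otimes>\<^bsub>Qp l\<^esub> s = cls (\<lambda>k. (X k + r) * inverse (X m + r))"
            using hensel_seq[OF Yc] by blast
          have "\<exists>s\<in>carrier (Qp l). s \<otimes>\<^bsub>Qp l\<^esub> s = cls (\<lambda>k. (X k + r) * (X m + r))"
          proof -
            have "(X k + r) * inverse (X m + r) * ((X m + r) * (X m + r)) = (X k + r) * (X m + r)" for k
              using nz by (simp add: field_simps)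
            then show ?thesis using square_times[OF sq Yc, of "X m + r"] by (simp only:)
          qed
          then show ?thesis using nz X Xr by (simp add: Qp_add Qp_mult)
        qed
        then show ?thesis by blast
      qed
      then have "\<forall>r\<in>C. \<forall>\<^sub>F m in sequentially. X m + r \<noteq> 0 \<and> (\<exists>s\<in>carrier (Qp l). s \<otimes>\<^bsub>Qp l\<^esub> s = (z \<oplus>\<^bsub>Qp l\<^esub> \<iota> r) \<otimes>\<^bsub>Qp l\<^esub> \<iota> (X m + r))"
        unfolding eventually_sequentially by blast
      then have "\<forall>\<^sub>F m in sequentially. \<forall>r\<in>C. X m + r \<noteq> 0 \<and> (\<exists>s\<in>carrier (Qp l). s \<otimes>\<^bsub>Qp l\<^esub> s = (z \<oplus>\<^bsub>Qp l\<^esub> \<iota> r) \<otimes>\<^bsub>Qp l\<^esub> \<iota> (X m + r))"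
        using C by (intro eventually_ball_finite) auto
      then show ?thesis unfolding eventually_sequentially by blast
    qed
  qed
qed

end

section \<open>Odd primes\<close>

text \<open>Adding classes requires no formula for rational abscissas: both classes come from points
  over R, and the sum of the points has the sum of the classes.\<close>

lemma (in place) kummer_image_add:
  assumes ab: "a \<noteq> 0" "b \<noteq> 0" "a \<noteq> b" and g: "g \<in> kummer_image rat_class a b" and h: "h \<in> kummer_image rat_class a b"
  shows "g + h \<in> kummer_image rat_class a b"
proof -
  interpret C: elliptic_curve R cl "\<iota> a" "\<iota> b" by (rule curve_\<iota>[OF ab])
  obtain P Q where PQ: "P \<in> C.E" "Q \<in> C.E" "g = C.kummer P" "h = C.kummer Q"
    using g h unfolding kummer_image_eq[OF ab, symmetric] by (auto elim!: imageE)
  then have "g + h = C.kummer (C.pls P Q)" "C.pls P Q \<in> C.E" using C.kummer_add by auto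
  then show ?thesis unfolding kummer_image_eq[OF ab, symmetric] by (metis imageI)
qed

lemma bit_double [simp]: "(x::bit) + x = 0"
  by (cases x) auto

context prime_place
begin

lemma val_add_less:
  assumes "x \<noteq> 0" "val_ge l (padic_val_rat l x + 1) y"
  shows "x + y \<noteq> 0" "padic_val_rat l (x + y) = padic_val_rat l x"
proof -
  have n: "\<not> val_ge l (padic_val_rat l x + 1) (x + y)"
  proof
    assume "val_ge l (padic_val_rat l x + 1) (x + y)"
    then have "val_ge l (padic_val_rat l x + 1) (x + y - y)" using assms val_ge_diff by blast
    then show False using assms by (simp add: val_ge_def)
  qed
  then show "x + y \<noteq> 0" by auto
  have "val_ge l (padic_val_rat l x) (x + y)"
    using val_ge_add[of "padic_val_rat l x" x y] val_ge_mono[OF assms(2)] by (simp add: val_ge_def)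
  then show "padic_val_rat l (x + y) = padic_val_rat l x" using n by (auto simp: val_ge_def)
qed

lemma val_of_int_unit: "\<not> int l dvd m \<Longrightarrow> padic_val_rat l (of_int m) = 0"
  by (rule val_unit_form[of _ _ m 1]) (use not_dvd_1 in \<open>simp add: unit_form_def\<close>)

end

context hensel_place
begin

lemma fst_rat_class: "x \<noteq> 0 \<Longrightarrow> fst (rat_class x) = of_int (padic_val_rat l x)"
  using unit_form_quotient[of x] rat_class_unit_form by (metis fst_conv)

lemma fst_rat_class_0: "x \<noteq> 0 \<Longrightarrow> fst (rat_class x) = 0 \<longleftrightarrow> even (padic_val_rat l x)"
  using of_int_bit_eq_0 by (simp add: fst_rat_class)

lemma chi_1: "chi 1 = 0"
  using chi_mult[of 1 1] not_dvd_1 by simp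

lemma rat_class_unit: "\<not> int l dvd m \<Longrightarrow> rat_class (of_int m) = (0, chi m)"
  using rat_class_unit_form[of "of_int m" 0 m 1] not_dvd_1 chi_1 by (simp add: unit_form_def)

text \<open>x + y is x times 1 + y / x, and the second factor is near enough to 1 to have trivial
  class.\<close>

lemma rat_class_add_close:
  assumes "x \<noteq> 0" "val_ge l (padic_val_rat l x + int c) y"
  shows "x + y \<noteq> 0" "rat_class (x + y) = rat_class x"
proof -
  have "val_ge l (- padic_val_rat l x) (inverse x)" using assms val_inverse by (simp add: val_ge_def)
  then have "val_ge l (padic_val_rat l x + int c + - padic_val_rat l x) (y * inverse x)" using assms by (intro val_ge_mult)
  moreover have "y * inverse x = (x + y) * inverse x - 1" using assms by (simp add: field_simps)
  ultimately have v: "val_ge l (int c) ((x + y) * inverse x - 1)" by simp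
  show nz: "x + y \<noteq> 0" by (rule val_add_less[OF assms(1) val_ge_mono[OF assms(2)]]) (use c_v2 in simp)
  have e: "x + y = x * ((x + y) * inverse x)" using assms by (simp add: field_simps)
  have "rat_class (x * ((x + y) * inverse x)) = rat_class x + rat_class ((x + y) * inverse x)" by (rule rat_class_mult) (use nz assms in auto)
  then show "rat_class (x + y) = rat_class x" using rat_class_near_1[OF v] e by simp
qed

text \<open>Applied when x dominates a and b: the three factors then share one class, and their
  product being a square makes it trivial.\<close>

lemma rat_class_triple: "x \<noteq> 0 \<Longrightarrow> rat_class x + rat_class x + rat_class x = 0 \<Longrightarrow> rat_class x = 0"
  using rat_class_double[of x] by simp

end

text \<open>The quadratic character written additively. Multiples of l also get the value 1, so it
  is multiplicative only away from them.\<close>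

definition qchi :: "nat \<Rightarrow> int \<Rightarrow> bit" where
  "qchi l m = (if Legendre m (int l) = 1 then 0 else 1)"

text \<open>By Euler's criterion both sides are congruent modulo l, and they differ by at most 2 <
  l.\<close>

lemma Legendre_mult:
  assumes "prime l" "odd l"
  shows "Legendre (m * n) (int l) = Legendre m (int l) * Legendre n (int l)"
proof -
  have l2: "2 < l" using assms prime_ge_2_nat[of l] by (metis le_neq_implies_less even_numeral)
  note E = euler_criterion[OF assms(1) l2]
  have "[Legendre (m * n) (int l) = (m * n) ^ ((l - 1) div 2)] (mod int l)" by (rule E)
  also have "(m * n) ^ ((l - 1) div 2) = m ^ ((l - 1) div 2) * n ^ ((l - 1) div 2)" by (rule power_mult_distrib)
  also have "[m ^ ((l - 1) div 2) * n ^ ((l - 1) div 2) = Legendre m (int l) * Legendre n (int l)] (mod int l)"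
    by (intro cong_mult; rule cong_sym; rule E)
  finally have c: "int l dvd Legendre (m * n) (int l) - Legendre m (int l) * Legendre n (int l)"
    by (simp add: cong_iff_dvd_diff)
  have "\<bar>Legendre (m * n) (int l) - Legendre m (int l) * Legendre n (int l)\<bar> \<le> 2"
    by (auto simp: Legendre_def)
  then show ?thesis using c l2 zdvd_imp_le[of "int l" "\<bar>Legendre (m * n) (int l) - Legendre m (int l) * Legendre n (int l)\<bar>"] by auto
qed

lemma qchi_cong:
  assumes "int l dvd m - n" shows "qchi l m = qchi l n"
proof -
  have "[m = n] (mod int l)" using assms by (simp add: cong_iff_dvd_diff)
  then have "[m = 0] (mod int l) \<longleftrightarrow> [n = 0] (mod int l)" "\<And>y. [y\<^sup>2 = m] (mod int l) \<longleftrightarrow> [y\<^sup>2 = n] (mod int l)"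
    using cong_trans cong_sym by blast+
  then show ?thesis by (simp add: qchi_def Legendre_def QuadRes_def)
qed

lemma qchi_root:
  assumes "\<not> int l dvd m" shows "qchi l m = 0 \<longleftrightarrow> (\<exists>s. int l dvd m - s * s)"
proof -
  have "(\<exists>s. int l dvd m - s * s) \<longleftrightarrow> QuadRes (int l) m"
    unfolding QuadRes_def by (simp add: cong_iff_dvd_diff power2_eq_square dvd_diff_commute)
  moreover have "\<not> [m = 0] (mod int l)" using assms by (simp add: cong_0_iff)
  ultimately show ?thesis by (simp add: qchi_def Legendre_def)
qed

section \<open>Reduction modulo an odd prime\<close>

locale odd_place = prime_place +
  assumes l_odd: "odd l"
begin

lemma qchi_mult: "\<not> int l dvd m \<Longrightarrow> \<not> int l dvd n \<Longrightarrow> qchi l (m * n) = qchi l m + qchi l n"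
  using Legendre_mult[OF l_prime l_odd, of m n] by (auto simp: qchi_def Legendre_def cong_0_iff)

sublocale hensel_place l 1 "qchi l"
  by unfold_locales (use l_odd qchi_mult qchi_root in \<open>auto intro: qchi_cong\<close>)

lemma val_ge_1_of_int: "val_ge l 1 (of_int k) \<longleftrightarrow> int l dvd k"
  using val_ge_dvd[of 1 k] by simp

text \<open>There are only four pairs of classes over the residue field, so by
  \<open>card_kummer_ge_4\<close> all of them occur on the reduced curve. The abscissa of a point
  found there, read as an integer, has the same classes over Q_l; if a factor vanishes modulo l, the
  torsion point at the corresponding root is taken instead.\<close>

lemma residue_pattern:
  assumes ab: "\<not> int l dvd a" "\<not> int l dvd b" "\<not> int l dvd a - b"
  shows "((0, r), (0, s)) \<in> kummer_image rat_class (of_int a) (of_int b)"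
proof -
  let ?F = "residue_ring (int l)"
  interpret res: residues_prime l ?F by unfold_locales (rule l_prime)
  have ops: "x \<oplus>\<^bsub>?F\<^esub> y = (x + y) mod int l" "x \<otimes>\<^bsub>?F\<^esub> y = (x * y) mod int l" "\<ominus>\<^bsub>?F\<^esub> x = (- x) mod int l"
    "\<zero>\<^bsub>?F\<^esub> = 0" "\<one>\<^bsub>?F\<^esub> = 1" "carrier ?F = {0..int l - 1}" for x y
    by (simp_all add: res.res_add_eq res.res_mult_eq res.res_neg_eq res.res_zero_eq res.res_one_eq res.res_carrier_eq)
  have sub: "x \<ominus>\<^bsub>?F\<^esub> y = (x - y) mod int l" for x y
    by (simp add: a_minus_def ops mod_simps)
  have l3: "2 < int l" using l_odd prime_ge_2_nat[OF l_prime] by (cases "l = 2") auto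
  have nzd: "\<not> int l dvd x" if "x \<in> carrier ?F" "x \<noteq> 0" for x
    using that zdvd_not_zless[of x "int l"] by (auto simp: ops)
  have qm [simp]: "qchi l (x mod int l) = qchi l x" for x
    by (rule qchi_cong) (simp add: mod_eq_dvd_iff[symmetric])
  interpret cf: square_class_field ?F "qchi l"
  proof
    show "\<one>\<^bsub>?F\<^esub> \<oplus>\<^bsub>?F\<^esub> \<one>\<^bsub>?F\<^esub> \<noteq> \<zero>\<^bsub>?F\<^esub>" using l3 by (simp add: ops)
    show "qchi l (x \<otimes>\<^bsub>?F\<^esub> y) = qchi l x + qchi l y"
      if "x \<in> carrier ?F" "y \<in> carrier ?F" "x \<noteq> \<zero>\<^bsub>?F\<^esub>" "y \<noteq> \<zero>\<^bsub>?F\<^esub>" for x y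
      using that nzd qchi_mult by (simp add: ops)
    show "qchi l x = 0 \<longleftrightarrow> (\<exists>s\<in>carrier ?F. s \<otimes>\<^bsub>?F\<^esub> s = x)" if x: "x \<in> carrier ?F" "x \<noteq> \<zero>\<^bsub>?F\<^esub>" for x
    proof -
      have "\<not> int l dvd x" using x nzd by (simp add: ops)
      then have "qchi l x = 0 \<longleftrightarrow> (\<exists>s. int l dvd x - s * s)" by (rule qchi_root)
      also have "\<dots> \<longleftrightarrow> (\<exists>s\<in>carrier ?F. s \<otimes>\<^bsub>?F\<^esub> s = x)"
      proof
        assume "\<exists>s. int l dvd x - s * s"
        then obtain s where "x mod int l = (s * s) mod int l" by (auto simp: mod_eq_dvd_iff)
        then have "(s mod int l) \<otimes>\<^bsub>?F\<^esub> (s mod int l) = x" using x by (simp add: ops mod_simps)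
        moreover have "s mod int l \<in> carrier ?F" by (simp add: ops)
        ultimately show "\<exists>s\<in>carrier ?F. s \<otimes>\<^bsub>?F\<^esub> s = x" by blast
      next
        assume "\<exists>s\<in>carrier ?F. s \<otimes>\<^bsub>?F\<^esub> s = x"
        then obtain s where "(s * s) mod int l = x" by (auto simp: ops)
        then show "\<exists>s. int l dvd x - s * s" by (metis mod_eq_dvd_iff mod_mod_trivial)
      qed
      finally show ?thesis .
    qed
  qed
  interpret C: elliptic_curve ?F "qchi l" "a mod int l" "b mod int l"
  proof
    show "a mod int l \<noteq> \<zero>\<^bsub>?F\<^esub>" "b mod int l \<noteq> \<zero>\<^bsub>?F\<^esub>" using ab by (auto simp: ops)
    show "a mod int l \<noteq> b mod int l" using ab by (simp add: mod_eq_dvd_iff)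
  qed (simp_all add: ops)
  have "finite (carrier ?F)" by (simp add: ops)
  then have "4 \<le> card (C.kummer ` C.E)" by (rule C.card_kummer_ge_4)
  moreover have UV: "(UNIV :: (bit \<times> bit) set) = {(0,0),(0,1),(1,0),(1,1)}"
  proof -
    have "x = 0 \<or> x = 1" for x :: bit by (cases x) auto
    then show ?thesis by (auto simp: set_eq_iff) 
  qed
  have U: "finite (UNIV :: (bit \<times> bit) set)" "card (UNIV :: (bit \<times> bit) set) = 4" unfolding UV by simp_all
  ultimately have "C.kummer ` C.E = UNIV" using card_seteq[OF U(1), of "C.kummer ` C.E"] by simp
  then have "(r, s) \<in> C.kummer ` C.E" by simp
  then obtain P where P: "P \<in> C.E" "C.kummer P = (r, s)" by (auto elim!: imageE)
  show ?thesis
  proof (cases P)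
    case None
    then have "r = 0" "s = 0" using P by (auto simp: C.kummer_def)
    then show ?thesis by (simp add: kummer_image_def zero_prod_def)
  next
    case (Some p)
    then obtain x y where eP: "P = Some (x, y)" by (cases p) auto
    have "x \<in> carrier ?F" using P(1) unfolding eP C.mem_E by blast
    then have x: "0 \<le> x" "x < int l" by (simp_all add: ops)
    have m: "(x + a mod int l) mod int l = (x + a) mod int l" "(x + b mod int l) mod int l = (x + b) mod int l"
      by (simp_all add: mod_simps)
    have w: "qchi l (a mod int l * (b mod int l) mod int l) = qchi l (a * b)"
      by (rule qchi_cong) (metis mod_eq_dvd_iff mod_mod_trivial mod_mult_eq)
    have w2: "qchi l (\<ominus>\<^bsub>?F\<^esub> (a mod int l) \<otimes>\<^bsub>?F\<^esub> (b mod int l \<ominus>\<^bsub>?F\<^esub> a mod int l)) = qchi l (- a * (b - a))"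
    proof -
      have "(- (a mod int l) mod int l * ((b mod int l - a mod int l) mod int l)) mod int l = (- a * (b - a)) mod int l"
        by (simp only: mod_mult_eq mod_diff_eq mod_minus_eq)
      then show ?thesis unfolding ops sub by (metis qm)
    qed
    have k0: "r = (if x = 0 then qchi l (a * b) else qchi l x)"
      using P eP w by (simp add: C.kummer_def cf.root_class_def ops split: if_splits)
    have ka: "s = (if (x + a) mod int l = 0 then qchi l (- a * (b - a)) else qchi l (x + a))"
    proof -
      have "s = (if x \<oplus>\<^bsub>?F\<^esub> a mod int l = \<zero>\<^bsub>?F\<^esub>
        then qchi l (\<ominus>\<^bsub>?F\<^esub> (a mod int l) \<otimes>\<^bsub>?F\<^esub> (b mod int l \<ominus>\<^bsub>?F\<^esub> a mod int l)) else qchi l (x \<oplus>\<^bsub>?F\<^esub> a mod int l))"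
        using P(2) unfolding eP C.kummer_def cf.root_class_def by auto
      then show ?thesis unfolding w2 unfolding ops m by simp
    qed
    consider "x = 0" | "int l dvd x + a" | "int l dvd x + b" | "x \<noteq> 0" "\<not> int l dvd x + a" "\<not> int l dvd x + b" by blast
    then show ?thesis
    proof cases
      case 1
      then have "r = qchi l (a * b)" "s = qchi l a" using k0 ka ab by (auto simp: mod_eq_0_iff_dvd)
      moreover have "rat_class (of_int a * of_int b) = (0, qchi l (a * b))" "rat_class (of_int a) = (0, qchi l a)"
        using rat_class_unit[of "a * b"] rat_class_unit[of a] ab dvd_mult_l by simp_all
      ultimately show ?thesis by (simp add: kummer_image_def)
    next
      case 2
      then have x0: "x \<noteq> 0" using ab by auto
      have "int l dvd x - (- a)" using 2 by simp
      then have "r = qchi l (- a)" using k0 x0 qchi_cong by simp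
      moreover have "s = qchi l (- a * (b - a))" using ka 2 by simp
      moreover have "\<not> int l dvd b - a" using ab by (metis dvd_minus_iff minus_diff_eq)
      then have "rat_class (- of_int a) = (0, qchi l (- a))" "rat_class (- of_int a * (of_int b - of_int a)) = (0, qchi l (- a * (b - a)))"
        using rat_class_unit[of "- a"] rat_class_unit[of "- a * (b - a)"] ab dvd_mult_l[of "- a" "b - a"] by simp_all
      ultimately show ?thesis by (simp add: kummer_image_def)
    next
      case 3
      then have x0: "x \<noteq> 0" using ab by auto
      have "int l dvd x - (- b)" using 3 by simp
      then have "r = qchi l (- b)" using k0 x0 qchi_cong by simp
      moreover have d: "int l dvd (x + a) - (a - b)" using 3 by simp
      then have "\<not> int l dvd x + a" using ab by (metis dvd_diff_right_iff dvd_diff_commute)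
      then have "s = qchi l (a - b)" using ka qchi_cong[OF d] by (simp add: mod_eq_0_iff_dvd)
      moreover have "rat_class (- of_int b) = (0, qchi l (- b))" "rat_class (of_int a - of_int b) = (0, qchi l (a - b))"
        using rat_class_unit[of "- b"] rat_class_unit[of "a - b"] ab by simp_all
      ultimately show ?thesis by (simp add: kummer_image_def)
    next
      case 4
      have xd: "\<not> int l dvd x" using 4 x zdvd_not_zless by fastforce
      have rs: "r = qchi l x" "s = qchi l (x + a)" using k0 ka 4 by (auto simp: mod_eq_0_iff_dvd)
      have "qchi l x + qchi l (x + a) + qchi l (x + b) = 0"
        using C.k_sum[of x y] P eP 4 by (simp add: cf.root_class_def ops m mod_eq_0_iff_dvd)
      then have "rat_class (of_int x) + rat_class (of_int (x + a)) + rat_class (of_int (x + b)) = 0"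
        using rat_class_unit[OF xd] rat_class_unit[OF 4(2)] rat_class_unit[OF 4(3)] by (simp add: zero_prod_def)
      moreover have "((0, r), (0, s)) = (rat_class (of_int x), rat_class (of_int (x + a)))"
        using rat_class_unit[OF xd] rat_class_unit[OF 4(2)] rs by simp
      moreover have "(of_int x :: rat) \<noteq> 0" "(of_int (x + a) :: rat) \<noteq> 0" "(of_int (x + b) :: rat) \<noteq> 0"
        using xd 4 by (metis dvd_0_right of_int_eq_0_iff)+
      ultimately show ?thesis
        unfolding kummer_image_def by (intro UnI2 CollectI exI[of _ "of_int x"]) (simp add: zero_prod_def)
    qed
  qed
qed

end

lemma kummer_image_cases:
  assumes "g \<in> kummer_image c a b"
  obtains "g = (0, 0)" | "g = (c (a * b), c a)" | "g = (c (- a), c (- a * (b - a)))" | "g = (c (- b), c (a - b))"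
  | x where "x \<noteq> 0" "x + a \<noteq> 0" "x + b \<noteq> 0" "c x + c (x + a) + c (x + b) = 0" "g = (c x, c (x + a))"
  using assms unfolding kummer_image_def by blast

lemma kummer_image_I:
  "(0, 0) \<in> kummer_image c a b" "(c (a * b), c a) \<in> kummer_image c a b" "(c (- a), c (- a * (b - a))) \<in> kummer_image c a b"
  "(c (- b), c (a - b)) \<in> kummer_image c a b"
  "x \<noteq> 0 \<Longrightarrow> x + a \<noteq> 0 \<Longrightarrow> x + b \<noteq> 0 \<Longrightarrow> c x + c (x + a) + c (x + b) = 0 \<Longrightarrow> (c x, c (x + a)) \<in> kummer_image c a b"
  unfolding kummer_image_def by blast+

lemma log_2_4: "log 2 (4 :: real) = 2"
  using log_pow_cancel[of 2 2] by simp

lemma kummer_image_0: "0 \<in> kummer_image c a b"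
  using kummer_image_I(1) by (simp add: zero_prod_def)

context prime_place
begin

lemma val_l_times: "\<not> int l dvd m \<Longrightarrow> padic_val_rat l (of_int (int l * m)) = 1"
  by (rule val_unit_form[of _ _ m 1]) (use not_dvd_1 in \<open>simp add: unit_form_def\<close>)

end

context hensel_place
begin

lemma rat_class_add_eq_0: "x \<noteq> 0 \<Longrightarrow> rat_class x + g = 0 \<longleftrightarrow> g = rat_class x"
  using rat_class_double[of x] by (metis add_left_cancel)

lemma local_delta_Qp:
  assumes "a \<noteq> 0" "b \<noteq> 0" "a \<noteq> b" "d \<noteq> 0"
  shows "local_delta (Qp l) (Qp_of_int l) (a + b) (a * b) d = (if rat_class (of_int d) = 0 then 0
    else log 2 (real (card ((\<lambda>g. (+) g ` kummer_image rat_class (of_int (d * a)) (of_int (d * b))) ` kummer_image rat_class (of_int a) (of_int b)))))"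
  by (rule place.local_delta_eq[OF place_Qp]) (use assms in \<open>auto simp: Qp_of_int_def\<close>)

end

section \<open>Local images and indices at odd primes\<close>

abbreviation unram :: "((bit \<times> bit) \<times> (bit \<times> bit)) set" where
  "unram \<equiv> {((0, 0), (0, 0)), ((0, 0), (0, 1)), ((0, 1), (0, 0)), ((0, 1), (0, 1))}"

lemma unram_iff: "g \<in> unram \<longleftrightarrow> fst (fst g) = 0 \<and> fst (snd g) = 0"
proof -
  obtain p q r s where g: "g = ((p, q), (r, s))" by (metis surj_pair)
  have "q = 0 \<or> q = 1" "s = 0 \<or> s = 1" by (cases q; simp) (cases s; simp)
  then show ?thesis unfolding g by auto
qed

text \<open>The Kummer image at a prime of multiplicative reduction: the diagonal of the unramified
  classes, together with the pairs of ramified classes that differ by the unramified class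
  h.\<close>

abbreviation multiplicative_image :: "bit \<Rightarrow> ((bit \<times> bit) \<times> (bit \<times> bit)) set" where
  "multiplicative_image h \<equiv> {((0, 0), (0, 0)), ((0, 1), (0, 1)), ((1, h), (1, 0)), ((1, h + 1), (1, 1))}"

lemma card_unram_cosets: "card ((\<lambda>g. (+) g ` unram) ` unram) = 1"
  by code_simp

text \<open>Both groups have order four and share only the unramified diagonal, of order
  two.\<close>

lemma card_mult_red_cosets: "card ((\<lambda>g. (+) g ` multiplicative_image (h + 1)) ` multiplicative_image h) = 2"
proof -
  have "card ((\<lambda>g. (+) g ` multiplicative_image (0 + 1)) ` multiplicative_image 0) = 2" by code_simp
  moreover have "card ((\<lambda>g. (+) g ` multiplicative_image (1 + 1)) ` multiplicative_image 1) = 2" by code_simp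
  ultimately show ?thesis by (cases h) auto
qed

context odd_place
begin

lemma val_neg:
  assumes "x \<noteq> 0" "padic_val_rat l x < 0"
  shows "padic_val_rat l (x + of_int a) = padic_val_rat l x" "rat_class (x + of_int a) = rat_class x"
proof -
  have v: "val_ge l (padic_val_rat l x + 1) (of_int a)" using val_ge_mono[OF val_ge_of_int] assms by simp
  show "padic_val_rat l (x + of_int a) = padic_val_rat l x" using val_add_less[OF assms(1) v] by simp
  show "rat_class (x + of_int a) = rat_class x" using rat_class_add_close[OF assms(1)] v by simp
qed

text \<open>An abscissa of negative valuation dominates a and b, so its three factors share one
  class. Otherwise the factors are integral and at most one is divisible by l, because their
  differences a, b and a - b are units; as the valuations have even sum, each is even. The reverse
  inclusion is \<open>residue_pattern\<close>.\<close>

lemma kummer_image_good: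
  assumes ab: "\<not> int l dvd a" "\<not> int l dvd b" "\<not> int l dvd a - b"
  shows "kummer_image rat_class (of_int a) (of_int b) = unram"
proof (intro equalityI subsetI)
  fix g assume "g \<in> unram"
  then show "g \<in> kummer_image rat_class (of_int a) (of_int b)" using residue_pattern[OF ab] by auto
next
  fix g assume "g \<in> kummer_image rat_class (of_int a) (of_int b)"
  then show "g \<in> unram"
  proof (cases rule: kummer_image_cases)
    case 2
    have "rat_class (of_int (a * b)) = (0, qchi l (a * b))" "rat_class (of_int a) = (0, qchi l a)"
      using rat_class_unit[of "a * b"] rat_class_unit[of a] ab dvd_mult_l by simp_all
    then show ?thesis unfolding unram_iff 2 by simp
  next
    case 3
    have "\<not> int l dvd b - a" using ab by (metis dvd_minus_iff minus_diff_eq)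
    then have "rat_class (of_int (- a)) = (0, qchi l (- a))" "rat_class (of_int (- a * (b - a))) = (0, qchi l (- a * (b - a)))"
      using rat_class_unit[of "- a"] rat_class_unit[of "- a * (b - a)"] ab dvd_mult_l[of "- a" "b - a"] by simp_all
    then show ?thesis unfolding unram_iff 3 by simp
  next
    case 4
    have "rat_class (of_int (- b)) = (0, qchi l (- b))" "rat_class (of_int (a - b)) = (0, qchi l (a - b))"
      using rat_class_unit[of "- b"] rat_class_unit[of "a - b"] ab by simp_all
    then show ?thesis unfolding unram_iff 4 by simp
  next
    case (5 x)
    have s: "fst (rat_class x) + fst (rat_class (x + of_int a)) + fst (rat_class (x + of_int b)) = 0"
      using arg_cong[OF 5(4), of fst] by simp
    show ?thesis
    proof (cases "padic_val_rat l x < 0")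
      case True
      then have "rat_class (x + of_int a) = rat_class x" "rat_class (x + of_int b) = rat_class x" using val_neg 5 by auto
      then show ?thesis using s unfolding unram_iff 5(5) by simp
    next
      case False
      have v0: "val_ge l 0 x" using False by (simp add: val_ge_def)
      have z: "fst (rat_class y) = 0" if "val_ge l 0 y" "\<not> val_ge l 1 y" for y
      proof -
        have "y \<noteq> 0" "padic_val_rat l y = 0" using that by (auto simp: val_ge_def)
        then show ?thesis by (simp add: fst_rat_class)
      qed
      have va: "val_ge l 0 (x + of_int a)" "val_ge l 0 (x + of_int b)" using v0 val_ge_of_int val_ge_add by blast+
      have d1: "\<not> (val_ge l 1 x \<and> val_ge l 1 (x + of_int a))"
        using val_ge_diff[of 1 "x + of_int a" x] ab(1) by (auto simp: val_ge_1_of_int)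
      have d2: "\<not> (val_ge l 1 x \<and> val_ge l 1 (x + of_int b))"
        using val_ge_diff[of 1 "x + of_int b" x] ab(2) by (auto simp: val_ge_1_of_int)
      have d3: "\<not> (val_ge l 1 (x + of_int a) \<and> val_ge l 1 (x + of_int b))"
        using val_ge_diff[of 1 "x + of_int a" "x + of_int b"] ab(3) val_ge_1_of_int[of "a - b"] by auto
      show ?thesis unfolding unram_iff 5(5) using s z[OF v0] z[OF va(1)] z[OF va(2)] d1 d2 d3 by auto
    qed
  qed (simp add: zero_prod_def)
qed

lemma delta_good:
  assumes ab: "\<not> int l dvd a" "\<not> int l dvd b" "\<not> int l dvd a - b" "\<not> int l dvd d"
  shows "local_delta (Qp l) (Qp_of_int l) (a + b) (a * b) d = 0"
proof -
  have nz: "a \<noteq> 0" "b \<noteq> 0" "a \<noteq> b" "d \<noteq> 0" using ab by auto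
  have "\<not> int l dvd d * a - d * b" using ab dvd_mult_l[of d "a - b"] by (simp add: algebra_simps)
  then have "kummer_image rat_class (of_int (d * a)) (of_int (d * b)) = unram" using ab dvd_mult_l by (intro kummer_image_good) auto
  then show ?thesis using local_delta_Qp[OF nz] kummer_image_good[OF ab(1-3)] card_unram_cosets by simp
qed

text \<open>The coefficients d a and d b of the twist have valuation one. If v(x) and v(x + d a) are
  both even, then v(x) <= 0, since v(x) >= 2 would give v(x + d a) = 1; so x dominates and its class
  is trivial. Hence the four unramified classes lie in different cosets.\<close>

lemma delta_ramified:
  assumes ab: "\<not> int l dvd a" "\<not> int l dvd b" "\<not> int l dvd a - b" and d: "d = int l * d'" "\<not> int l dvd d'"
  shows "local_delta (Qp l) (Qp_of_int l) (a + b) (a * b) d = 2"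
proof -
  have nz: "a \<noteq> 0" "b \<noteq> 0" "a \<noteq> b" "d \<noteq> 0" using ab d by auto
  have v1: "padic_val_rat l (of_int (d * e)) = 1" if "\<not> int l dvd e" for e
    using val_l_times[of "d' * e"] that d dvd_mult_l by (simp add: mult.assoc)
  have f1: "fst (rat_class (of_int (d * e))) = 1" if "\<not> int l dvd e" for e
  proof -
    have "e \<noteq> 0" using that by auto
    then show ?thesis using v1[OF that] nz by (simp add: fst_rat_class)
  qed
  have triv: "g = 0" if g: "g \<in> kummer_image rat_class (of_int (d * a)) (of_int (d * b))" and u: "g \<in> unram" for g
    using g
  proof (cases rule: kummer_image_cases)
    case 2
    show ?thesis using u f1[OF ab(1)] unfolding 2 unram_iff by simp
  next
    case 3
    have "fst (rat_class (of_int (d * (- a)))) = 1" using f1[of "- a"] ab by simp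
    then show ?thesis using u unfolding 3 unram_iff by simp
  next
    case 4
    have "fst (rat_class (of_int (d * (- b)))) = 1" using f1[of "- b"] ab by simp
    then show ?thesis using u unfolding 4 unram_iff by simp
  next
    case (5 x)
    have "fst (rat_class x) = 0" "fst (rat_class (x + of_int (d * a))) = 0" using u unfolding 5(5) unram_iff by simp_all
    then have ev: "even (padic_val_rat l x)" "even (padic_val_rat l (x + of_int (d * a)))"
      using fst_rat_class_0[OF 5(1)] fst_rat_class_0[OF 5(2)] by blast+
    have "padic_val_rat l x \<le> 0"
    proof (rule ccontr)
      assume "\<not> ?thesis"
      then have "padic_val_rat l x \<ge> 2" using ev(1) by (cases "padic_val_rat l x = 1") auto
      then have "val_ge l 2 x" by (simp add: val_ge_def)
      then have "padic_val_rat l (of_int (d * a) + x) = 1"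
        using val_add_less(2)[of "of_int (d * a)" x] v1[OF ab(1)] nz by simp
      then show False using ev(2) by (simp add: add.commute)
    qed
    then have "val_ge l (padic_val_rat l x + 1) (of_int (d * e))" if "\<not> int l dvd e" for e
      using v1[OF that] by (simp add: val_ge_def)
    then have ca: "rat_class (x + of_int (d * a)) = rat_class x" "rat_class (x + of_int (d * b)) = rat_class x"
      using rat_class_add_close(2)[OF 5(1)] ab by simp_all
    then have "rat_class x = 0" using rat_class_triple[OF 5(1)] 5(4) by (simp only:)
    then show ?thesis unfolding 5(5) ca by (simp only: zero_prod_def)
  qed (simp add: zero_prod_def)
  have inj: "inj_on (\<lambda>g. (+) g ` kummer_image rat_class (of_int (d * a)) (of_int (d * b))) unram"
  proof (rule inj_onI)
    fix g h assume g: "g \<in> unram" and h: "h \<in> unram"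
      and e: "(+) g ` kummer_image rat_class (of_int (d * a)) (of_int (d * b)) = (+) h ` kummer_image rat_class (of_int (d * a)) (of_int (d * b))"
    have "g + 0 \<in> (+) g ` kummer_image rat_class (of_int (d * a)) (of_int (d * b))"
      by (intro imageI kummer_image_0)
    then have "g \<in> (+) h ` kummer_image rat_class (of_int (d * a)) (of_int (d * b))" unfolding e by simp
    then obtain j where j: "j \<in> kummer_image rat_class (of_int (d * a)) (of_int (d * b))" "g = h + j" by (auto elim!: imageE)
    have "fst (fst g) = fst (fst h) + fst (fst j)" "fst (snd g) = fst (snd h) + fst (snd j)" using j(2) by simp_all
    then have "j \<in> unram" using g h unfolding unram_iff by simp
    then show "g = h" using triv j by simp
  qed
  have "card ((\<lambda>g. (+) g ` kummer_image rat_class (of_int (d * a)) (of_int (d * b))) ` unram) = 4"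
    using card_image[OF inj] by simp
  moreover have "rat_class (of_int d) \<noteq> 0" using f1[of 1] not_dvd_1 by (auto simp: zero_prod_def)
  ultimately show ?thesis using local_delta_Qp[OF nz] kummer_image_good[OF ab] by (simp add: log_2_4)
qed

text \<open>Otherwise the squares modulo l would be stable under translation by b.\<close>
lemma exists_nonresidue_shift:
  assumes b: "\<not> int l dvd b" and d: "\<not> int l dvd d" "qchi l d = 1"
  shows "\<exists>s. \<not> int l dvd s * s - b \<and> qchi l (s * s - b) = 1"
proof (rule ccontr)
  assume h: "\<not> ?thesis"
  define Q where "Q z \<longleftrightarrow> (\<exists>s. int l dvd z - s * s)" for z
  have step: "Q (z - b)" if qz: "Q z" for z
  proof -
    obtain s where s: "int l dvd z - s * s" using qz unfolding Q_def by blast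
    have "Q (s * s - b)"
    proof (cases "int l dvd s * s - b")
      case True
      then show ?thesis unfolding Q_def by (intro exI[of _ 0]) simp
    next
      case False
      then have "qchi l (s * s - b) \<noteq> 1" using h by blast
      then have "qchi l (s * s - b) = 0" by simp
      then show ?thesis using qchi_root[OF False] by (simp add: Q_def)
    qed
    then obtain t where "int l dvd s * s - b - t * t" by (auto simp: Q_def)
    then have "int l dvd (z - s * s) + (s * s - b - t * t)" using s by (rule dvd_add[rotated])
    then show ?thesis unfolding Q_def by (intro exI[of _ t]) (simp add: algebra_simps)
  qed
  \<comment> \<open>Starting from the square 0, translation by -b reaches every residue, since b is
    a unit; k below is chosen to arrive at the nonresidue d.\<close>
  have Qk: "Q (- (int k * b))" for k
  proof (induction k)
    case 0
    then show ?case unfolding Q_def by (intro exI[of _ 0]) simp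
  next
    case (Suc k)
    have "- (int (Suc k) * b) = - (int k * b) - b" by (simp add: algebra_simps)
    then show ?case using step[OF Suc] by (simp only:)
  qed
  have "coprime b (int l)" using prime_imp_coprime[OF pl b] by (simp add: coprime_commute)
  then obtain y where "[b * y = 1] (mod int l)" using cong_solve_coprime_int by blast
  then have 1: "[b * (y * (- d)) = - d] (mod int l)"
    using cong_scalar_right[of "b * y" 1 "int l" "- d"] by (simp add: mult.assoc)
  define k where "k = nat ((y * (- d)) mod int l)"
  have "int k = (y * (- d)) mod int l" unfolding k_def by simp
  then have "[int k = y * (- d)] (mod int l)" by (simp add: cong_def)
  then have "[b * int k = b * (y * (- d))] (mod int l)" by (rule cong_scalar_left)
  then have "[b * int k = - d] (mod int l)" using 1 by (rule cong_trans)
  then have "int l dvd b * int k + d" by (simp add: cong_iff_dvd_diff)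
  then have e: "int l dvd d - (- (int k * b))" by (simp add: algebra_simps)
  obtain s where s: "int l dvd - (int k * b) - s * s" using Qk[of k] unfolding Q_def by blast
  have "int l dvd (d - (- (int k * b))) + (- (int k * b) - s * s)" using e s by (rule dvd_add)
  then have "int l dvd d - s * s" by (simp add: algebra_simps)
  then have "qchi l d = 0" using qchi_root[OF d(1)] by blast
  then show False using d by simp
qed

text \<open>Modulo l the roots 0 and -a coincide. If v(x) <= 0, then x + a has the class of x, which
  is unramified and for v(x) < 0 even trivial. If v(x) > 0, then x + b has the class of b, so the
  classes of x and x + a differ by it, and x is ramified. Torsion points and a nonresidue of the
  form s^2 - b generate the whole group.\<close>

lemma kummer_image_multiplicative:
  assumes a: "a = int l * a'" "\<not> int l dvd a'" and b: "\<not> int l dvd b" and n: "\<not> int l dvd e" "qchi l e = 1"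
  shows "kummer_image rat_class (of_int a) (of_int b) = multiplicative_image (qchi l b)"
proof -
  define h where "h = qchi l b"
  have nz: "a \<noteq> 0" "b \<noteq> 0" "a \<noteq> b" using a b by auto
  have cb: "rat_class (of_int b) = (0, h)" using rat_class_unit[OF b] by (simp add: h_def)
  have va: "padic_val_rat l (of_int a) = 1" using val_l_times[OF a(2)] a(1) by simp
  have fa: "fst (rat_class (of_int a)) = 1" using va nz by (simp add: fst_rat_class)
  have v1a: "val_ge l 1 (of_int a)" using va by (simp add: val_ge_def)
  have close: "rat_class (x + of_int a) = rat_class x" if "x \<noteq> 0" "padic_val_rat l x \<le> 0" for x
    using rat_class_add_close(2)[OF that(1)] val_ge_mono[OF v1a] that(2) by simp
  have ba: "\<not> int l dvd b - a" using b a by (simp add: dvd_diff_left_iff)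
  have cba: "rat_class (of_int b - of_int a) = (0, h)"
  proof -
    have "int l dvd (b - a) - b" using a by simp
    then have "qchi l (b - a) = h" unfolding h_def by (rule qchi_cong)
    then show ?thesis using rat_class_unit[OF ba] by simp
  qed
  have hh: "z + (0, h) + (0, h) = z" for z :: "bit \<times> bit"
  proof -
    have "(0, h) + (0, h) = (0 :: bit \<times> bit)" by (simp add: zero_prod_def)
    then show ?thesis by (simp only: add.assoc add_0_right)
  qed
  have in1: "((0, t), (0, t)) \<in> multiplicative_image h" for t by (cases t) auto
  have in2: "((1, t), (1, t + h)) \<in> multiplicative_image h" for t by (cases t; cases h) auto
  have in2': "(g, g + (0, h)) \<in> multiplicative_image h" if "fst g = 1" for g
    using in2[of "snd g"] that by (cases g) simp
  have sub: "kummer_image rat_class (of_int a) (of_int b) \<subseteq> multiplicative_image h"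
  proof
    fix g assume "g \<in> kummer_image rat_class (of_int a) (of_int b)"
    then show "g \<in> multiplicative_image h"
    proof (cases rule: kummer_image_cases)
      case 2
      have "g = (rat_class (of_int a) + (0, h), rat_class (of_int a) + (0, h) + (0, h))"
        unfolding 2 hh using nz rat_class_mult[of "of_int a" "of_int b"] cb by simp
      then show ?thesis using in2'[of "rat_class (of_int a) + (0, h)"] fa by simp
    next
      case 3
      have m: "rat_class (- of_int a * (of_int b - of_int a)) = rat_class (- of_int a) + (0, h)"
        using nz rat_class_mult[of "- of_int a" "of_int b - of_int a"] cba by simp
      have "padic_val_rat l (of_int (- a)) = 1" using val_l_times[of "- a'"] a by simp
      then have "fst (rat_class (- of_int a)) = 1" using nz by (simp add: fst_rat_class)
      then show ?thesis using in2'[of "rat_class (- of_int a)"] unfolding 3 m by simp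
    next
      case 4
      have "padic_val_rat l (of_int (- b)) \<le> 0" using val_of_int_unit[of "- b"] b by simp
      then have "rat_class (of_int a - of_int b) = rat_class (- of_int b)" using close[of "- of_int b"] nz by simp
      moreover have "rat_class (- of_int b) = (0, qchi l (- b))" using rat_class_unit[of "- b"] b by simp
      ultimately show ?thesis unfolding 4 using in1 by simp
    next
      case (5 x)
      show ?thesis
      proof (cases "padic_val_rat l x \<le> 0")
        case True
        then have e: "rat_class (x + of_int a) = rat_class x" using close 5 by blast
        show ?thesis
        proof (cases "padic_val_rat l x = 0")
          case True
          then have "fst (rat_class x) = 0" using 5 fst_rat_class_0 by simp
          then show ?thesis unfolding 5(5) e using in1[of "snd (rat_class x)"] by (cases "rat_class x") simp
        next
          case False
          then have "rat_class (x + of_int b) = rat_class x" using val_neg(2)[of x b] 5 True by simp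
          then have "rat_class x = 0" using rat_class_triple[OF 5(1)] 5(4) by (simp only: e)
          then show ?thesis unfolding 5(5) e using in1[of 0] by (simp add: zero_prod_def)
        qed
      next
        case False
        then have vx: "val_ge l 1 x" by (simp add: val_ge_def)
        have "rat_class (of_int b + x) = rat_class (of_int b)"
          using rat_class_add_close(2)[of "of_int b" x] vx val_of_int_unit[OF b] nz by simp
        then have cxb: "rat_class (x + of_int b) = (0, h)" using cb by (simp add: add.commute)
        have "rat_class x + (rat_class (x + of_int a) + (0, h)) = 0" using 5(4) cxb by (simp add: add.assoc)
        then have "rat_class (x + of_int a) + (0, h) = rat_class x" using rat_class_add_eq_0[OF 5(1)] by blast
        then have e: "rat_class (x + of_int a) = rat_class x + (0, h)" using hh[of "rat_class (x + of_int a)"] by (simp only:)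
        \<comment> \<open>If v(x) >= 2, then x + a has the class of a, which is ramified, and x
          differs from it by an unramified class.\<close>
        have "fst (rat_class x) = 1"
        proof (cases "padic_val_rat l x = 1")
          case True
          then show ?thesis using 5 by (simp add: fst_rat_class)
        next
          case F: False
          then have "val_ge l 2 x" using False by (simp add: val_ge_def)
          then have "rat_class (of_int a + x) = rat_class (of_int a)"
            using rat_class_add_close(2)[of "of_int a" x] va nz by simp
          then have "fst (rat_class x + (0, h)) = 1" using e fa by (simp add: add.commute)
          then show ?thesis by simp
        qed
        then show ?thesis unfolding 5(5) e by (rule in2')
      qed
    qed (simp add: zero_prod_def)
  qed
  interpret P: place "Qp l" \<iota> rat_class by (rule place_Qp)
  have nzr: "(of_int a :: rat) \<noteq> 0" "(of_int b :: rat) \<noteq> 0" "(of_int a :: rat) \<noteq> of_int b" using nz by auto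
  note add = P.kummer_image_add[OF nzr]
  have T3: "((0, qchi l (- b)), (0, qchi l (- b))) \<in> kummer_image rat_class (of_int a) (of_int b)"
  proof -
    have "padic_val_rat l (of_int (- b)) \<le> 0" using val_of_int_unit[of "- b"] b by simp
    then have "rat_class (of_int a - of_int b) = rat_class (- of_int b)" using close[of "- of_int b"] nz by simp
    moreover have "rat_class (- of_int b) = (0, qchi l (- b))" using rat_class_unit[of "- b"] b by simp
    ultimately show ?thesis using kummer_image_I(4)[of rat_class "of_int b" "of_int a"] by simp
  qed
  \<comment> \<open>x = s^2 - b makes x + b a square, and x + a is close to the unit x. If l divides
    s, then -b is itself a nonresidue and the torsion point at -b has the wanted class.\<close>
  have g1: "((0, 1), (0, 1)) \<in> kummer_image rat_class (of_int a) (of_int b)"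
  proof -
    obtain s where s: "\<not> int l dvd s * s - b" "qchi l (s * s - b) = 1" using exists_nonresidue_shift[OF b n] by blast
    show ?thesis
    proof (cases "int l dvd s")
      case True
      then have "int l dvd (s * s - b) - (- b)" by simp
      then have "qchi l (- b) = 1" using qchi_cong s by metis
      then show ?thesis using T3 by simp
    next
      case False
      define x where "x = (of_int (s * s - b) :: rat)"
      have cx: "rat_class x = (0, 1)" "x \<noteq> 0" "padic_val_rat l x = 0"
        unfolding x_def using rat_class_unit[OF s(1)] s val_of_int_unit[OF s(1)] by (auto simp del: of_int_diff)
      have ca: "rat_class (x + of_int a) = (0, 1)" using close[of x] cx by simp
      have xa: "x + of_int a \<noteq> 0" by (rule rat_class_add_close(1)) (use cx v1a in auto)
      have xb: "x + of_int b = of_int (s * s)" by (simp add: x_def)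
      have "s \<noteq> 0" using False by auto
      then have cb: "rat_class (x + of_int b) = 0" "x + of_int b \<noteq> 0" unfolding xb using rat_class_double[of "of_int s"] by (simp_all add: rat_class_mult)
      show ?thesis using kummer_image_I(5)[of x "of_int a" "of_int b" rat_class] cx ca xa cb by (simp add: zero_prod_def)
    qed
  qed
  have "(rat_class (of_int a * of_int b), rat_class (of_int a)) \<in> kummer_image rat_class (of_int a) (of_int b)" by (rule kummer_image_I(2))
  moreover have "rat_class (of_int a * of_int b) = rat_class (of_int a) + (0, h)" using nz cb by (simp add: rat_class_mult)
  ultimately have g2: "((1, snd (rat_class (of_int a)) + h), (1, snd (rat_class (of_int a)))) \<in> kummer_image rat_class (of_int a) (of_int b)"
    using fa by (cases "rat_class (of_int a)") simp
  have g3: "((1, snd (rat_class (of_int a)) + h + 1), (1, snd (rat_class (of_int a)) + 1)) \<in> kummer_image rat_class (of_int a) (of_int b)"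
    using add[OF g2 g1] by simp
  have "multiplicative_image h \<subseteq> kummer_image rat_class (of_int a) (of_int b)"
    using kummer_image_0[of rat_class "of_int a" "of_int b"] g1 g2 g3
    by (cases "snd (rat_class (of_int a))"; cases h) (simp_all add: zero_prod_def)
  then show ?thesis using sub unfolding h_def by blast
qed

text \<open>For a residue d the local extension is trivial; twisting by a nonresidue turns the
  parameter h of the image into h + 1.\<close>

lemma delta_multiplicative:
  assumes a: "a = int l * a'" "\<not> int l dvd a'" and b: "\<not> int l dvd b" and d: "\<not> int l dvd d"
  shows "local_delta (Qp l) (Qp_of_int l) (a + b) (a * b) d = (if qchi l d = 0 then 0 else 1)"
proof -
  have nz: "a \<noteq> 0" "b \<noteq> 0" "a \<noteq> b" "d \<noteq> 0" using a b d by auto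
  have cd: "rat_class (of_int d) = 0 \<longleftrightarrow> qchi l d = 0" using rat_class_unit[OF d] by (simp add: zero_prod_def)
  show ?thesis
  proof (cases "qchi l d = 0")
    case True
    then show ?thesis using local_delta_Qp[OF nz] cd by simp
  next
    case False
    then have d1: "qchi l d = 1" by simp
    have da: "d * a = int l * (d * a')" "\<not> int l dvd d * a'" "\<not> int l dvd d * b" using a b d dvd_mult_l by auto
    have "kummer_image rat_class (of_int (d * a)) (of_int (d * b)) = multiplicative_image (qchi l (d * b))"
      by (rule kummer_image_multiplicative[OF da d d1])
    moreover have "qchi l (d * b) = qchi l b + 1" using qchi_mult[OF d b] d1 by (simp add: add.commute)
    moreover have "kummer_image rat_class (of_int a) (of_int b) = multiplicative_image (qchi l b)"
      by (rule kummer_image_multiplicative[OF a b d d1])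
    ultimately show ?thesis
      using local_delta_Qp[OF nz] cd False card_mult_red_cosets[of "qchi l b"] by simp
  qed
qed

end

section \<open>The prime 2\<close>

text \<open>Coordinates with respect to the basis -1, 5 of the units modulo 8.\<close>

definition chi2 :: "int \<Rightarrow> bit \<times> bit" where
  "chi2 m = (of_bool (m mod 8 = 3 \<or> m mod 8 = 7), of_bool (m mod 8 = 3 \<or> m mod 8 = 5))"

lemma odd_mod_8: "odd (m::int) \<Longrightarrow> m mod 8 = 1 \<or> m mod 8 = 3 \<or> m mod 8 = 5 \<or> m mod 8 = 7"
  by presburger

lemma chi2_mult:
  assumes "odd m" "odd n" shows "chi2 (m * n) = chi2 m + chi2 n"
proof -
  have "(m * n) mod 8 = (m mod 8) * (n mod 8) mod 8" by (simp add: mod_mult_eq)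
  then show ?thesis using odd_mod_8[OF assms(1)] odd_mod_8[OF assms(2)] by (elim disjE) (simp_all add: chi2_def)
qed

interpretation two: hensel_place 2 3 chi2
proof
  show "chi2 (m * n) = chi2 m + chi2 n" if "\<not> int 2 dvd m" "\<not> int 2 dvd n" for m n
    using chi2_mult that by simp
  show "chi2 m + chi2 m = 0" for m by (simp add: chi2_def zero_prod_def)
  show "chi2 m = chi2 n" if "\<not> int 2 dvd m" "int 2 ^ 3 dvd m - n" for m n
  proof -
    have "m mod 8 = n mod 8" using that by (simp add: mod_eq_dvd_iff)
    then show ?thesis by (simp add: chi2_def)
  qed
  show "\<exists>s. int 2 ^ 3 dvd m - s * s" if h: "\<not> int 2 dvd m" "chi2 m = 0" for m
  proof -
    have "m mod 8 = 1" using odd_mod_8[of m] h by (auto simp: chi2_def zero_prod_def)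
    then have "8 dvd m - 1 * 1" by (simp add: mod_eq_dvd_iff[of m 8 1, symmetric])
    then show ?thesis by (intro exI[of _ 1]) simp
  qed
qed auto

abbreviation rat_class2 :: "rat \<Rightarrow> bit \<times> bit \<times> bit" where "rat_class2 \<equiv> two.rat_class"
abbreviation val2 :: "rat \<Rightarrow> int" where "val2 \<equiv> padic_val_rat 2"

lemma unit_minus_one: "x \<noteq> 0 \<Longrightarrow> val2 x = 0 \<Longrightarrow> val_ge 2 1 (x - 1)"
proof -
  assume x: "x \<noteq> 0" "val2 x = 0"
  then obtain m n where f: "unit_form 2 x 0 m n" using two.unit_form_quotient[of x] by metis
  have "even (m - n)" using f by (simp add: unit_form_def)
  then obtain k where k: "m - n = 2 * k" by blast
  have "(x - 1) * of_int n = of_int (m - n)" using f by (simp add: unit_form_def algebra_simps)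
  then have "(x - 1) * of_int n = of_nat 2 powi 1 * of_int k" unfolding k by simp
  then show ?thesis unfolding two.val_ge_iff using f unit_form_def by blast
qed

text \<open>Here y / x is 4 times a unit, hence congruent to 4 modulo 8, and x + y is x times a
  factor congruent to 5.\<close>

lemma rat_class2_add_5:
  assumes "x \<noteq> 0" "y \<noteq> 0" "val2 y = val2 x + 2"
  shows "rat_class2 (x + y) = rat_class2 x + (0, (0, 1))"
proof -
  define u where "u = y * inverse x * inverse 4"
  have v4: "val2 4 = 2" by (rule two.val_unit_form[of 4 2 1 1]) (simp add: unit_form_def)
  have "val2 u = 0"
    unfolding u_def using assms v4 two.val_mult[of "y * inverse x" "inverse 4"] two.val_mult[of y "inverse x"]
      two.val_inverse[of x] two.val_inverse[of 4] by simp
  then have "val_ge 2 1 (u - 1)" using unit_minus_one assms by (simp add: u_def)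
  then have "val_ge 2 (2 + 1) (4 * (u - 1))" using v4 by (intro two.val_ge_mult) (simp_all add: val_ge_def)
  moreover have "4 * (u - 1) = y * inverse x - 4" by (simp add: u_def)
  ultimately have v: "val_ge 2 (val2 5 + int 3) (y * inverse x - 4)"
    using two.val_of_int_unit[of 5] by simp
  have c5: "rat_class2 5 = (0, (0, 1))" using two.rat_class_unit[of 5] by (simp add: chi2_def)
  have "rat_class2 (5 + (y * inverse x - 4)) = (0, (0, 1))" using two.rat_class_add_close(2)[OF _ v] c5 by simp
  moreover have nz: "5 + (y * inverse x - 4) \<noteq> 0" using two.rat_class_add_close(1)[OF _ v] by simp
  moreover have e: "x + y = x * (5 + (y * inverse x - 4))" using assms by (simp add: field_simps)
  ultimately show ?thesis using two.rat_class_mult[OF assms(1) nz] by (simp only: e)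
qed

text \<open>m and f are the classes of -1 and 5.\<close>
definition two_adic_image :: "bit \<times> bit \<times> bit \<Rightarrow> bit \<times> bit \<times> bit \<Rightarrow> bit \<times> bit \<times> bit \<Rightarrow> ((bit \<times> bit \<times> bit) \<times> (bit \<times> bit \<times> bit)) set" where
  "two_adic_image \<alpha> \<beta> \<delta> = (let m = (0, (1, 0)); f = (0, (0, 1)) in
     {(0, 0), (0, f), (\<alpha> + \<beta>, \<alpha>), (\<alpha> + \<beta>, \<alpha> + f), (m + \<alpha>, m + \<alpha> + \<delta>), (m + \<alpha>, m + \<alpha> + \<delta> + f),
      (m + \<beta>, m + \<delta>), (m + \<beta>, m + \<delta> + f)})"

lemma rat_class2_minus: "x \<noteq> 0 \<Longrightarrow> rat_class2 (- x) = (0, (1, 0)) + rat_class2 x"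
  using two.rat_class_mult[of "- 1" x] two.rat_class_unit[of "- 1"] by (simp add: chi2_def)

lemma add_self_3 [simp]: "(g::bit \<times> bit \<times> bit) + g = 0"
  by (cases g) (auto simp: zero_prod_def)

lemma add_self_3' [simp]: "(g::bit \<times> bit \<times> bit) + (g + h) = h"
  by (simp flip: add.assoc)

text \<open>For v(x) nonzero, parity forces v(x) to be even. At v(x) = -2 and v(x) = 2 the smaller
  term contributes the class of 5, and beyond these values it has no effect. For v(x) = 0 both x + a
  and x + b are even and differ by twice a unit, so one of them has valuation one; by parity the
  other has odd valuation at least 3, and x is close to a root.\<close>

lemma kummer_image_two:
  assumes ab: "odd a" "odd b" "b - a = 2 * u" "odd u"
  shows "kummer_image rat_class2 (of_int a) (of_int b) = two_adic_image (rat_class2 (of_int a)) (rat_class2 (of_int b)) (rat_class2 (of_int (b - a)))"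
proof -
  define \<alpha> \<beta> \<delta> where d: "\<alpha> = rat_class2 (of_int a)" "\<beta> = rat_class2 (of_int b)" "\<delta> = rat_class2 (of_int (b - a))"
  define m f :: "bit \<times> bit \<times> bit" where mf: "m = (0, (1, 0))" "f = (0, (0, 1))"
  have nz: "a \<noteq> 0" "b \<noteq> 0" "b - a \<noteq> 0" "a \<noteq> b" using ab by auto
  have nzr: "(of_int a :: rat) \<noteq> 0" "(of_int b :: rat) \<noteq> 0" "(of_int (b - a) :: rat) \<noteq> 0" "(of_int (a - b) :: rat) \<noteq> 0"
    using nz by auto
  have va: "val2 (of_int a) = 0" "val2 (of_int b) = 0" using two.val_of_int_unit ab by simp_all
  have vba: "val2 (of_int (b - a)) = 1" using two.val_l_times[of u] ab by simp
  have vab: "val2 (of_int (a - b)) = 1" using two.val_l_times[of "- u"] ab by (simp add: algebra_simps)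
  have cab: "rat_class2 (of_int (a - b)) = m + \<delta>"
    using rat_class2_minus[OF nzr(3)] by (simp add: d mf del: of_int_diff flip: of_int_minus)
  have cma: "rat_class2 (- of_int a) = m + \<alpha>" "rat_class2 (- of_int b) = m + \<beta>"
    using rat_class2_minus nzr by (simp_all add: d mf)
  have par: "fst (rat_class2 x) = 0 \<longleftrightarrow> even (val2 x)" if "x \<noteq> 0" for x using two.fst_rat_class_0[OF that] .
  have ts: "two_adic_image \<alpha> \<beta> \<delta> = {(0, 0), (0, f), (\<alpha> + \<beta>, \<alpha>), (\<alpha> + \<beta>, \<alpha> + f), (m + \<alpha>, m + \<alpha> + \<delta>), (m + \<alpha>, m + \<alpha> + \<delta> + f),
      (m + \<beta>, m + \<delta>), (m + \<beta>, m + \<delta> + f)}"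
    by (simp add: two_adic_image_def mf Let_def)
  have c2: "rat_class2 (of_int a * of_int b) = \<alpha> + \<beta>" using nzr by (simp add: two.rat_class_mult d)
  have c3: "rat_class2 (- of_int a * (of_int b - of_int a)) = m + \<alpha> + \<delta>"
    using two.rat_class_mult[of "- of_int a" "of_int (b - a)"] nzr cma by (simp add: d)
  have c4: "rat_class2 (of_int a - of_int b) = m + \<delta>" using cab by simp
  have sub: "kummer_image rat_class2 (of_int a) (of_int b) \<subseteq> two_adic_image \<alpha> \<beta> \<delta>"
  proof
    fix g assume "g \<in> kummer_image rat_class2 (of_int a) (of_int b)"
    then show "g \<in> two_adic_image \<alpha> \<beta> \<delta>"
    proof (cases rule: kummer_image_cases)
      case 1 then show ?thesis by (simp add: ts)
    next
      case 2 then show ?thesis unfolding 2 c2 ts by (simp add: d)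
    next
      case 3 then show ?thesis unfolding 3 c3 cma ts by simp
    next
      case 4 then show ?thesis unfolding 4 c4 cma ts by simp
    next
      case (5 x)
      define X Y Z where XYZ: "X = rat_class2 x" "Y = rat_class2 (x + of_int a)" "Z = rat_class2 (x + of_int b)"
      have s: "X + Y + Z = 0" using 5(4) by (simp add: XYZ)
      have g: "g = (X, Y)" using 5(5) by (simp add: XYZ)
      have sf: "fst X + fst Y + fst Z = 0" using arg_cong[OF s, of fst] by simp
      have Y: "Y = X + Z"
      proof -
        have "X + (Y + Z) = X + X" using s by (simp only: add.assoc add_self_3)
        then have "Y + Z = X" by (simp only: add_left_cancel)
        then have "Y + (Z + Z) = X + Z" by (simp only: add.assoc[symmetric])
        then show ?thesis by (simp only: add_self_3 add_0_right)
      qed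
      have X: "X = Y + Z" unfolding Y by (simp only: add.assoc add_self_3 add_0_right)
      consider "val2 x < 0" | "val2 x > 0" | "val2 x = 0" by linarith
      then show ?thesis
      proof cases
        case 1
        have "val_ge 2 (val2 x + 1) (of_int e)" for e using two.val_ge_mono[OF two.val_ge_of_int] 1 by simp
        then have "val2 (x + of_int a) = val2 x" "val2 (x + of_int b) = val2 x" using two.val_add_less(2)[OF 5(1)] by auto
        then have "fst Y = fst X" "fst Z = fst X" using 5 by (simp_all add: two.fst_rat_class XYZ)
        then have "fst X = 0" using sf by simp
        then have ev: "even (val2 x)" using par 5(1) by (simp add: XYZ)
        show ?thesis
        proof (cases "val2 x = - 2")
          case True
          then have YZ: "Y = X + f" "Z = X + f" using rat_class2_add_5[OF 5(1)] nzr va by (simp_all add: XYZ mf)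
          have "X = 0" by (rule trans[OF X]) (simp only: YZ add_self_3)
          moreover have "Y = f" unfolding YZ(1) calculation by simp
          ultimately show ?thesis unfolding g ts by simp
        next
          case False
          then have "val2 x \<le> - 4" using 1 ev by presburger
          then have "val_ge 2 (val2 x + int 3) (of_int e)" for e using two.val_ge_mono[OF two.val_ge_of_int] by simp
          then have YZ: "Y = X" "Z = X" using two.rat_class_add_close(2)[OF 5(1)] by (simp_all add: XYZ)
          have "X = 0" by (rule trans[OF X]) (simp only: YZ add_self_3)
          then show ?thesis unfolding g ts YZ by simp
        qed
      next
        case 2
        have "val_ge 2 1 x" using 2 by (simp add: val_ge_def)
        then have "val2 (of_int a + x) = 0" "val2 (of_int b + x) = 0"
          using two.val_add_less(2)[OF nzr(1)] two.val_add_less(2)[OF nzr(2)] va by simp_all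
        then have "fst Y = 0" "fst Z = 0" using 5 par by (simp_all add: XYZ add.commute)
        then have "fst X = 0" using sf by simp
        then have ev: "even (val2 x)" using par 5(1) by (simp add: XYZ)
        show ?thesis
        proof (cases "val2 x = 2")
          case True
          then have YZ: "Y = \<alpha> + f" "Z = \<beta> + f"
            using rat_class2_add_5[OF nzr(1) 5(1)] rat_class2_add_5[OF nzr(2) 5(1)] va by (simp_all add: XYZ d mf add.commute)
          have "\<alpha> + f + (\<beta> + f) = \<alpha> + \<beta> + (f + f)" by (simp only: ac_simps)
          then have "\<alpha> + f + (\<beta> + f) = \<alpha> + \<beta>" by (simp only: add_self_3 add_0_right)
          then have "X = \<alpha> + \<beta>" by (intro trans[OF X]) (simp only: YZ)
          then show ?thesis unfolding g ts YZ by simp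
        next
          case False
          then have "val2 x \<ge> 4" using 2 ev by presburger
          then have "val_ge 2 (int 3) x" by (simp add: val_ge_def)
          then have YZ: "Y = \<alpha>" "Z = \<beta>"
            using two.rat_class_add_close(2)[OF nzr(1), of x] two.rat_class_add_close(2)[OF nzr(2), of x] va by (simp_all add: XYZ d add.commute)
          have "X = \<alpha> + \<beta>" by (rule trans[OF X]) (simp only: YZ)
          then show ?thesis unfolding g ts YZ by simp
        qed
      next
        case 3
        have x1: "val_ge 2 1 (x - 1)" using unit_minus_one 5(1) 3 by blast
        have fX: "fst X = 0" using par[OF 5(1)] 3 by (simp add: XYZ)
        have "2 dvd a + 1" "2 dvd b + 1" using ab by auto
        then have "val_ge 2 1 (of_int (a + 1))" "val_ge 2 1 (of_int (b + 1))"
          using two.val_ge_dvd[of 1 "a + 1"] two.val_ge_dvd[of 1 "b + 1"] by (auto simp del: of_int_add)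
        then have "val_ge 2 1 (x - 1 + of_int (a + 1))" "val_ge 2 1 (x - 1 + of_int (b + 1))" using x1 two.val_ge_add by blast+
        then have y1: "val_ge 2 1 (x + of_int a)" "val_ge 2 1 (x + of_int b)" by simp_all
        show ?thesis
        proof (cases "val_ge 2 2 (x + of_int a)")
          case True
          have z: "x + of_int b = of_int (b - a) + (x + of_int a)" by simp
          have "val2 (x + of_int b) = 1" unfolding z using two.val_add_less(2)[OF nzr(3), of "x + of_int a"] True vba by simp
          then have "fst Z = 1" using 5 by (simp add: XYZ two.fst_rat_class)
          then have "fst Y = 1" using sf fX by simp
          then have od: "odd (val2 (x + of_int a))" using par[OF 5(2)] by (simp add: XYZ)
          then have "val2 (x + of_int a) \<noteq> 2" by auto
          then have v3: "val2 (x + of_int a) \<ge> 3" using True 5(2) by (simp add: val_ge_def)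
          have "rat_class2 (- of_int a + (x + of_int a)) = rat_class2 (- of_int a)"
            using two.rat_class_add_close(2)[of "- of_int a" "x + of_int a"] nzr v3 two.val_of_int_unit[of "- a"] ab by (simp add: val_ge_def)
          then have X1: "X = m + \<alpha>" using cma by (simp add: XYZ)
          show ?thesis
          proof (cases "val2 (x + of_int a) = 3")
            case True
            then have "Z = \<delta> + f" unfolding XYZ z using rat_class2_add_5[OF nzr(3) 5(2)] vba by (simp add: d mf)
            then show ?thesis unfolding g ts Y X1 by (simp add: add.assoc)
          next
            case False
            then have "val_ge 2 (val2 (of_int (b - a)) + int 3) (x + of_int a)" using v3 vba by (simp add: val_ge_def)
            then have "Z = \<delta>" unfolding XYZ z using two.rat_class_add_close(2)[OF nzr(3), of "x + of_int a"] by (simp add: d)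
            then show ?thesis unfolding g ts Y X1 by (simp add: add.assoc)
          qed
        next
          case False
          then have vy: "val2 (x + of_int a) = 1" using y1(1) by (auto simp: val_ge_def)
          then have "fst Y = 1" using 5 by (simp add: XYZ two.fst_rat_class)
          then have fZ: "fst Z = 1" using sf fX by simp
          then have od: "odd (val2 (x + of_int b))" using par[OF 5(3)] by (simp add: XYZ)
          \<comment> \<open>x + a and a - b are both twice a unit, so their difference x + b is
            divisible by 4.\<close>
          have half: "val_ge 2 1 (w * inverse 2 - 1)" if "w \<noteq> 0" "val2 w = 1" for w
          proof -
            have "val2 (w * inverse 2) = 0"
              using two.val_mult[of w "inverse 2"] two.val_inverse[of 2] two.val_2 that by (simp add: two.v2_def)
            then show ?thesis using unit_minus_one that by simp
          qed
          have "val_ge 2 1 ((x + of_int a) * inverse 2 - 1 - (of_int (a - b) * inverse 2 - 1))"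
            using half[OF 5(2) vy] half[OF nzr(4) vab] two.val_ge_diff by blast
          then have "val_ge 2 (1 + 1) (2 * ((x + of_int a) * inverse 2 - 1 - (of_int (a - b) * inverse 2 - 1)))"
            using two.val_2 by (intro two.val_ge_mult) (simp_all add: val_ge_def two.v2_def)
          moreover have "2 * ((x + of_int a) * inverse 2 - 1 - (of_int (a - b) * inverse 2 - 1)) = x + of_int b"
            by (simp add: field_simps)
          ultimately have "val_ge 2 2 (x + of_int b)" by simp
          moreover have "val2 (x + of_int b) \<noteq> 2" using od by auto
          ultimately have v3: "val2 (x + of_int b) \<ge> 3" using 5(3) by (simp add: val_ge_def)
          have y: "x + of_int a = of_int (a - b) + (x + of_int b)" by simp
          have "rat_class2 (- of_int b + (x + of_int b)) = rat_class2 (- of_int b)"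
            using two.rat_class_add_close(2)[of "- of_int b" "x + of_int b"] nzr v3 two.val_of_int_unit[of "- b"] ab by (simp add: val_ge_def)
          then have X1: "X = m + \<beta>" using cma by (simp add: XYZ)
          show ?thesis
          proof (cases "val2 (x + of_int b) = 3")
            case True
            then have "Y = m + \<delta> + f" unfolding XYZ y using rat_class2_add_5[OF nzr(4) 5(3)] vab cab by (simp add: mf)
            then show ?thesis unfolding g ts X1 by simp
          next
            case False
            then have "val_ge 2 (val2 (of_int (a - b)) + int 3) (x + of_int b)" using v3 vab by (simp add: val_ge_def)
            then have "Y = m + \<delta>" unfolding XYZ y using two.rat_class_add_close(2)[OF nzr(4), of "x + of_int b"] cab by simp
            then show ?thesis unfolding g ts X1 by simp
          qed
        qed
      qed
    qed
  qed
  interpret P: place "Qp 2" two.\<iota> rat_class2 by (rule two.place_Qp)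
  have nzr': "(of_int a :: rat) \<noteq> of_int b" using nz by auto
  note add = P.kummer_image_add[OF nzr(1,2) nzr']
  let ?J = "kummer_image rat_class2 (of_int a) (of_int b)"
  \<comment> \<open>1/4 is a square, and adding an odd integer, whose valuation is larger by two,
    multiplies its class by that of 5.\<close>
  have G: "(0, f) \<in> ?J"
  proof -
    have v: "val2 (1 / 4) = - 2" by (rule two.val_unit_form[of _ _ 1 1]) (simp add: unit_form_def power_int_minus)
    have c: "rat_class2 (1 / 4) = 0" using two.rat_class_unit_form[of "1 / 4" "- 2" 1 1] by (simp add: unit_form_def power_int_minus chi2_def zero_prod_def)
    have "rat_class2 (1 / 4 + of_int a) = f" "rat_class2 (1 / 4 + of_int b) = f"
      using rat_class2_add_5[of "1 / 4"] nzr va v c by (simp_all add: mf)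
    moreover have "1 / 4 + of_int e \<noteq> (0 :: rat)" for e
    proof
      assume "1 / 4 + of_int e = (0 :: rat)"
      then have "of_int (1 + 4 * e) = (0 :: rat)" by simp
      then have "1 + 4 * e = 0" by (simp only: of_int_eq_0_iff)
      then show False by presburger
    qed
    ultimately show ?thesis using kummer_image_I(5)[of "1 / 4" "of_int a" "of_int b" rat_class2] c by simp
  qed
  have T: "(\<alpha> + \<beta>, \<alpha>) \<in> ?J" "(m + \<alpha>, m + \<alpha> + \<delta>) \<in> ?J" "(m + \<beta>, m + \<delta>) \<in> ?J"
    using kummer_image_I(2-4)[of rat_class2 "of_int a" "of_int b"] kummer_image_I(4)[of rat_class2 "of_int b" "of_int a"] unfolding c2 c3 c4 cma by (simp_all add: d)
  have "two_adic_image \<alpha> \<beta> \<delta> \<subseteq> ?J"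
    unfolding ts using G T kummer_image_I(1)[of rat_class2 "of_int a" "of_int b"] add[OF T(1) G] add[OF T(2) G] add[OF T(3) G] by simp
  then show ?thesis using sub unfolding d by blast
qed

text \<open>The norm index at 2 in terms of r = p mod 8, the sign e and k = d mod 8. The third
  parameter is the class of b - a = 2 e, and twisting adds the class of k to all three
  parameters.\<close>

definition two_index :: "int \<Rightarrow> int \<Rightarrow> int \<Rightarrow> nat" where
  "two_index r e k =
     card ((\<lambda>g. (+) g ` two_adic_image (0, chi2 k + chi2 (e * r)) (0, chi2 k + chi2 (e * (r + 2))) (1, chi2 k + chi2 e)) `
       two_adic_image (0, chi2 (e * r)) (0, chi2 (e * (r + 2))) (1, chi2 e))"

lemma two_table_3:
  "\<forall>r\<in>{1, 3, 5, 7::int}. \<forall>e\<in>{1, -1::int}. two_index r e 3 = (if r mod 4 = 1 then 2 else 4)"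
  unfolding two_index_def by code_simp

lemma two_table_5:
  "\<forall>r\<in>{1, 3, 5, 7::int}. \<forall>e\<in>{1, -1::int}. two_index r e 5 = 2"
  unfolding two_index_def by code_simp

lemma two_table_7:
  "\<forall>r\<in>{1, 3, 5, 7::int}. \<forall>e\<in>{1, -1::int}. two_index r e 7 = (if r mod 4 = 3 then 2 else 4)"
  unfolding two_index_def by code_simp

lemma chi2_mod: "m mod 8 = n mod 8 \<Longrightarrow> chi2 m = chi2 n"
  by (simp add: chi2_def)

lemma delta_two:
  assumes p: "odd p" and e: "e \<in> {1, -1}" and dd: "odd d"
  shows "local_delta (Qp 2) (Qp_of_int 2) (e * p + e * (p + 2)) (e * p * (e * (p + 2))) d =
    (if d mod 8 = 1 then 0
     else if d mod 8 = 5 \<or> (d mod 8 = 7 \<and> p mod 4 = 3) \<or> (d mod 8 = 3 \<and> p mod 4 = 1) then 1 else 2)"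
proof -
  have eo: "odd e" using e by auto
  have ab: "odd (e * p)" "odd (e * (p + 2))" "e * (p + 2) - e * p = 2 * e" using p eo by (auto simp: algebra_simps)
  have nz: "e * p \<noteq> 0" "e * (p + 2) \<noteq> 0" "e * p \<noteq> e * (p + 2)" "d \<noteq> 0"
    using ab(1,2) dd eo by (metis even_zero, metis even_zero, auto)
  have cd: "rat_class2 (of_int d) = (0, chi2 d)" using two.rat_class_unit[of d] dd by simp
  have d0: "chi2 d = 0 \<longleftrightarrow> d mod 8 = 1" using odd_mod_8[OF dd] by (auto simp: chi2_def zero_prod_def)
  have c2e: "rat_class2 (of_int (2 * e)) = (1, chi2 e)"
    using two.rat_class_unit_form[of "of_int (2 * e)" 1 e 1] eo by (simp add: unit_form_def chi2_def)
  \<comment> \<open>Both images depend on p and d only through their residues modulo 8, so the three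
    tables cover every d that is not a local square.\<close>
  define r where "r = p mod 8"
  have r: "r \<in> {1, 3, 5, 7}" using odd_mod_8[OF p] by (auto simp: r_def)
  have "(e * (p + 2)) mod 8 = (e * (r + 2)) mod 8"
    unfolding r_def by (metis mod_mult_right_eq mod_add_left_eq)
  moreover have "(e * p) mod 8 = (e * r) mod 8" "d mod 8 = d mod 8 mod 8" unfolding r_def by (simp_all add: mod_mult_right_eq)
  ultimately have cc: "chi2 (e * p) = chi2 (e * r)" "chi2 (e * (p + 2)) = chi2 (e * (r + 2))" "chi2 d = chi2 (d mod 8)"
    by (blast intro: chi2_mod)+
  have J1: "kummer_image rat_class2 (of_int (e * p)) (of_int (e * (p + 2))) = two_adic_image (0, chi2 (e * r)) (0, chi2 (e * (r + 2))) (1, chi2 e)"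
    unfolding kummer_image_two[OF ab eo] unfolding ab(3) c2e
    using two.rat_class_unit[of "e * p"] two.rat_class_unit[of "e * (p + 2)"] ab(1,2) cc by simp
  have dab: "odd (d * (e * p))" "odd (d * (e * (p + 2)))" "d * (e * (p + 2)) - d * (e * p) = 2 * (d * e)" "odd (d * e)"
    using ab dd eo by (auto simp: algebra_simps)
  have "rat_class2 (of_int (2 * (d * e))) = (1, chi2 d + chi2 e)"
    using two.rat_class_unit_form[of "of_int (2 * (d * e))" 1 "d * e" 1] eo dd chi2_mult[of d e] by (simp add: unit_form_def two.chi_1)
  then have J2: "kummer_image rat_class2 (of_int (d * (e * p))) (of_int (d * (e * (p + 2)))) =
    two_adic_image (0, chi2 (d mod 8) + chi2 (e * r)) (0, chi2 (d mod 8) + chi2 (e * (r + 2))) (1, chi2 (d mod 8) + chi2 e)"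
    unfolding kummer_image_two[OF dab] unfolding dab(3)
    using two.rat_class_unit[of "d * (e * p)"] two.rat_class_unit[of "d * (e * (p + 2))"] dab(1,2) chi2_mult[of d "e * p"] chi2_mult[of d "e * (p + 2)"]
      ab(1,2) dd cc by simp
  have r4: "r mod 4 = p mod 4" unfolding r_def by (simp add: mod_mod_cancel)
  show ?thesis
  proof (cases "d mod 8 = 1")
    case True
    then have "rat_class2 (of_int d) = 0" using cd d0 by (simp add: zero_prod_def)
    then show ?thesis using two.local_delta_Qp[OF nz] True by simp
  next
    case False
    then have "rat_class2 (of_int d) \<noteq> 0" using cd d0 by (auto simp: zero_prod_def)
    moreover have k: "d mod 8 \<in> {3, 5, 7}" using odd_mod_8[OF dd] False by auto
    moreover have "two_index r e (d mod 8) =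
      (if d mod 8 = 5 \<or> (d mod 8 = 7 \<and> p mod 4 = 3) \<or> (d mod 8 = 3 \<and> p mod 4 = 1) then 2 else 4)"
      using k two_table_3[rule_format, OF r e] two_table_5[rule_format, OF r e] two_table_7[rule_format, OF r e] r4
      by auto
    ultimately show ?thesis
      using two.local_delta_Qp[OF nz] False unfolding J1 J2 two_index_def
      by (simp add: log_2_4)
  qed
qed

section \<open>The real place\<close>

definition sgn_class :: "rat \<Rightarrow> bit" where
  "sgn_class x = of_bool (x < 0)"

lemma place_real: "place real_field of_rat sgn_class"
proof -
  have c: "carrier real_field = UNIV" "mult real_field = (*)" "add real_field = (+)" "one real_field = 1" "zero real_field = 0"
    by (simp_all add: real_field_def)
  have cr: "cring real_field"
  proof (rule cringI)
    show "abelian_group real_field"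
      by (rule abelian_groupI) (auto simp: c intro: exI[of _ "- _"])
    show "comm_monoid real_field" by (rule comm_monoidI) (auto simp: c)
  qed (auto simp: c algebra_simps)
  interpret cring real_field by (rule cr)
  have "Units real_field = carrier real_field - {zero real_field}"
  proof -
    have "\<exists>y. y * x = 1" if "x \<noteq> 0" for x :: real using that by (intro exI[of _ "inverse x"]) simp
    then show ?thesis by (auto simp: Units_def c mult.commute)
  qed
  then have "field real_field" by (rule cring_fieldI)
  then interpret field real_field .
  show ?thesis
  proof
    show "\<one>\<^bsub>real_field\<^esub> \<oplus>\<^bsub>real_field\<^esub> \<one>\<^bsub>real_field\<^esub> \<noteq> \<zero>\<^bsub>real_field\<^esub>" by (simp add: c)
    show "sgn_class (x * y) = sgn_class x + sgn_class y" if "x \<noteq> 0" "y \<noteq> 0" for x y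
      using that by (auto simp: sgn_class_def mult_less_0_iff)
    show "sgn_class x = 0 \<longleftrightarrow> (\<exists>s\<in>carrier real_field. s \<otimes>\<^bsub>real_field\<^esub> s = of_rat x)" for x
    proof -
      have "(\<exists>s::real. s * s = of_rat x) \<longleftrightarrow> 0 \<le> x"
      proof
        assume "\<exists>s::real. s * s = of_rat x"
        then have "0 \<le> (of_rat x :: real)" by (metis zero_le_square)
        then show "0 \<le> x" by simp
      next
        assume "0 \<le> x"
        then show "\<exists>s::real. s * s = of_rat x" by (intro exI[of _ "sqrt (of_rat x)"]) simp
      qed
      then show ?thesis by (auto simp: c sgn_class_def)
    qed
    show "\<exists>x. \<forall>r\<in>C. x + r \<noteq> 0 \<and> (\<exists>s\<in>carrier real_field. s \<otimes>\<^bsub>real_field\<^esub> s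
        = (z \<oplus>\<^bsub>real_field\<^esub> of_rat r) \<otimes>\<^bsub>real_field\<^esub> of_rat (x + r))"
      if C: "finite C" and nz: "\<And>r. r \<in> C \<Longrightarrow> z \<oplus>\<^bsub>real_field\<^esub> of_rat r \<noteq> \<zero>\<^bsub>real_field\<^esub>" for z C
    proof -
      \<comment> \<open>e is at most the distance from z to any -r, so a rational x between z and z
        + e gives each x + r the sign of z + r. The entry 1 keeps the minimum meaningful for empty
        C.\<close>
      define e where "e = Min (insert 1 ((\<lambda>r. \<bar>z + of_rat r\<bar>) ` C))"
      have e: "e > 0" unfolding e_def using C nz by (subst Min_gr_iff) (auto simp: c)
      have le: "e \<le> \<bar>z + of_rat r\<bar>" if "r \<in> C" for r unfolding e_def using C that by (intro Min_le) auto
      obtain x where x: "z < of_rat x" "of_rat x < z + e" using of_rat_dense[of z "z + e"] e by auto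
      have "x + r \<noteq> 0 \<and> (\<exists>s. s * s = (z + of_rat r) * of_rat (x + r))" if r: "r \<in> C" for r
      proof -
        have p: "(z + of_rat r) * (of_rat (x + r) :: real) > 0"
          using le[OF r] x by (auto simp: zero_less_mult_iff of_rat_add abs_if split: if_splits)
        then have "x + r \<noteq> 0" by auto
        moreover have "sqrt ((z + of_rat r) * of_rat (x + r)) * sqrt ((z + of_rat r) * of_rat (x + r)) = (z + of_rat r) * of_rat (x + r)"
          using p by simp
        ultimately show ?thesis by blast
      qed
      then show ?thesis by (auto simp: c)
    qed
  qed (auto simp: c of_rat_add of_rat_mult)
qed

text \<open>The real curve has an oval over [-b, -a] and an unbounded branch over x >= 0, and the
  Kummer map is constant on each.\<close>

lemma kummer_image_real_pos:
  assumes "0 < a" "a < b"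
  shows "kummer_image sgn_class a b = {(0, 0), (1, 1)}"
proof -
  have "g \<in> {(0, 0), (1, 1)}" if "g \<in> kummer_image sgn_class a b" for g
    using that
  proof (cases rule: kummer_image_cases)
    case (5 x)
    then show ?thesis using assms by (auto simp: sgn_class_def split: if_splits)
  qed (use assms in \<open>auto simp: sgn_class_def mult_less_0_iff\<close>)
  moreover have "(1, 1) \<in> kummer_image sgn_class a b"
    using kummer_image_I(4)[of sgn_class b a] assms by (simp add: sgn_class_def)
  ultimately show ?thesis using kummer_image_I(1)[of sgn_class a b] by blast
qed

text \<open>Now the roots are ordered as 0 < -a < -b. The oval lies over [0, -a] and has the class
  (0, 1).\<close>

lemma kummer_image_real_neg:
  assumes "a < 0" "b < a"
  shows "kummer_image sgn_class a b = {(0, 0), (0, 1)}"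
proof -
  have "g \<in> {(0, 0), (0, 1)}" if "g \<in> kummer_image sgn_class a b" for g
    using that
  proof (cases rule: kummer_image_cases)
    case (5 x)
    then show ?thesis using assms by (auto simp: sgn_class_def split: if_splits)
  qed (use assms in \<open>auto simp: sgn_class_def mult_less_0_iff zero_less_mult_iff\<close>)
  moreover have "(0, 1) \<in> kummer_image sgn_class a b"
    using kummer_image_I(2)[of sgn_class a b] assms by (simp add: sgn_class_def mult_less_0_iff)
  ultimately show ?thesis using kummer_image_I(1)[of sgn_class a b] by blast
qed

text \<open>A negative d interchanges the two orders of the roots, and the resulting images, each of
  order two, meet trivially.\<close>

lemma delta_real:
  assumes ab: "0 < a \<and> a < b \<or> b < a \<and> a < 0" and d: "d \<noteq> 0"
  shows "local_delta real_field of_int (a + b) (a * b) d = (if d < 0 then 1 else 0)"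
proof -
  have nz: "a \<noteq> 0" "b \<noteq> 0" "a \<noteq> b" using ab by auto
  have L: "local_delta real_field of_int (a + b) (a * b) d = (if sgn_class (of_int d) = 0 then 0
    else log 2 (real (card ((\<lambda>g. (+) g ` kummer_image sgn_class (of_int (d * a)) (of_int (d * b))) ` kummer_image sgn_class (of_int a) (of_int b)))))"
    by (rule place.local_delta_eq[OF place_real]) (use nz d in auto)
  show ?thesis
  proof (cases "d < 0")
    case False
    then show ?thesis using L by (simp add: sgn_class_def)
  next
    case True
    have c1: "card ((\<lambda>g. (+) g ` {(0, 0), (0, 1)}) ` {(0, 0), (1, 1 :: bit)} :: (bit \<times> bit) set set) = 2" by code_simp
    have c2: "card ((\<lambda>g. (+) g ` {(0, 0), (1, 1)}) ` {(0, 0), (0, 1 :: bit)} :: (bit \<times> bit) set set) = 2" by code_simp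
    from ab show ?thesis
    proof
      assume h: "0 < a \<and> a < b"
      then have "d * a < 0" "d * b < d * a" using True by (auto simp: mult_less_0_iff)
      then have "kummer_image sgn_class (of_int (d * a)) (of_int (d * b)) = {(0, 0), (0, 1)}" by (intro kummer_image_real_neg) (simp_all del: of_int_mult)
      moreover have "kummer_image sgn_class (of_int a) (of_int b) = {(0, 0), (1, 1)}" using h by (intro kummer_image_real_pos) simp_all
      ultimately show ?thesis using L c1 True by (simp only: sgn_class_def) simp
    next
      assume h: "b < a \<and> a < 0"
      then have "0 < d * a" "d * a < d * b" using True by (auto simp: zero_less_mult_iff)
      then have "kummer_image sgn_class (of_int (d * a)) (of_int (d * b)) = {(0, 0), (1, 1)}" by (intro kummer_image_real_pos) (simp_all del: of_int_mult)
      moreover have "kummer_image sgn_class (of_int a) (of_int b) = {(0, 0), (0, 1)}" using h by (intro kummer_image_real_neg) simp_all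
      ultimately show ?thesis using L c2 True by (simp only: sgn_class_def) simp
    qed
  qed
qed

section \<open>The global norm index\<close>

lemma Legendre_qchi: "\<not> int l dvd d \<Longrightarrow> Legendre d (int l) = (if qchi l d = 0 then 1 else - 1)"
  by (auto simp: qchi_def Legendre_def cong_0_iff)

text \<open>The sum consists of \<mu>0 from the real place, 2 for each of the n primes dividing D, 0
  or 1 at each of p and q, and 0, 1 or 2 at the prime 2. The listed cases are the ways in which p, q
  and 2 can produce a given excess over 2 n + \<mu>0.\<close>

theorem theorem3p3:
  fixes p q :: nat and \<epsilon> \<mu> :: int and D n :: nat and S :: "nat set"
  assumes "prime p" "prime q" "odd p" "odd q" "int q - int p = 2"
    and "\<epsilon> \<in> {1, -1}"
    and "finite S" "card S = n" "\<forall>l\<in>S. prime l \<and> odd l" "D = \<Prod>S"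
    and "coprime (p * q) D"
    and "\<mu> \<in> {1, -1}" "\<mu> * int D \<noteq> 1"
  defines "\<delta> \<equiv> delta_EQK (\<epsilon> * int p + \<epsilon> * int q) ((\<epsilon> * int p) * (\<epsilon> * int q)) (\<mu> * int D)"
    and "\<mu>0 \<equiv> (1 - \<mu>) div 2"
    and "Lp \<equiv> Legendre (\<mu> * int D) (int p)"
    and "Lq \<equiv> Legendre (\<mu> * int D) (int q)"
  shows
    "real_of_int (2 * int n + \<mu>0) \<le> \<delta> \<and> \<delta> \<le> real_of_int (2 * int n + 4 + \<mu>0)
     \<and> (\<delta> = real_of_int (2 * int n + \<mu>0) \<longleftrightarrow>
          [int D = \<mu>] (mod 8) \<and> Lp = 1 \<and> Lq = 1)
     \<and> (\<delta> = real_of_int (2 * int n + 1 + \<mu>0) \<longleftrightarrow>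
          ([int D = 5 * \<mu>] (mod 8) \<and> Lp = 1 \<and> Lq = 1)
        \<or> ([int D = 7 * \<mu>] (mod 8) \<and> [p = 3] (mod 4) \<and> Lp = 1 \<and> Lq = 1)
        \<or> ([int D = 3 * \<mu>] (mod 8) \<and> [p = 1] (mod 4) \<and> Lp = 1 \<and> Lq = 1)
        \<or> ([int D = \<mu>] (mod 8) \<and> Lp + Lq = 0))
     \<and> (\<delta> = real_of_int (2 * int n + 2 + \<mu>0) \<longleftrightarrow>
          ([int D = 7 * \<mu>] (mod 8) \<and> [p = 1] (mod 4) \<and> Lp = 1 \<and> Lq = 1)
        \<or> ([int D = 3 * \<mu>] (mod 8) \<and> [p = 3] (mod 4) \<and> Lp = 1 \<and> Lq = 1)
        \<or> ([int D = 5 * \<mu>] (mod 8) \<and> Lp + Lq = 0)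
        \<or> ([int D = 7 * \<mu>] (mod 8) \<and> [p = 3] (mod 4) \<and> Lp + Lq = 0)
        \<or> ([int D = 3 * \<mu>] (mod 8) \<and> [p = 1] (mod 4) \<and> Lp + Lq = 0)
        \<or> ([int D = \<mu>] (mod 8) \<and> Lp = -1 \<and> Lq = -1))
     \<and> (\<delta> = real_of_int (2 * int n + 3 + \<mu>0) \<longleftrightarrow>
          ([int D = 7 * \<mu>] (mod 8) \<and> [p = 1] (mod 4) \<and> Lp + Lq = 0)
        \<or> ([int D = 3 * \<mu>] (mod 8) \<and> [p = 3] (mod 4) \<and> Lp + Lq = 0)
        \<or> ([int D = 5 * \<mu>] (mod 8) \<and> Lp = -1 \<and> Lq = -1)
        \<or> ([int D = 7 * \<mu>] (mod 8) \<and> [p = 3] (mod 4) \<and> Lp = -1 \<and> Lq = -1)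
        \<or> ([int D = 3 * \<mu>] (mod 8) \<and> [p = 1] (mod 4) \<and> Lp = -1 \<and> Lq = -1))
     \<and> (\<delta> = real_of_int (2 * int n + 4 + \<mu>0) \<longleftrightarrow>
          ([int D = 7 * \<mu>] (mod 8) \<and> [p = 1] (mod 4) \<and> Lp = -1 \<and> Lq = -1)
        \<or> ([int D = 3 * \<mu>] (mod 8) \<and> [p = 3] (mod 4) \<and> Lp = -1 \<and> Lq = -1))"
proof -
  define a b d where abd: "a = \<epsilon> * int p" "b = \<epsilon> * int q" "d = \<mu> * int D"
  have pp: "odd_place p" "odd_place q" using assms(1-4) by unfold_locales auto
  have e: "\<epsilon> = 1 \<or> \<epsilon> = - 1" and m: "\<mu> = 1 \<or> \<mu> = - 1" using assms(6,12) by auto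
  have q: "int q = int p + 2" using assms(5) by simp
  have q': "q = p + 2" using q by simp
  have p2: "p > 2" "q > 2" using assms(1-4) prime_gt_1_nat[of p] q' by (cases "p = 2"; force)+
  have Sp: "prime l" "odd l" if "l \<in> S" for l using assms(9) that by auto
  have dvdD: "l dvd D" if "l \<in> S" for l unfolding assms(10) using assms(7) that by (rule dvd_prodI)
  have D0: "D \<noteq> 0" unfolding assms(10) using assms(7) Sp by (auto simp: prod_zero_iff)
  have primeD: "l \<in> S" if h: "prime l" "l dvd D" for l
  proof -
    obtain k where "k \<in> S" "l dvd k" using h assms(7) unfolding assms(10) by (auto simp: prime_dvd_prod_iff)
    then show ?thesis using primes_dvd_imp_eq[of l k] Sp h by auto
  qed
  have oddD: "odd D" using primeD[of 2] Sp(2)[of 2] by auto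
  have cop: "\<not> p dvd D" "\<not> q dvd D"
    using coprime_common_divisor[OF assms(11), of p] coprime_common_divisor[OF assms(11), of q] assms(1,2) not_prime_unit
    by auto
  have pqS: "p \<notin> S" "q \<notin> S" using cop dvdD by blast+
  have dp: "\<not> int p dvd d" "\<not> int q dvd d" using cop m by (auto simp: abd)
  have d0: "d \<noteq> 0" using D0 m by (auto simp: abd)
  \<comment> \<open>The differences of the roots are, up to sign, a, b and a - b = -2 \<epsilon>, so
    the curve has good reduction outside 2, p and q.\<close>
  have nd: "\<not> int l dvd a" "\<not> int l dvd b" "\<not> int l dvd a - b" if l: "prime l" "l \<noteq> p" "l \<noteq> q" "l \<noteq> 2" for l
  proof -
    have "\<not> l dvd p" "\<not> l dvd q" "\<not> l dvd 2"
      using primes_dvd_imp_eq[OF l(1)] assms(1,2) l two_is_prime_nat by blast+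
    then have "\<not> int l dvd int p" "\<not> int l dvd int q" "\<not> int l dvd 2"
      using of_nat_dvd_iff[of l 2, where 'a = int] by simp_all
    moreover have "a - b = \<epsilon> * - 2" using q by (simp add: abd algebra_simps)
    ultimately show "\<not> int l dvd a" "\<not> int l dvd b" "\<not> int l dvd a - b" using e by (auto simp: abd)
  qed
  have "p \<noteq> q" using q' by simp
  then have npq: "\<not> int p dvd int q" "\<not> int q dvd int p"
    using primes_dvd_imp_eq[of p q] primes_dvd_imp_eq[of q p] assms(1,2) by (simp_all add: of_nat_dvd_iff) blast+
  define pd where "pd = place_delta (a + b) (a * b) d"
  have \<delta>: "\<delta> = (\<Sum>v\<in>{v \<in> places_Q. pd v \<noteq> 0}. pd v)"
    by (simp add: \<delta>_def delta_EQK_def pd_def abd)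
  have pdS: "pd (Some l) = local_delta (Qp l) (Qp_of_int l) (a + b) (a * b) d" for l
    by (simp add: pd_def place_delta_def)
  have v_real: "pd None = (if \<mu> = - 1 then 1 else 0)"
  proof -
    have "0 < a \<and> a < b \<or> b < a \<and> a < 0" using e p2 q by (auto simp: abd)
    then have "pd None = (if d < 0 then 1 else 0)"
      using delta_real[of a b d] d0 by (simp add: pd_def place_delta_def)
    moreover have "d < 0 \<longleftrightarrow> \<mu> = - 1" using m D0 by (auto simp: abd)
    ultimately show ?thesis by simp
  qed
  have dodd: "odd d" using oddD m by (auto simp: abd)
  have v_two: "pd (Some 2) = (if d mod 8 = 1 then 0
     else if d mod 8 = 5 \<or> (d mod 8 = 7 \<and> int p mod 4 = 3) \<or> (d mod 8 = 3 \<and> int p mod 4 = 1) then 1 else 2)"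
    using delta_two[of "int p" \<epsilon> d] assms(3,6) dodd by (simp add: pdS abd q)
  have v_p: "pd (Some p) = (if Lp = 1 then 0 else 1)"
  proof -
    interpret odd_place p by (rule pp(1))
    have "\<not> int p dvd \<epsilon>" "\<not> int p dvd b"
      using e p2 npq by (auto simp: abd)
    then have "pd (Some p) = (if qchi p d = 0 then 0 else 1)"
      unfolding pdS using delta_multiplicative[of a \<epsilon> b d] dp by (simp add: abd mult.commute)
    moreover have "Lp = (if qchi p d = 0 then 1 else - 1)"
      unfolding Lp_def abd(3)[symmetric] by (rule Legendre_qchi) (rule dp)
    ultimately show ?thesis by simp
  qed
  have v_q: "pd (Some q) = (if Lq = 1 then 0 else 1)"
  proof -
    interpret odd_place q by (rule pp(2))
    have "\<not> int q dvd \<epsilon>" "\<not> int q dvd a"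
      using e p2 npq by (auto simp: abd)
    \<comment> \<open>The roles of a and b are interchanged, because q divides b; the equation of
      the curve is symmetric in them.\<close>
    then have "local_delta (Qp q) (Qp_of_int q) (b + a) (b * a) d = (if qchi q d = 0 then 0 else 1)"
      using delta_multiplicative[of b \<epsilon> a d] dp by (simp add: abd mult.commute)
    then have "pd (Some q) = (if qchi q d = 0 then 0 else 1)" unfolding pdS by (simp add: add.commute mult.commute)
    moreover have "Lq = (if qchi q d = 0 then 1 else - 1)"
      unfolding Lq_def abd(3)[symmetric] by (rule Legendre_qchi) (rule dp)
    ultimately show ?thesis by simp
  qed
  have v_S: "pd (Some l) = 2" if l: "l \<in> S" for l
  proof -
    interpret odd_place l using Sp[OF l] by unfold_locales
    have ne: "l \<noteq> p" "l \<noteq> q" "l \<noteq> 2" using l pqS Sp(2)[OF l] by auto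
    define D' where "D' = \<Prod>(S - {l})"
    have DD: "D = l * D'" unfolding assms(10) D'_def using prod.remove[OF assms(7) l] by simp
    have "\<not> l dvd D'"
    proof
      assume "l dvd D'"
      then obtain k where "k \<in> S - {l}" "l dvd k" unfolding D'_def using l_prime assms(7) by (auto simp: prime_dvd_prod_iff)
      then show False using primes_dvd_imp_eq[of l k] Sp l_prime by auto
    qed
    then have "\<not> int l dvd \<mu> * int D'" using m by auto
    moreover have "d = int l * (\<mu> * int D')" by (simp add: abd DD)
    ultimately show ?thesis unfolding pdS using delta_ramified nd[OF l_prime ne] by blast
  qed
  have v_other: "pd (Some l) = 0" if l: "prime l" "l \<noteq> 2" "l \<noteq> p" "l \<noteq> q" "l \<notin> S" for l
  proof -
    interpret odd_place l using l prime_odd_nat[of l] prime_ge_2_nat[of l] by unfold_locales auto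
    have "\<not> l dvd D" using primeD l by blast
    then have "\<not> int l dvd d" using m by (auto simp: abd)
    then show ?thesis unfolding pdS using delta_good nd[OF l(1) l(3,4,2)] by blast
  qed
  \<comment> \<open>The support over which the sum is defined is replaced by an explicit finite set
    of places, some of whose terms may vanish.\<close>
  define V where "V = insert None (insert (Some 2) (insert (Some p) (insert (Some q) (Some ` S))))"
  have "\<delta> = (\<Sum>v\<in>V. pd v)" unfolding \<delta>
  proof (rule sum.mono_neutral_left)
    show "finite V" unfolding V_def using assms(7) by simp
    show "{v \<in> places_Q. pd v \<noteq> 0} \<subseteq> V"
    proof
      fix v assume v: "v \<in> {v \<in> places_Q. pd v \<noteq> 0}"
      show "v \<in> V"
      proof (cases v)
        case None then show ?thesis by (simp add: V_def)
      next
        case (Some l)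
        then have "prime l" "pd (Some l) \<noteq> 0" using v by (auto simp: places_Q_def)
        then show ?thesis using v_other[of l] Some by (auto simp: V_def)
      qed
    qed
    have "V \<subseteq> places_Q" using assms(1,2) Sp by (auto simp: V_def places_Q_def)
    then show "\<forall>i\<in>V - {v \<in> places_Q. pd v \<noteq> 0}. pd i = 0" by blast
  qed
  also have "\<dots> = pd None + (pd (Some 2) + (pd (Some p) + (pd (Some q) + (\<Sum>v\<in>Some ` S. pd v))))"
  proof -
    have "2 \<notin> S" using Sp(2)[of 2] by auto
    then show ?thesis unfolding V_def using assms(7) pqS p2 q' by (simp add: image_iff)
  qed
  also have "(\<Sum>v\<in>Some ` S. pd v) = (\<Sum>l\<in>S. pd (Some l))" by (simp add: sum.reindex)
  also have "\<dots> = 2 * real n" using v_S assms(8) by simp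
  finally have tot: "\<delta> = pd None + (pd (Some 2) + (pd (Some p) + (pd (Some q) + 2 * real n)))" .
  have mu: "real_of_int \<mu>0 = pd None" unfolding v_real \<mu>0_def using m by auto
  have Lpv: "Lp = 1 \<or> Lp = - 1" unfolding Lp_def abd(3)[symmetric] using Legendre_qchi[OF dp(1)] by auto
  have Lqv: "Lq = 1 \<or> Lq = - 1" unfolding Lq_def abd(3)[symmetric] using Legendre_qchi[OF dp(2)] by auto
  \<comment> \<open>Multiplication by \<mu>, which is its own inverse, turns conditions on D into
    conditions on d = \<mu> D.\<close>
  have cong: "[int D = k * \<mu>] (mod 8) \<longleftrightarrow> d mod 8 = k mod 8" for k
  proof -
    have "\<mu> * \<mu> = 1" using m by auto
    then have "int D - k * \<mu> = \<mu> * (d - k)" by (simp add: abd algebra_simps flip: mult.assoc)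
    then have "8 dvd int D - k * \<mu> \<longleftrightarrow> 8 dvd d - k" using m dvd_diff_commute[of 8 k d] by auto
    then show ?thesis by (simp add: cong_iff_dvd_diff mod_eq_dvd_iff)
  qed
  have cong1: "[int D = \<mu>] (mod 8) \<longleftrightarrow> d mod 8 = 1" using cong[of 1] by simp
  have e4: "int p mod 4 = int (p mod 4)" by (simp add: zmod_int)
  have pk: "p mod 4 = k \<longleftrightarrow> int p mod 4 = int k" for k unfolding e4 of_nat_eq_iff ..
  have p4: "[p = 3] (mod 4) \<longleftrightarrow> int p mod 4 = 3" "[p = 1] (mod 4) \<longleftrightarrow> int p mod 4 = 1"
    using pk[of 3] pk[of 1] by (simp_all add: cong_def)
  have "odd (int p)" using assms(3) by simp
  then have p13: "int p mod 4 = 1 \<or> int p mod 4 = 3" by presburger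
  have d8: "d mod 8 = 1 \<or> d mod 8 = 3 \<or> d mod 8 = 5 \<or> d mod 8 = 7" using odd_mod_8[OF dodd] .
  have N: "real_of_int (2 * int n + \<mu>0) = 2 * real n + pd None"
    "real_of_int (2 * int n + 1 + \<mu>0) = 2 * real n + 1 + pd None" "real_of_int (2 * int n + 2 + \<mu>0) = 2 * real n + 2 + pd None"
    "real_of_int (2 * int n + 3 + \<mu>0) = 2 * real n + 3 + pd None" "real_of_int (2 * int n + 4 + \<mu>0) = 2 * real n + 4 + pd None"
    using mu by simp_all
  \<comment> \<open>n and \<mu>0 contribute equally to both sides of every comparison. What remains
    is a finite check over the signs Lp and Lq, p mod 4 and d mod 8.\<close>
  define x where "x = pd None"
  define z where "z = 2 * real n"
  show ?thesis
    unfolding N cong cong1 p4 tot v_two v_p v_q x_def[symmetric] z_def[symmetric]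
    using Lpv Lqv p13 d8 by (elim disjE) simp_all
qed

end
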